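(* Let $(g,\lambda,1)$ be an orthosymmetric real type and let $\tau\in\mathcal H_{g,\lambda,1}$. Let $\mathbf R_{\not\ni 0}$ be a connected component of the locus of real points of the real principally polarized abelian variety $(A(\tau),S_{conj})$ which does not contain the zero of $A(\tau)$. Then $$\dim\big((\Theta_\tau)\cap\mathbf R_{\not\ni0}\big)=g-1,$$ where $(\Theta_\tau)$ is the theta divisor on $A(\tau)$ and $\dim$ is the dimension as a real analytic variety.
   Context: An orthosymmetric real type is a triple $(g,\lambda,1)$ of integers with $g\ge1$, $0\le\lambda\le g$ and $\lambda$ even; write $\lambda=2\lambda_0$. Let $M=M_{g,\lambda,1}$ be the $g\times g$ matrix $\begin{bmatrix} M_{\lambda,\lambda,1}&0\\0&0\end{bmatrix}$ with $M_{\lambda,\lambda,1}=\begin{bmatrix}0&\mathrm{Id}_{\lambda_0}\\ \mathrm{Id}_{\lambda_0}&0\end{bmatrix}$. $\mathcal H_g$ is the Siegel upper half space of complex symmetric $g\times g$ matrices with positive definite imaginary part, and $\mathcal H_{g,\lambda,1}=\{\tau\in\mathcal H_g: 2\,\mathrm{Re}(\tau)=M\}$. $A(\tau)$ is the torus $\mathbb C^g/\Lambda(\tau)$, $\Lambda(\tau)=\mathbb Z^g+\tau\mathbb Z^g$, with its standard principal polarization; $S_{conj}$ is the anti-holomorphic involution $[z]\mapsto[\bar z]$; real points are its fixed points. The theta function is $\Theta(z;\tau)=\sum_{m\in\mathbb Z^g}\exp(\pi i\,m^{\top}\tau m+2\pi i\,m^{\top}z)$ and $(\Theta_\tau)=\{[z]\in\mathbb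 C^g/\Lambda(\tau):\Theta(z;\tau)=0\}$. Known description of the components: the real locus has $2^{g-\lambda}$ connected components, namely $\{[z]: z\in\mathbb R^g\}$ (the one containing zero) and, if $\lambda<g$, for each nonzero $q\in\{0,1\}^{g-\lambda}$, the set $\{[\tau\alpha+\beta]:\alpha,\beta\in\mathbb R^g,\ 2\alpha=\left[\begin{smallmatrix}0\\ q\end{smallmatrix}\right]\}$. (If $\lambda=g$ there is no component not containing zero.) *)

theory Defs
  imports "HOL-Analysis.Analysis"
begin

section \<open>Orthosymmetric real types and period matrices\<close>

text \<open>
  The triple is \<open>(g, \<lambda>, 1)\<close>; its last entry is constant and is not carried along.
\<close>

definition orthosymmetric_type :: "nat \<Rightarrow> nat \<Rightarrow> bool" where
  "orthosymmetric_type g lam \<longleftrightarrow> g \<ge> 1 \<and> lam \<le> g \<and> even lam"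

text \<open>
  The dimension \<open>g\<close> is \<open>CARD('n)\<close>.  The block matrix needs an order of the coordinates, whence the
  class \<open>linorder\<close>; positions are counted from \<open>0\<close>, so the upper right identity block of size
  \<open>\<lambda>\<^sub>0 = \<lambda> / 2\<close> has its entries at \<open>(k, k + \<lambda>\<^sub>0)\<close> for \<open>k < \<lambda>\<^sub>0\<close>.
\<close>

definition pos :: "'n::{finite,linorder} \<Rightarrow> nat" where
  "pos i = card {j. j < i}"

definition M_matrix :: "nat \<Rightarrow> real^('n::{finite,linorder})^('n::{finite,linorder})" where
  "M_matrix lam = (\<chi> i j.
     if (pos i < lam div 2 \<and> pos j = pos i + lam div 2) \<or>
        (pos j < lam div 2 \<and> pos i = pos j + lam div 2) then 1 else 0)"

definition siegel :: "(complex^'n^'n) set" where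
  "siegel = {\<tau>. transpose \<tau> = \<tau> \<and>
                 (\<forall>x::real^'n. x \<noteq> 0 \<longrightarrow> x \<bullet> ((\<chi> i j. Im (\<tau>$i$j)) *v x) > 0)}"

definition siegel_real :: "nat \<Rightarrow> (complex^('n::{finite,linorder})^('n::{finite,linorder})) set" where
  "siegel_real lam = {\<tau> \<in> siegel. (\<chi> i j. 2 * Re (\<tau>$i$j)) = M_matrix lam}"


section \<open>The torus, its topology and its real points\<close>

definition cvec :: "int^'n \<Rightarrow> complex^'n" where
  "cvec m = (\<chi> i. of_int (m$i))"

definition lattice :: "complex^'n^'n \<Rightarrow> (complex^'n) set" where
  "lattice \<tau> = {cvec m + \<tau> *v cvec n | m n. True}"

definition tproj :: "complex^'n^'n \<Rightarrow> complex^'n \<Rightarrow> (complex^'n) set" where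
  "tproj \<tau> z = (\<lambda>l. z + l) ` lattice \<tau>"

definition torus :: "complex^'n^'n \<Rightarrow> (complex^'n) set set" where
  "torus \<tau> = range (tproj \<tau>)"

text \<open>The quotient topology\<close>

definition torus_topology :: "complex^'n^'n \<Rightarrow> (complex^'n) set topology" where
  "torus_topology \<tau> = topology (\<lambda>U. U \<subseteq> torus \<tau> \<and> open (tproj \<tau> -` U))"

lemma openin_torus_topology:
  "openin (torus_topology \<tau>) U \<longleftrightarrow> U \<subseteq> torus \<tau> \<and> open (tproj \<tau> -` U)"
proof -
  have "istopology (\<lambda>U. U \<subseteq> torus \<tau> \<and> open (tproj \<tau> -` U))"
    unfolding istopology_def
    by (auto simp: vimage_Int vimage_Union intro!: open_Int open_UN)
  then show ?thesis
    by (simp add: torus_topology_def topology_inverse')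
qed

lemma topspace_torus_topology: "topspace (torus_topology \<tau>) = torus \<tau>"
  by (rule subset_antisym)
     (auto simp: topspace_def openin_torus_topology torus_def vimage_def)

definition cnj_vec :: "complex^'n \<Rightarrow> complex^'n" where
  "cnj_vec z = (\<chi> i. cnj (z$i))"

text \<open>
  Conjugation of the coset \<open>[z]\<close> as a set; \<open>S_conj_tproj\<close> below shows that this is \<open>[z] \<mapsto> [cnj z]\<close>
  for the period matrices at hand.
\<close>

definition S_conj :: "(complex^'n) set \<Rightarrow> (complex^'n) set" where
  "S_conj P = cnj_vec ` P"

definition real_points :: "complex^'n^'n \<Rightarrow> (complex^'n) set set" where
  "real_points \<tau> = {P \<in> torus \<tau>. S_conj P = P}"

definition real_components :: "complex^'n^'n \<Rightarrow> (complex^'n) set set set" where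
  "real_components \<tau> =
     connected_components_of (subtopology (torus_topology \<tau>) (real_points \<tau>))"

lemma cnj_vec_add: "cnj_vec (z + w) = cnj_vec z + cnj_vec w"
  by (simp add: cnj_vec_def vec_eq_iff)

lemma cnj_vec_lattice:
  fixes \<tau> :: "complex^('n::{finite,linorder})^('n::{finite,linorder})"
  assumes \<tau>: "\<tau> \<in> siegel_real lam"
  shows "cnj_vec ` lattice \<tau> = lattice \<tau>"
proof -
  define N :: "int^('n::{finite,linorder})^('n::{finite,linorder})" where
    "N = (\<chi> i j. if (pos i < lam div 2 \<and> pos j = pos i + lam div 2) \<or>
        (pos j < lam div 2 \<and> pos i = pos j + lam div 2) then 1 else 0)"
  have MN: "M_matrix lam $ i $ j = of_int (N$i$j)" for i j
    by (simp add: M_matrix_def N_def)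
  have "(\<chi> i j. 2 * Re (\<tau>$i$j)) = M_matrix lam"
    using \<tau> by (simp add: siegel_real_def)
  then have re: "2 * Re (\<tau>$i$j) = of_int (N$i$j)" for i j
    by (metis MN vec_lambda_beta)
  have cnj_entry: "cnj (\<tau>$i$j) = of_int (N$i$j) - \<tau>$i$j" for i j
    using re[of i j] by (simp add: complex_eq_iff)
  have conj_mem: "cnj_vec (cvec m + \<tau> *v cvec n) = cvec (m + N *v n) + \<tau> *v cvec (- n)" for m n
    by (simp add: cnj_vec_def cvec_def vec_eq_iff matrix_vector_mult_def cnj_entry
        left_diff_distrib sum_subtractf sum_negf)
  have sub: "cnj_vec ` lattice \<tau> \<subseteq> lattice \<tau>"
    unfolding lattice_def using conj_mem by blast
  have "cnj_vec (cnj_vec z) = z" for z :: "complex^('n::{finite,linorder})"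
    by (simp add: cnj_vec_def)
  then have "lattice \<tau> \<subseteq> cnj_vec ` lattice \<tau>"
    using sub by (metis image_subset_iff rev_image_eqI subsetI)
  with sub show ?thesis by (rule subset_antisym)
qed

lemma S_conj_tproj:
  assumes "\<tau> \<in> siegel_real lam"
  shows "S_conj (tproj \<tau> z) = tproj \<tau> (cnj_vec z)"
proof -
  have "S_conj (tproj \<tau> z) = (\<lambda>l. cnj_vec z + l) ` (cnj_vec ` lattice \<tau>)"
    by (simp add: S_conj_def tproj_def image_image cnj_vec_add)
  then show ?thesis
    by (simp add: cnj_vec_lattice[OF assms] tproj_def)
qed


section \<open>The theta divisor\<close>

text \<open>The bilinear product \<open>u\<^sup>T v\<close>; the library's inner product on \<open>\<complex>\<^sup>g\<close> is the real one.\<close>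

definition cdot :: "complex^'n \<Rightarrow> complex^'n \<Rightarrow> complex" where
  "cdot u v = (\<Sum>i\<in>UNIV. u$i * v$i)"

definition theta :: "complex^'n^'n \<Rightarrow> complex^'n \<Rightarrow> complex" where
  "theta \<tau> z = (\<Sum>\<^sub>\<infinity>m::int^'n\<in>UNIV.
     exp (of_real pi * \<i> * cdot (cvec m) (\<tau> *v cvec m) + 2 * of_real pi * \<i> * cdot (cvec m) z))"

definition theta_divisor :: "complex^'n^'n \<Rightarrow> (complex^'n) set set" where
  "theta_divisor \<tau> = {tproj \<tau> z | z. theta \<tau> z = 0}"


section \<open>Real analytic dimension\<close>

text \<open>
  Locally the sum of a power series in the coordinates; the multi-indices are the functions from
  the basis to the naturals.
\<close>

definition real_analytic_on ::
  "('a::euclidean_space \<Rightarrow> 'b::real_normed_vector) \<Rightarrow> 'a set \<Rightarrow> bool" where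
  "real_analytic_on f A \<longleftrightarrow>
     (\<forall>a\<in>A. \<exists>(c :: ('a \<Rightarrow> nat) \<Rightarrow> 'b) r. r > 0 \<and>
        (\<forall>x\<in>ball a r.
           ((\<lambda>k. (\<Prod>b\<in>Basis. ((x - a) \<bullet> b) ^ k b) *\<^sub>R c k) has_sum f x)
             (Basis \<rightarrow>\<^sub>E (UNIV :: nat set))))"

text \<open>
  Embedded, not necessarily closed, submanifolds of pure dimension \<open>d\<close>.  The empty set qualifies
  for every \<open>d\<close>.
\<close>

definition analytic_submanifold :: "nat \<Rightarrow> 'a::euclidean_space set \<Rightarrow> bool" where
  "analytic_submanifold d S \<longleftrightarrow>
     (\<forall>a\<in>S. \<exists>U W (\<phi> :: 'a \<Rightarrow> 'a) \<psi> L.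
        open U \<and> a \<in> U \<and> open W \<and> homeomorphism U W \<phi> \<psi> \<and>
        real_analytic_on \<phi> U \<and> real_analytic_on \<psi> W \<and>
        subspace L \<and> dim L = d \<and> \<phi> ` (S \<inter> U) = L \<inter> W)"

text \<open>
  The torus carries the real analytic structure, of dimension \<open>2g\<close>, whose charts are the inverses
  of the quotient map on open sets where it is injective.
\<close>

definition torus_submanifold ::
  "complex^'n^'n \<Rightarrow> nat \<Rightarrow> (complex^'n) set set \<Rightarrow> bool" where
  "torus_submanifold \<tau> d N \<longleftrightarrow>
     N \<subseteq> torus \<tau> \<and>
     (\<forall>U. open U \<and> inj_on (tproj \<tau>) U \<longrightarrow> analytic_submanifold d (U \<inter> tproj \<tau> -` N))"

text \<open>
  The dimension of a real analytic set is the largest dimension of a nonempty analytic submanifold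
  contained in it; that of the empty set is \<open>-\<infinity>\<close>.
\<close>

definition real_analytic_dim ::
  "complex^'n^'n \<Rightarrow> (complex^'n) set set \<Rightarrow> ereal" where
  "real_analytic_dim \<tau> X =
     (SUP d \<in> {d. \<exists>N. N \<noteq> {} \<and> N \<subseteq> X \<and> torus_submanifold \<tau> d N}. ereal (real d))"

end

theory Submission
  imports Defs "HOL-Complex_Analysis.Complex_Analysis"
begin

text \<open>
  Let \<open>\<tau> = M / 2 + \<i> Y\<close>.  A component of the real locus is \<open>[\<tau> \<alpha> + \<real>\<^sup>g]\<close> with \<open>2 \<alpha>\<close> and \<open>M \<alpha>\<close>
  integral, and it misses \<open>0\<close> only if some \<open>2 \<alpha>\<^sub>j\<close> is odd.  Up to a nowhere vanishing factor the theta
  function on it is a real-valued trigonometric series \<open>F\<close> with nonzero, rapidly decreasing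
  coefficients, and \<open>F (x + e\<^sub>j) = - F x\<close>.

  Upper bound: a submanifold of dimension at least \<open>g\<close> would, by invariance of domain, make \<open>F\<close>
  vanish on an open set, hence identically, hence all coefficients would vanish.

  Lower bound: since \<open>F\<close> changes sign in direction \<open>e\<^sub>j\<close>, consider the zeros of the entire functions
  \<open>w \<mapsto> F (x + w e\<^sub>j)\<close> at which a sign change occurs, and among all \<open>x\<close> one of least multiplicity.  Near
  it the sign-changing zero is unique in a fixed disc and has constant multiplicity, so it is a
  contour integral that depends analytically on \<open>x\<close>; its graph is a hypersurface of zeros.
\<close>

no_notation fps_nth (infixl \<open>$\<close> 75)
no_notation Infinite_Set_Sum.abs_summable_on (infix \<open>abs'_summable'_on\<close> 50)

section \<open>Absolutely convergent power series with parameters\<close>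

text \<open>A zero of a real analytic function need not lie on a hypersurface (a sum of squares
  vanishes at a point), and nothing excludes that the derivative of \<open>F\<close> in direction
  \<open>e_j\<close> vanishes at every real zero, so the implicit function theorem is of no direct
  use. A change of sign cures the first problem: it survives small perturbations, so neighbouring
  lines carry one too. Least multiplicity cures the second: the zeros in a small disc have constant
  total multiplicity, and a sign-changing zero already uses up all of it, so no other zero is left.
  The contour integral of \<open>w F'/F\<close> is then analytic in the line even if the zero is
  multiple. Analyticity is stated through multi-index series; products, reciprocals and circle
  integrals of such series are therefore controlled by explicit majorants. Charts live in the
  ambient space of real dimension \<open>2g\<close>, so the zero becomes a function on an open set
  of complex vectors that depends only on their real coordinates other than the
  \<open>j\<close>-th.\<close>

definition mpow :: "('a::euclidean_space \<Rightarrow> nat) \<Rightarrow> 'a \<Rightarrow> real" where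
  "mpow k x = (\<Prod>b\<in>Basis. (x \<bullet> b) ^ k b)"

definition mdeg :: "('a::euclidean_space \<Rightarrow> nat) \<Rightarrow> nat" where
  "mdeg k = (\<Sum>b\<in>Basis. k b)"

lemma mdeg_zero [simp]: "mdeg (\<lambda>_. 0) = 0"
  by (simp add: mdeg_def)

lemma mpow_zero [simp]: "mpow (\<lambda>_. 0) x = 1"
  by (simp add: mpow_def)

lemma mdeg_add: "mdeg (\<lambda>b. k b + l b) = mdeg k + mdeg l"
  by (simp add: mdeg_def sum.distrib)

lemma mpow_add: "mpow (\<lambda>b. k b + l b) x = mpow k x * mpow l x"
  by (simp add: mpow_def power_add prod.distrib)

lemma mpow_restrict: "mpow (restrict k Basis) x = mpow k x"
  by (simp add: mpow_def)

lemma mpow_at_0: "mpow k 0 = (if mdeg k = 0 then 1 else 0)"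
  by (auto simp: mpow_def mdeg_def)

lemma mpow_mdeg_0: "mdeg k = 0 \<Longrightarrow> mpow k x = 1"
  by (auto simp: mpow_def mdeg_def)

lemma abs_mpow_le:
  assumes "norm x \<le> R"
  shows "\<bar>mpow k x\<bar> \<le> R ^ mdeg k"
proof -
  have "\<bar>mpow k x\<bar> = (\<Prod>b\<in>Basis. \<bar>x \<bullet> b\<bar> ^ k b)"
    by (simp add: mpow_def abs_prod power_abs)
  also have "\<dots> \<le> (\<Prod>b\<in>Basis. R ^ k b)"
    using assms by (intro prod_mono conjI power_mono) (auto intro: Basis_le_norm order_trans)
  also have "\<dots> = R ^ mdeg k"
    by (simp add: mdeg_def power_sum)
  finally show ?thesis .
qed

text \<open>Terms may share a multi-index here; collecting them gives the series of the definition.\<close>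

lemma real_analytic_onI:
  fixes f :: "'a::euclidean_space \<Rightarrow> 'b::banach"
  assumes "\<And>a. a \<in> A \<Longrightarrow> \<exists>(I::'i set) \<kappa> e R. R > 0 \<and>
      (\<lambda>n. norm (e n) * R ^ mdeg (\<kappa> n)) summable_on I \<and>
      (\<forall>x\<in>ball a R. ((\<lambda>n. mpow (\<kappa> n) (x - a) *\<^sub>R e n) has_sum f x) I)"
  shows "real_analytic_on f A"
  unfolding real_analytic_on_def
proof
  fix a assume "a \<in> A"
  then obtain I :: "'i set" and \<kappa> e R where R: "R > 0"
    and sm: "(\<lambda>n. norm (e n) * R ^ mdeg (\<kappa> n)) summable_on I"
    and hs: "\<And>x. x \<in> ball a R \<Longrightarrow> ((\<lambda>n. mpow (\<kappa> n) (x - a) *\<^sub>R e n) has_sum f x) I"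
    using assms by blast
  define \<kappa>' where "\<kappa>' n = restrict (\<kappa> n) Basis" for n
  define J where "J k = {n\<in>I. \<kappa>' n = k}" for k
  have k': "\<kappa>' n \<in> Basis \<rightarrow>\<^sub>E UNIV" for n by (simp add: \<kappa>'_def)
  have md: "mdeg (\<kappa>' n) = mdeg (\<kappa> n)" for n by (simp add: \<kappa>'_def mdeg_def)
  \<comment> \<open>On \<open>J k\<close> the weight is the positive constant
    \<open>R ^ mdeg k\<close>, so it can be divided out of the majorant.\<close>
  have sumJ: "e summable_on J k" for k
  proof (rule abs_summable_summable)
    have "(\<lambda>n. norm (e n) * R ^ mdeg (\<kappa> n)) summable_on J k"
      by (rule summable_on_subset_banach[OF sm]) (auto simp: J_def)
    then have "(\<lambda>n. norm (e n) * R ^ mdeg k) summable_on J k"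
      by (rule summable_on_cong[THEN iffD1, rotated]) (auto simp: J_def md)
    then have "(\<lambda>n. norm (e n) * R ^ mdeg k * inverse (R ^ mdeg k)) summable_on J k"
      by (rule summable_on_cmult_left)
    then show "(\<lambda>n. norm (e n)) summable_on J k"
      using R by (simp add: mult.assoc)
  qed
  have "((\<lambda>k. mpow k (x - a) *\<^sub>R infsum e (J k)) has_sum f x) (Basis \<rightarrow>\<^sub>E UNIV)"
    if x: "x \<in> ball a R" for x
  proof -
    have "((\<lambda>p. mpow (fst p) (x - a) *\<^sub>R e (snd p)) has_sum f x) (Sigma (Basis \<rightarrow>\<^sub>E UNIV) J)
       \<longleftrightarrow> ((\<lambda>n. mpow (\<kappa> n) (x - a) *\<^sub>R e n) has_sum f x) I"
      by (rule has_sum_reindex_bij_witness[where j = snd and i = "\<lambda>n. (\<kappa>' n, n)"])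
         (use k' in \<open>auto simp: J_def mpow_restrict \<kappa>'_def\<close>)
    then have 1: "((\<lambda>p. mpow (fst p) (x - a) *\<^sub>R e (snd p)) has_sum f x) (Sigma (Basis \<rightarrow>\<^sub>E UNIV) J)"
      using hs[OF x] by simp
    show ?thesis
    proof (rule has_sum_SigmaD[OF 1])
      show "((\<lambda>y. mpow (fst (k, y)) (x - a) *\<^sub>R e (snd (k, y))) has_sum
          mpow k (x - a) *\<^sub>R infsum e (J k)) (J k)" for k
        using has_sum_scaleR[OF has_sum_infsum[OF sumJ]] by simp
    qed
  qed
  then show "\<exists>c r. r > 0 \<and> (\<forall>x\<in>ball a r. ((\<lambda>k. (\<Prod>b\<in>Basis. ((x - a) \<bullet> b) ^ k b) *\<^sub>R c k) has_sum f x)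
             (Basis \<rightarrow>\<^sub>E (UNIV :: nat set)))"
    using R unfolding mpow_def by (intro exI[of _ "\<lambda>k. infsum e (J k)"] exI[of _ R]) blast
qed

text \<open>
  Power series in \<open>x - a\<close> whose coefficients are continuous functions of a parameter in \<open>K\<close>, with a
  convergent majorant independent of the parameter.  Numbering the terms by natural numbers
  instead of by multi-indices lets products and geometric series be formed without collecting terms.
\<close>

definition ps_expansion ::
  "complex set \<Rightarrow> 'a::euclidean_space \<Rightarrow> real \<Rightarrow> ('a \<Rightarrow> complex \<Rightarrow> complex) \<Rightarrow>
   nat set \<Rightarrow> (nat \<Rightarrow> 'a \<Rightarrow> nat) \<Rightarrow> (nat \<Rightarrow> complex \<Rightarrow> complex) \<Rightarrow> (nat \<Rightarrow> real) \<Rightarrow> bool" where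
  "ps_expansion K a R f I \<kappa> d M \<longleftrightarrow>
     (\<forall>n\<in>I. 0 \<le> M n \<and> continuous_on K (d n) \<and> (\<forall>w\<in>K. norm (d n w) \<le> M n)) \<and>
     (\<lambda>n. M n * R ^ mdeg (\<kappa> n)) summable_on I \<and>
     (\<forall>x\<in>ball a R. \<forall>w\<in>K. ((\<lambda>n. of_real (mpow (\<kappa> n) (x - a)) * d n w) has_sum f x w) I)"

definition unif_ps ::
  "complex set \<Rightarrow> 'a::euclidean_space \<Rightarrow> real \<Rightarrow> ('a \<Rightarrow> complex \<Rightarrow> complex) \<Rightarrow> bool" where
  "unif_ps K a R f \<longleftrightarrow> (\<exists>I \<kappa> d M. ps_expansion K a R f I \<kappa> d M)"

lemma ps_expansionD:
  assumes "ps_expansion K a R f I \<kappa> d M"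
  shows "\<And>n. n \<in> I \<Longrightarrow> 0 \<le> M n" "\<And>n. n \<in> I \<Longrightarrow> continuous_on K (d n)"
    "\<And>n w. n \<in> I \<Longrightarrow> w \<in> K \<Longrightarrow> norm (d n w) \<le> M n"
    "(\<lambda>n. M n * R ^ mdeg (\<kappa> n)) summable_on I"
    "\<And>x w. x \<in> ball a R \<Longrightarrow> w \<in> K \<Longrightarrow>
       ((\<lambda>n. of_real (mpow (\<kappa> n) (x - a)) * d n w) has_sum f x w) I"
  using assms unfolding ps_expansion_def by blast+

text \<open>A definition cannot quantify over index types, so every countable index set is
  renumbered by naturals here: pairs for products, lists for geometric series, lattice points paired
  with multi-indices for theta series.\<close>

lemma unif_psI:
  fixes \<kappa> :: "'i \<Rightarrow> 'a::euclidean_space \<Rightarrow> nat"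
  assumes I: "countable I"
    and d: "\<And>i. i \<in> I \<Longrightarrow> continuous_on K (d i)"
    and M: "\<And>i w. i \<in> I \<Longrightarrow> w \<in> K \<Longrightarrow> norm (d i w) \<le> M i"
    and M0: "\<And>i. i \<in> I \<Longrightarrow> 0 \<le> M i"
    and sm: "(\<lambda>i. M i * R ^ mdeg (\<kappa> i)) summable_on I"
    and hs: "\<And>x w. x \<in> ball a R \<Longrightarrow> w \<in> K \<Longrightarrow>
       ((\<lambda>i. of_real (mpow (\<kappa> i) (x - a)) * d i w) has_sum f x w) I"
  shows "unif_ps K a R f"
proof -
  define g where "g = from_nat_into I"
  define J where "J = to_nat_on I ` I"
  have bij: "bij_betw g J I"
    unfolding g_def J_def using I
    by (auto simp: bij_betw_def inj_on_def image_image from_nat_into_to_nat_on)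
  then have gI: "g n \<in> I" if "n \<in> J" for n using that by (auto simp: bij_betw_def)
  show ?thesis
    unfolding unif_ps_def ps_expansion_def
  proof (intro exI[of _ J] exI[of _ "\<kappa> \<circ> g"] exI[of _ "d \<circ> g"] exI[of _ "M \<circ> g"] conjI ballI)
    show "(\<lambda>n. (M \<circ> g) n * R ^ mdeg ((\<kappa> \<circ> g) n)) summable_on J"
      using summable_on_reindex_bij_betw[OF bij, of "\<lambda>i. M i * R ^ mdeg (\<kappa> i)"] sm by simp
  next
    fix x w assume "x \<in> ball a R" "w \<in> K"
    then show "((\<lambda>n. of_real (mpow ((\<kappa> \<circ> g) n) (x - a)) * (d \<circ> g) n w) has_sum f x w) J"
      using has_sum_reindex_bij_betw[OF bij, of "\<lambda>i. of_real (mpow (\<kappa> i) (x - a)) * d i w"] hs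
      by simp
  qed (use gI d M M0 in auto)
qed

lemma unif_ps_mono:
  assumes "unif_ps K a R f" "0 \<le> R'" "R' \<le> R"
  shows "unif_ps K a R' f"
proof -
  obtain I \<kappa> d M where E: "ps_expansion K a R f I \<kappa> d M"
    using assms(1) unfolding unif_ps_def by blast
  note M0 = ps_expansionD(1)[OF E] and c = ps_expansionD(2)[OF E]
    and M = ps_expansionD(3)[OF E] and sm = ps_expansionD(4)[OF E]
    and hs = ps_expansionD(5)[OF E]
  show ?thesis
  proof (rule unif_psI[OF _ c M M0])
    show "(\<lambda>n. M n * R' ^ mdeg (\<kappa> n)) summable_on I"
      by (rule summable_on_comparison_test[OF sm])
         (use assms M0 in \<open>auto intro!: mult_left_mono power_mono\<close>)
  qed (use hs assms in auto)
qed

lemma unif_ps_cong: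
  assumes "unif_ps K a R f" "\<And>x w. x \<in> ball a R \<Longrightarrow> w \<in> K \<Longrightarrow> f x w = g x w"
  shows "unif_ps K a R g"
proof -
  obtain I \<kappa> d M where E: "ps_expansion K a R f I \<kappa> d M"
    using assms(1) unfolding unif_ps_def by blast
  note M0 = ps_expansionD(1)[OF E] and c = ps_expansionD(2)[OF E]
    and M = ps_expansionD(3)[OF E] and sm = ps_expansionD(4)[OF E]
    and hs = ps_expansionD(5)[OF E]
  show ?thesis
    by (rule unif_psI[OF _ c M M0 sm]) (use hs assms(2) in auto)
qed

text \<open>A function of the parameter alone is a single term of degree 0; compactness supplies its
  constant majorant.\<close>

lemma unif_ps_parameter:
  assumes "continuous_on K g" "compact K"
  shows "unif_ps K a R (\<lambda>x. g)"
proof -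
  obtain B where B: "\<And>w. w \<in> K \<Longrightarrow> norm (g w) \<le> B" "B > 0"
    using compact_imp_bounded[OF compact_continuous_image[OF assms]] by (auto simp: bounded_pos)
  show ?thesis
    by (rule unif_psI[of "{()}" K "\<lambda>_. g" "\<lambda>_. B" R "\<lambda>_ _. 0"])
       (use assms B in \<open>auto simp: has_sum_finite_iff\<close>)
qed

section \<open>Products, geometric series and reciprocals\<close>

lemma has_sum_product:
  fixes u :: "'i \<Rightarrow> 'c::{real_normed_div_algebra,banach}" and v :: "'j \<Rightarrow> 'c"
  assumes "u abs_summable_on I" "v abs_summable_on J" "(u has_sum s) I" "(v has_sum t) J"
  shows "(\<lambda>(i, j). u i * v j) abs_summable_on I \<times> J"
    and "((\<lambda>(i, j). u i * v j) has_sum s * t) (I \<times> J)"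
proof -
  show 1: "(\<lambda>(i, j). u i * v j) abs_summable_on I \<times> J"
  proof (rule summable_on_SigmaI)
    show "((\<lambda>y. norm (case (x, y) of (i, j) \<Rightarrow> u i * v j)) has_sum (norm (u x) * (\<Sum>\<^sub>\<infinity>j\<in>J. norm (v j)))) J" for x
      using has_sum_cmult_right[OF has_sum_infsum[OF assms(2)]] by (simp add: norm_mult)
    show "(\<lambda>x. norm (u x) * (\<Sum>\<^sub>\<infinity>j\<in>J. norm (v j))) summable_on I"
      by (rule summable_on_cmult_left[OF assms(1)])
  qed auto
  show "((\<lambda>(i, j). u i * v j) has_sum s * t) (I \<times> J)"
  proof (rule has_sum_SigmaI[where g = "\<lambda>i. u i * t"])
    show "(\<lambda>(i, j). u i * v j) summable_on I \<times> J"
      by (rule abs_summable_summable[OF 1])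
  qed (use assms in \<open>auto intro: has_sum_cmult_right has_sum_cmult_left\<close>)
qed

lemma unif_ps_term_abs_summable:
  assumes M: "\<And>n. n \<in> I \<Longrightarrow> norm (d n) \<le> M n"
    and sm: "(\<lambda>n. M n * R ^ mdeg (\<kappa> n)) summable_on I" and x: "norm x \<le> R"
  shows "(\<lambda>n. of_real (mpow (\<kappa> n) x) * (d n :: complex)) abs_summable_on I"
proof (rule Infinite_Sum.abs_summable_on_comparison_test'[OF sm])
  fix n assume n: "n \<in> I"
  have "norm (of_real (mpow (\<kappa> n) x) * d n) \<le> R ^ mdeg (\<kappa> n) * M n"
    unfolding norm_mult using abs_mpow_le[OF x] M[OF n]
    by (intro mult_mono zero_le_power order_trans[OF norm_ge_zero x]) auto
  then show "norm (of_real (mpow (\<kappa> n) x) * d n) \<le> M n * R ^ mdeg (\<kappa> n)"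
    by (simp add: mult.commute)
qed

text \<open>Terms are indexed by pairs: multi-indices add and majorants multiply. Different pairs
  may yield the same monomial, which the numbering tolerates.\<close>

lemma unif_ps_mult:
  assumes "unif_ps K a R f" "unif_ps K a R g" "0 \<le> R"
  shows "unif_ps K a R (\<lambda>x w. f x w * g x w)"
proof -
  obtain I \<kappa> d M where E: "ps_expansion K a R f I \<kappa> d M"
    using assms(1) unfolding unif_ps_def by blast
  note M0 = ps_expansionD(1)[OF E] and c = ps_expansionD(2)[OF E]
    and M = ps_expansionD(3)[OF E] and sm = ps_expansionD(4)[OF E]
    and hs = ps_expansionD(5)[OF E]
  obtain I' \<kappa>' d' M' where E': "ps_expansion K a R g I' \<kappa>' d' M'"
    using assms(2) unfolding unif_ps_def by blast
  note M0' = ps_expansionD(1)[OF E'] and c' = ps_expansionD(2)[OF E']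
    and M' = ps_expansionD(3)[OF E'] and sm' = ps_expansionD(4)[OF E']
    and hs' = ps_expansionD(5)[OF E']
  show ?thesis
  proof (rule unif_psI[where I = "I \<times> I'" and d = "\<lambda>(i,j) w. d i w * d' j w" and
        M = "\<lambda>(i,j). M i * M' j" and \<kappa> = "\<lambda>(i,j) b. \<kappa> i b + \<kappa>' j b"])
    have "(\<lambda>(i, j). (M i * R ^ mdeg (\<kappa> i)) * (M' j * R ^ mdeg (\<kappa>' j))) abs_summable_on I \<times> I'"
      using summable_on_iff_abs_summable_on_real sm sm'
      by (intro has_sum_product(1)[OF _ _ has_sum_infsum[OF sm] has_sum_infsum[OF sm']]) fast+
    then have "(\<lambda>(i, j). (M i * R ^ mdeg (\<kappa> i)) * (M' j * R ^ mdeg (\<kappa>' j))) summable_on I \<times> I'"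
      by (rule abs_summable_summable)
    then show "(\<lambda>p. (case p of (i, j) \<Rightarrow> M i * M' j) *
           R ^ mdeg (case p of (i, j) \<Rightarrow> \<lambda>b. \<kappa> i b + \<kappa>' j b)) summable_on I \<times> I'"
      by (rule summable_on_cong[THEN iffD1, rotated]) (auto simp: mdeg_add power_add)
  next
    fix x w assume x: "x \<in> ball a R" and w: "w \<in> K"
    have nx: "norm (x - a) \<le> R" using x by (simp add: dist_norm norm_minus_commute)
    have "((\<lambda>(i, j). (of_real (mpow (\<kappa> i) (x - a)) * d i w) * (of_real (mpow (\<kappa>' j) (x - a)) * d' j w))
      has_sum f x w * g x w) (I \<times> I')"
      by (rule has_sum_product(2)[OF _ _ hs[OF x w] hs'[OF x w]];
          rule unif_ps_term_abs_summable[OF _ _ nx]) (use M M' w sm sm' in auto)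
    then show "((\<lambda>p. of_real (mpow (case p of (i, j) \<Rightarrow> \<lambda>b. \<kappa> i b + \<kappa>' j b) (x - a)) *
          (case p of (i, j) \<Rightarrow> \<lambda>w. d i w * d' j w) w) has_sum f x w * g x w) (I \<times> I')"
      by (rule has_sum_cong[THEN iffD1, rotated]) (auto simp: mpow_add mult_ac)
  qed (auto intro!: continuous_on_mult c c' mult_mono M M' simp: M0 M0' norm_mult)
qed

text \<open>The \<open>n\<close>-th power of a sum is expanded into words of length \<open>n\<close>
  over the index set; the head of the list is the factor split off in the induction.\<close>

lemma has_sum_lists_length:
  fixes u :: "'i \<Rightarrow> 'c::{real_normed_field,banach}"
  assumes "u abs_summable_on J" "(u has_sum v) J"
  shows "(\<lambda>L. prod_list (map u L)) abs_summable_on {L \<in> lists J. length L = n} \<and>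
    ((\<lambda>L. prod_list (map u L)) has_sum v ^ n) {L \<in> lists J. length L = n}"
proof (induction n)
  case 0
  have "{L \<in> lists J. length L = 0} = {[]}" by auto
  then show ?case by (simp add: has_sum_finite_iff)
next
  case (Suc n)
  let ?P = "\<lambda>(i, L). u i * prod_list (map u L)"
  have bij: "bij_betw (\<lambda>(i, L). i # L) (J \<times> {L \<in> lists J. length L = n}) {L \<in> lists J. length L = Suc n}"
    by (rule bij_betw_byWitness[where f' = "\<lambda>L. (hd L, tl L)"]) (auto simp: length_Suc_conv)
  have eq: "(\<lambda>p. prod_list (map u (case p of (i, L) \<Rightarrow> i # L))) = ?P"
    by auto
  have "?P abs_summable_on J \<times> {L \<in> lists J. length L = n}"
    "(?P has_sum v * v ^ n) (J \<times> {L \<in> lists J. length L = n})"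
    using has_sum_product[OF assms(1) conjunct1[OF Suc] assms(2) conjunct2[OF Suc]] by simp_all
  then show ?case
    using has_sum_reindex_bij_betw[OF bij, of "\<lambda>L. prod_list (map u L)"]
      summable_on_reindex_bij_betw[OF bij, of "\<lambda>L. norm (prod_list (map u L))"]
    by (simp add: eq split_def)
qed

lemma norm_prod_list:
  "norm (prod_list (map u L)) = prod_list (map (\<lambda>i. norm (u i :: 'c::real_normed_div_algebra)) L)"
  by (induction L) (simp_all add: norm_mult)

text \<open>The geometric series with each power expanded: grouping the lists by length recovers the
  series of \<open>v ^ n\<close>. The bound below 1 is on the sum of the absolute values, so that
  the expanded family itself converges absolutely; a bound on \<open>v\<close> alone would not
  do.\<close>

lemma has_sum_lists:
  fixes u :: "'i \<Rightarrow> 'c::{real_normed_field,banach}"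
  assumes "((\<lambda>i. norm (u i)) has_sum s) J" "s < 1" "(u has_sum v) J"
  shows "(\<lambda>L. prod_list (map u L)) abs_summable_on lists J"
    and "((\<lambda>L. prod_list (map u L)) has_sum inverse (1 - v)) (lists J)"
proof -
  let ?A = "\<lambda>n. {L \<in> lists J. length L = n}"
  have s0: "0 \<le> s" using assms(1) by (rule has_sum_nonneg) auto
  have abs: "u abs_summable_on J" using assms(1) by (rule has_sum_imp_summable)
  have nv: "norm v \<le> s" by (rule norm_has_sum_bound[OF assms(1,3)])
  have bij: "bij_betw snd (Sigma UNIV ?A) (lists J)"
    by (rule bij_betw_byWitness[where f' = "\<lambda>L. (length L, L)"]) auto
  have abs': "(\<lambda>p. prod_list (map u (snd p))) abs_summable_on Sigma UNIV ?A"
  proof (rule summable_on_SigmaI)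
    show "((\<lambda>y. norm (prod_list (map u (snd (n, y))))) has_sum s ^ n) (?A n)" for n
      using has_sum_lists_length[of "\<lambda>i. norm (u i)" J s n] assms(1) abs
      by (simp add: norm_prod_list)
    show "(\<lambda>n. s ^ n) summable_on UNIV"
      using s0 assms(2) by (auto intro!: summable_nonneg_imp_summable_on summable_geometric)
  qed auto
  then show "(\<lambda>L. prod_list (map u L)) abs_summable_on lists J"
    using summable_on_reindex_bij_betw[OF bij, of "\<lambda>L. norm (prod_list (map u L))"] by simp
  have "((\<lambda>p. prod_list (map u (snd p))) has_sum inverse (1 - v)) (Sigma UNIV ?A)"
  proof (rule has_sum_SigmaI)
    show "((\<lambda>y. prod_list (map u (snd (n, y)))) has_sum v ^ n) (?A n)" for n
      using has_sum_lists_length[OF abs assms(3)] by simp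
    have "norm v < 1" using nv assms(2) by simp
    then have "(\<lambda>n. v ^ n) sums inverse (1 - v)" "summable (\<lambda>n. norm (v ^ n))"
      using geometric_sums[of v] by (simp_all add: inverse_eq_divide norm_power summable_geometric)
    then show "((\<lambda>n. v ^ n) has_sum inverse (1 - v)) UNIV"
      by (intro norm_summable_imp_has_sum)
    show "(\<lambda>p. prod_list (map u (snd p))) summable_on Sigma UNIV ?A"
      by (rule abs_summable_summable[OF abs'])
  qed
  then show "((\<lambda>L. prod_list (map u L)) has_sum inverse (1 - v)) (lists J)"
    using has_sum_reindex_bij_betw[OF bij, of "\<lambda>L. prod_list (map u L)"] by simp
qed

text \<open>Dividing by the value at the centre, \<open>f = f a * (1 - u)\<close> with
  \<open>u\<close> free of terms of degree 0. On a smaller ball every term of \<open>u\<close> gains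
  at least one factor equal to the ratio of the radii, so the majorant of \<open>u\<close> drops
  below 1 and the geometric series over lists applies.\<close>

lemma unif_ps_inverse:
  assumes f: "unif_ps K a R f" and R: "0 < R" and K: "compact K"
    and cont: "continuous_on K (f a)" and nz: "\<And>w. w \<in> K \<Longrightarrow> f a w \<noteq> 0"
  obtains R' where "0 < R'" "R' \<le> R" "unif_ps K a R' (\<lambda>x w. inverse (f x w))"
proof -
  obtain I \<kappa> d M where E: "ps_expansion K a R f I \<kappa> d M"
    using f unfolding unif_ps_def by blast
  note M0 = ps_expansionD(1)[OF E] and c = ps_expansionD(2)[OF E]
    and M = ps_expansionD(3)[OF E] and sm = ps_expansionD(4)[OF E]
    and hs = ps_expansionD(5)[OF E]
  define J where "J = {n \<in> I. mdeg (\<kappa> n) > 0}"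
  have J: "J \<subseteq> I" by (auto simp: J_def)
  define g where "g w = inverse (f a w)" for w
  have cg: "continuous_on K g"
    unfolding g_def using cont nz by (intro continuous_on_inverse) auto
  obtain B where B: "\<And>w. w \<in> K \<Longrightarrow> norm (g w) \<le> B" "B > 0"
    using compact_imp_bounded[OF compact_continuous_image[OF cg K]] by (auto simp: bounded_pos)
  define S where "S = (\<Sum>\<^sub>\<infinity>n\<in>J. M n * R ^ mdeg (\<kappa> n))"
  have smJ: "(\<lambda>n. M n * R ^ mdeg (\<kappa> n)) summable_on J"
    by (rule summable_on_subset_banach[OF sm J])
  have S0: "0 \<le> S" unfolding S_def using M0 J R by (intro infsum_nonneg) auto
  \<comment> \<open>\<open>B\<close> bounds \<open>1 / f a\<close> and \<open>S\<close> the
    non-constant terms at radius \<open>R\<close>. At radius \<open>t * R\<close> the majorant of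
    \<open>u\<close> is at most \<open>t * B * S\<close>, hence at most 1/2.\<close>
  define t where "t = 1 / (2 * (B * S + 1))"
  have BS: "B * S \<ge> 0" using B(2) S0 by simp
  have t: "0 < t" "t \<le> 1" "t * (B * S) \<le> 1 / 2"
    using BS by (auto simp: t_def divide_simps)
  define R' where "R' = t * R"
  have R': "0 < R'" "R' \<le> R" using t R by (auto simp: R'_def mult_le_cancel_right1)
  define N where "N n = B * M n" for n
  have le: "N n * R' ^ mdeg (\<kappa> n) \<le> t * B * (M n * R ^ mdeg (\<kappa> n))" if n: "n \<in> J" for n
  proof -
    obtain m where m: "mdeg (\<kappa> n) = Suc m" using n by (cases "mdeg (\<kappa> n)") (auto simp: J_def)
    have "t ^ Suc m \<le> t" using t by (simp add: mult_le_cancel_left1 power_le_one)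
    then have "t ^ Suc m * (B * M n * R ^ Suc m) \<le> t * (B * M n * R ^ Suc m)"
      using B n M0 J R by (intro mult_right_mono) auto
    then show ?thesis by (simp add: N_def R'_def m power_mult_distrib mult_ac)
  qed
  have N0: "0 \<le> N n" if "n \<in> J" for n using M0 J that B by (auto simp: N_def)
  have smN: "(\<lambda>n. N n * R' ^ mdeg (\<kappa> n)) summable_on J"
    by (rule summable_on_comparison_test[OF summable_on_cmult_right[OF smJ, of "t * B"]])
       (use le N0 R' in auto)
  define s where "s = (\<Sum>\<^sub>\<infinity>n\<in>J. N n * R' ^ mdeg (\<kappa> n))"
  have hsN: "((\<lambda>n. N n * R' ^ mdeg (\<kappa> n)) has_sum s) J"
    unfolding s_def by (rule has_sum_infsum[OF smN])
  have "s \<le> t * B * S"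
    unfolding s_def S_def using le
    by (subst infsum_cmult_right'[symmetric]) (intro infsum_mono smN summable_on_cmult_right smJ)
  then have s1: "s < 1" using t by (simp add: mult.assoc)
  define u where "u n w = - (g w * d n w)" for n w
  have uN: "norm (u n w) \<le> N n" if "n \<in> J" "w \<in> K" for n w
    unfolding u_def N_def norm_minus_cancel norm_mult using that J M B
    by (intro mult_mono) (auto intro: less_imp_le)
  have "unif_ps K a R' (\<lambda>x w. inverse (g w * f x w))"
  proof (rule unif_psI[where I = "lists J" and d = "\<lambda>L w. \<Prod>n\<leftarrow>L. u n w" and
        M = "\<lambda>L. \<Prod>n\<leftarrow>L. N n" and \<kappa> = "\<lambda>L b. \<Sum>n\<leftarrow>L. \<kappa> n b"])
    show "countable (lists J)" by simp
    show "continuous_on K (\<lambda>w. \<Prod>n\<leftarrow>L. u n w)" if "L \<in> lists J" for L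
      using that
    proof induction
      case (Cons n L)
      then show ?case using J c by (auto intro!: continuous_on_mult continuous_on_minus cg simp: u_def)
    qed simp
    show "norm (\<Prod>n\<leftarrow>L. u n w) \<le> (\<Prod>n\<leftarrow>L. N n)" if "L \<in> lists J" "w \<in> K" for L w
      using that
    proof induction
      case (Cons n L)
      then show ?case using uN[of n w] N0[of n] unfolding list.map prod_list.Cons norm_mult
        by (intro mult_mono) auto
    qed simp
    show "0 \<le> (\<Prod>n\<leftarrow>L. N n)" if "L \<in> lists J" for L
      using that by induction (auto simp: N0)
    have "(\<lambda>L. \<Prod>n\<leftarrow>L. N n * R' ^ mdeg (\<kappa> n)) abs_summable_on lists J"
    proof (rule has_sum_lists(1)[OF _ s1 hsN])
      show "((\<lambda>n. norm (N n * R' ^ mdeg (\<kappa> n))) has_sum s) J"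
        by (rule has_sum_cong[THEN iffD1, OF _ hsN]) (use N0 R' in \<open>auto simp: abs_mult\<close>)
    qed
    then have "(\<lambda>L. \<Prod>n\<leftarrow>L. N n * R' ^ mdeg (\<kappa> n)) summable_on lists J"
      by (rule abs_summable_summable)
    moreover have "(\<Prod>n\<leftarrow>L. N n * R' ^ mdeg (\<kappa> n)) = (\<Prod>n\<leftarrow>L. N n) * R' ^ mdeg (\<lambda>b. \<Sum>n\<leftarrow>L. \<kappa> n b)" for L
      by (induction L) (simp_all add: mdeg_add power_add)
    ultimately show "(\<lambda>L. (\<Prod>n\<leftarrow>L. N n) * R' ^ mdeg (\<lambda>b. \<Sum>n\<leftarrow>L. \<kappa> n b)) summable_on lists J"
      by simp
  next
    fix x w assume x: "x \<in> ball a R'" and w: "w \<in> K"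
    have xR: "x \<in> ball a R" using x R' by auto
    have nx: "norm (x - a) \<le> R'" using x by (simp add: dist_norm norm_minus_commute)
    let ?p = "\<lambda>n. of_real (mpow (\<kappa> n) (x - a)) :: complex"
    have "((\<lambda>n. ?p n * d n w + - (of_real (mpow (\<kappa> n) (a - a)) * d n w)) has_sum (f x w + - f a w)) I"
      by (intro has_sum_add has_sum_uminusI hs xR w) (use R in auto)
    \<comment> \<open>At the centre only the terms of degree 0 survive; they cancel against those at
      \<open>x\<close>, which leaves the sum over \<open>J\<close>.\<close>
    then have "((\<lambda>n. ?p n * d n w) has_sum (f x w - f a w)) J"
      by (subst (asm) has_sum_cong_neutral[where T = J and g = "\<lambda>n. ?p n * d n w"])
         (auto simp: J_def mpow_at_0 mpow_mdeg_0)
    then have "((\<lambda>n. - g w * (?p n * d n w)) has_sum (- g w * (f x w - f a w))) J"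
      by (rule has_sum_cmult_right)
    moreover have "- g w * (f x w - f a w) = 1 - g w * f x w"
      using nz[OF w] by (simp add: g_def algebra_simps)
    ultimately have hu: "((\<lambda>n. ?p n * u n w) has_sum (1 - g w * f x w)) J"
      by (simp add: u_def mult_ac)
    have absu: "(\<lambda>n. ?p n * u n w) abs_summable_on J"
      by (rule unif_ps_term_abs_summable[OF _ smN nx]) (use uN w in auto)
    have "(\<Sum>\<^sub>\<infinity>n\<in>J. norm (?p n * u n w)) \<le> s"
      unfolding s_def
    proof (rule infsum_mono[OF absu smN])
      fix n assume n: "n \<in> J"
      have "norm (?p n * u n w) \<le> R' ^ mdeg (\<kappa> n) * N n"
        unfolding norm_mult using abs_mpow_le[OF nx] uN[OF n w] R'
        by (intro mult_mono) auto
      then show "norm (?p n * u n w) \<le> N n * R' ^ mdeg (\<kappa> n)" by (simp add: mult.commute)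
    qed
    then have s1': "(\<Sum>\<^sub>\<infinity>n\<in>J. norm (?p n * u n w)) < 1" using s1 by simp
    have "((\<lambda>L. \<Prod>n\<leftarrow>L. ?p n * u n w) has_sum inverse (1 - (1 - g w * f x w))) (lists J)"
      by (rule has_sum_lists(2)[OF has_sum_infsum[OF absu] s1' hu])
    moreover have "(\<Prod>n\<leftarrow>L. ?p n * u n w)
         = of_real (mpow (\<lambda>b. \<Sum>n\<leftarrow>L. \<kappa> n b) (x - a)) * (\<Prod>n\<leftarrow>L. u n w)" for L
      by (induction L) (simp_all add: mpow_add)
    ultimately show "((\<lambda>L. of_real (mpow (\<lambda>b. \<Sum>n\<leftarrow>L. \<kappa> n b) (x - a)) * (\<Prod>n\<leftarrow>L. u n w))
        has_sum inverse (g w * f x w)) (lists J)"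
      by simp
  qed
  from unif_ps_mult[OF unif_ps_parameter[OF cg K] this] R'
  have "unif_ps K a R' (\<lambda>x w. g w * inverse (g w * f x w))" by simp
  then have "unif_ps K a R' (\<lambda>x w. inverse (f x w))"
    by (rule unif_ps_cong) (use nz in \<open>auto simp: g_def\<close>)
  with R' show thesis by (intro that)
qed

section \<open>Circle integrals, sums of exponentials, continuity at the centre\<close>

text \<open>The majorant makes the partial sums converge uniformly on the circle, along the net of
  finite index sets, so integration passes under the sum; each coefficient is bounded by the length
  of the circle times \<open>M n\<close>.\<close>

lemma unif_ps_contour_integral:
  assumes f: "unif_ps (sphere z r) a R f" and r: "0 < r" and R: "0 < R"
  obtains I :: "nat set" and \<kappa> e where
    "(\<lambda>n. norm (e n :: complex) * R ^ mdeg (\<kappa> n)) summable_on I"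
    "\<And>x. x \<in> ball a R \<Longrightarrow>
       ((\<lambda>n. mpow (\<kappa> n) (x - a) *\<^sub>R e n) has_sum contour_integral (circlepath z r) (f x)) I"
proof -
  obtain I \<kappa> d M where E: "ps_expansion (sphere z r) a R f I \<kappa> d M"
    using f unfolding unif_ps_def by blast
  note M0 = ps_expansionD(1)[OF E] and c = ps_expansionD(2)[OF E]
    and M = ps_expansionD(3)[OF E] and sm = ps_expansionD(4)[OF E]
    and hs = ps_expansionD(5)[OF E]
  let ?C = "circlepath z r"
  define e where "e n = contour_integral ?C (d n)" for n
  have int: "d n contour_integrable_on ?C" if "n \<in> I" for n
    using c[OF that] r by (intro contour_integrable_continuous_circlepath) auto
  have ne: "norm (e n) \<le> 2 * pi * r * M n" if n: "n \<in> I" for n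
  proof -
    have "(d n has_contour_integral e n) ?C"
      unfolding e_def by (rule has_contour_integral_integral[OF int[OF n]])
    then have "norm (e n) \<le> M n * (2 * pi * r)"
      by (rule has_contour_integral_bound_circlepath)
         (use M[OF n] M0[OF n] r in \<open>auto simp: dist_norm norm_minus_commute\<close>)
    then show ?thesis by (simp add: mult_ac)
  qed
  show thesis
  proof (rule that)
    show "(\<lambda>n. norm (e n) * R ^ mdeg (\<kappa> n)) summable_on I"
      by (rule summable_on_comparison_test[OF summable_on_cmult_right[OF sm, of "2 * pi * r"]])
         (use ne R in \<open>auto simp: mult.assoc[symmetric] intro!: mult_right_mono\<close>)
  next
    fix x assume x: "x \<in> ball a R"
    have nx: "norm (x - a) \<le> R" using x by (simp add: dist_norm norm_minus_commute)
    let ?p = "\<lambda>n. of_real (mpow (\<kappa> n) (x - a)) :: complex"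
    have ul: "uniform_limit (sphere z r) (\<lambda>X w. \<Sum>n\<in>X. ?p n * d n w) (f x) (finite_subsets_at_top I)"
    proof (rule Weierstrass_m_test_general'[OF _ _ sm])
      show "norm (?p n * d n w) \<le> M n * R ^ mdeg (\<kappa> n)" if "n \<in> I" "w \<in> sphere z r" for n w
      proof -
        have "norm (?p n * d n w) \<le> R ^ mdeg (\<kappa> n) * M n"
          unfolding norm_mult using abs_mpow_le[OF nx] M[OF that]
          by (intro mult_mono zero_le_power order_trans[OF norm_ge_zero nx]) auto
        then show ?thesis by (simp add: mult.commute)
      qed
    qed (use hs x in auto)
    have ev: "\<forall>\<^sub>F X in finite_subsets_at_top I. finite X \<and> X \<subseteq> I"
      by (rule eventually_finite_subsets_at_top_weakI) auto
    have lim: "((\<lambda>X. contour_integral ?C (\<lambda>w. \<Sum>n\<in>X. ?p n * d n w)) \<longlongrightarrow> contour_integral ?C (f x))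
        (finite_subsets_at_top I)"
    proof (rule contour_integral_uniform_limit_circlepath(2)[OF _ _ _ r])
      show "\<forall>\<^sub>F X in finite_subsets_at_top I. (\<lambda>w. \<Sum>n\<in>X. ?p n * d n w) contour_integrable_on ?C"
        using ev by eventually_elim
          (auto intro!: contour_integrable_sum contour_integrable_lmul int)
    qed (use ul r in auto)
    have "((\<lambda>X. \<Sum>n\<in>X. mpow (\<kappa> n) (x - a) *\<^sub>R e n) \<longlongrightarrow> contour_integral ?C (f x)) (finite_subsets_at_top I)"
    proof (rule Lim_transform_eventually[OF lim])
      show "\<forall>\<^sub>F X in finite_subsets_at_top I. contour_integral ?C (\<lambda>w. \<Sum>n\<in>X. ?p n * d n w) =
          (\<Sum>n\<in>X. mpow (\<kappa> n) (x - a) *\<^sub>R e n)"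
        using ev
      proof eventually_elim
        case (elim X)
        then show ?case
          by (subst contour_integral_sum)
             (auto intro!: contour_integrable_lmul int sum.cong
               simp: contour_integral_lmul int subset_iff e_def scaleR_conv_of_real)
      qed
    qed
    then show "((\<lambda>n. mpow (\<kappa> n) (x - a) *\<^sub>R e n) has_sum contour_integral ?C (f x)) I"
      by (simp add: has_sum_def)
  qed
qed

text \<open>One exponential series per basis vector, multiplied out: a choice of one exponent in
  each factor is a multi-index.\<close>

lemma has_sum_exp_multi_index:
  fixes z :: "'a::euclidean_space \<Rightarrow> 'c::{real_normed_field,banach,second_countable_topology}"
  shows "(\<lambda>k. \<Prod>b\<in>Basis. z b ^ k b / fact (k b)) abs_summable_on (Basis \<rightarrow>\<^sub>E UNIV)"
    and "((\<lambda>k. \<Prod>b\<in>Basis. z b ^ k b / fact (k b)) has_sum exp (\<Sum>b\<in>Basis. z b)) (Basis \<rightarrow>\<^sub>E UNIV)"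
proof -
  have 1: "(\<lambda>n. z b ^ n / fact n) abs_summable_on UNIV" for b
    using summable_norm_exp[of "z b"] 
    by (intro summable_nonneg_imp_summable_on) (auto simp: divide_inverse mult.commute scaleR_conv_of_real norm_mult norm_inverse)
  have "(\<lambda>n. z b ^ n / fact n) sums exp (z b)" for b
    using exp_converges[of "z b"] by (simp add: divide_inverse mult.commute scaleR_conv_of_real)
  with 1 have 2: "((\<lambda>n. z b ^ n / fact n) has_sum exp (z b)) UNIV" for b
    by (intro norm_summable_imp_has_sum) (auto simp: summable_on_UNIV_nonneg_real_iff)
  show 3: "(\<lambda>k. \<Prod>b\<in>Basis. z b ^ k b / fact (k b)) abs_summable_on (Basis \<rightarrow>\<^sub>E UNIV)"
    using abs_summable_on_prod_PiE[of Basis "\<lambda>_. UNIV" "\<lambda>b n. z b ^ n / fact n"] 1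
    by (simp add: abs_summable_equivalent)
  have "infsum (\<lambda>k. \<Prod>b\<in>Basis. z b ^ k b / fact (k b)) (Basis \<rightarrow>\<^sub>E UNIV) =
     (\<Prod>b\<in>Basis. infsum (\<lambda>n. z b ^ n / fact n) UNIV)"
    by (rule infsum_prod_PiE_abs) (use 1 in auto)
  also have "\<dots> = exp (\<Sum>b\<in>Basis. z b)"
    unfolding exp_sum[OF finite_Basis] by (rule prod.cong) (auto intro: infsumI 2)
  finally show "((\<lambda>k. \<Prod>b\<in>Basis. z b ^ k b / fact (k b)) has_sum exp (\<Sum>b\<in>Basis. z b)) (Basis \<rightarrow>\<^sub>E UNIV)"
    using abs_summable_summable[OF 3] by (simp add: has_sum_iff)
qed

text \<open>Each \<open>exp (l i x)\<close> is expanded about \<open>a\<close> in the coordinates of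
  \<open>x - a\<close>, so the terms are indexed by pairs of \<open>i\<close> and a multi-index.
  Summing the majorants over the multi-indices first gives exactly the family assumed summable in
  \<open>sm\<close>.\<close>

lemma unif_ps_exp_sum:
  fixes l :: "'i::countable \<Rightarrow> 'a::euclidean_space \<Rightarrow> complex"
  assumes lin: "\<And>i. linear (l i)" and R: "0 \<le> R"
    and c: "\<And>i. continuous_on K (c i)"
    and M: "\<And>i w. w \<in> K \<Longrightarrow> norm (c i w) \<le> M i" and M0: "\<And>i. 0 \<le> M i"
    and sm: "(\<lambda>i. M i * (exp (norm (l i a)) * exp (\<Sum>b\<in>Basis. norm (l i b) * R))) summable_on UNIV"
    and hs: "\<And>x w. w \<in> K \<Longrightarrow> ((\<lambda>i. c i w * exp (l i x)) has_sum f x w) UNIV"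
  shows "unif_ps K a R f"
proof (rule unif_psI[where I = "UNIV \<times> (Basis \<rightarrow>\<^sub>E UNIV)" and \<kappa> = snd and
      d = "\<lambda>(i, k) w. c i w * exp (l i a) * (\<Prod>b\<in>Basis. l i b ^ k b / fact (k b))" and
      M = "\<lambda>(i, k). M i * exp (norm (l i a)) * (\<Prod>b\<in>Basis. norm (l i b) ^ k b / fact (k b))"])
  let ?P = "Basis \<rightarrow>\<^sub>E UNIV :: ('a \<Rightarrow> nat) set"
  show "countable ((UNIV :: 'i set) \<times> ?P)" by (intro countable_SIGMA countable_PiE countableI_type) auto
  have ne: "norm (exp (z::complex)) \<le> exp (norm z)" for z
    by (simp add: complex_Re_le_cmod)
  show "norm ((case p of (i, k) \<Rightarrow> \<lambda>w. c i w * exp (l i a) * (\<Prod>b\<in>Basis. l i b ^ k b / fact (k b))) w)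
     \<le> (case p of (i, k) \<Rightarrow> M i * exp (norm (l i a)) * (\<Prod>b\<in>Basis. norm (l i b) ^ k b / fact (k b)))"
    if "w \<in> K" for p w
    using M[OF that] ne M0
    by (auto simp: norm_mult norm_divide norm_power simp flip: prod_norm split: prod.splits
        intro!: mult_mono prod_nonneg mult_nonneg_nonneg)
  have "(\<lambda>p. M (fst p) * exp (norm (l (fst p) a)) *
      (\<Prod>b\<in>Basis. (norm (l (fst p) b) * R) ^ snd p b / fact (snd p b))) summable_on UNIV \<times> ?P"
  proof (rule summable_on_SigmaI[OF _ sm])
    show "((\<lambda>y. M (fst (i, y)) * exp (norm (l (fst (i, y)) a)) *
      (\<Prod>b\<in>Basis. (norm (l (fst (i, y)) b) * R) ^ snd (i, y) b / fact (snd (i, y) b))) has_sum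
      M i * (exp (norm (l i a)) * exp (\<Sum>b\<in>Basis. norm (l i b) * R))) ?P" for i
      using has_sum_cmult_right[OF has_sum_exp_multi_index(2)[of "\<lambda>b. norm (l i b) * R"], of "M i * exp (norm (l i a))"]
      by (simp add: mult.assoc)
  qed (use M0 R in \<open>auto intro!: mult_nonneg_nonneg prod_nonneg\<close>)
  then show "(\<lambda>p. (case p of (i, k) \<Rightarrow> M i * exp (norm (l i a)) * (\<Prod>b\<in>Basis. norm (l i b) ^ k b / fact (k b)))
      * R ^ mdeg (snd p)) summable_on UNIV \<times> ?P"
    by (rule summable_on_cong[THEN iffD1, rotated])
       (auto simp: mdeg_def power_sum power_mult_distrib simp flip: prod.distrib)
next
  let ?P = "Basis \<rightarrow>\<^sub>E UNIV :: ('a \<Rightarrow> nat) set"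
  fix x w assume x: "x \<in> ball a R" and w: "w \<in> K"
  define t where "t = x - a"
  have nt: "norm t \<le> R" using x by (simp add: t_def dist_norm norm_minus_commute)
  let ?F = "\<lambda>p. c (fst p) w * exp (l (fst p) a) * (\<Prod>b\<in>Basis. ((t \<bullet> b) *\<^sub>R l (fst p) b) ^ snd p b / fact (snd p b))"
  have l_sum: "l i t = (\<Sum>b\<in>Basis. (t \<bullet> b) *\<^sub>R l i b)" for i
    using lin[of i] by (subst euclidean_representation[of t, symmetric]) (simp add: linear_sum linear_scale)
  have "?F summable_on UNIV \<times> ?P"
  proof (rule abs_summable_summable, rule summable_on_SigmaI)
    let ?e = "\<lambda>i. norm (c i w) * norm (exp (l i a)) * exp (\<Sum>b\<in>Basis. norm ((t \<bullet> b) *\<^sub>R l i b))"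
    show "((\<lambda>y. norm (?F (i, y))) has_sum ?e i) ?P" for i
      using has_sum_cmult_right[OF has_sum_exp_multi_index(2)[of "\<lambda>b. norm ((t \<bullet> b) *\<^sub>R l i b)"],
          of "norm (c i w) * norm (exp (l i a))"]
      by (simp add: norm_mult norm_power norm_divide power_mult_distrib power_abs abs_mult flip: prod_norm)
    show "?e summable_on UNIV"
    proof (rule summable_on_comparison_test[OF sm])
      fix i
      have "(\<Sum>b\<in>Basis. norm ((t \<bullet> b) *\<^sub>R l i b)) \<le> (\<Sum>b\<in>Basis. norm (l i b) * R)"
        using nt R by (intro sum_mono) (auto simp: mult.commute intro!: mult_mono order_trans[OF Basis_le_norm])
      then show "?e i \<le> M i * (exp (norm (l i a)) * exp (\<Sum>b\<in>Basis. norm (l i b) * R))"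
        using M[OF w] M0 unfolding mult.assoc
        by (intro mult_mono) (auto simp: complex_Re_le_cmod)
    qed auto
  qed auto
  then have "(?F has_sum f x w) (UNIV \<times> ?P)"
  proof (rule has_sum_SigmaI[rotated 2])
    show "((\<lambda>y. ?F (i, y)) has_sum c i w * exp (l i x)) ?P" for i
    proof -
      have "l i x = l i a + (\<Sum>b\<in>Basis. (t \<bullet> b) *\<^sub>R l i b)"
        unfolding l_sum[symmetric] unfolding t_def using lin[of i] by (simp add: linear_diff)
      then show ?thesis
        using has_sum_cmult_right[OF has_sum_exp_multi_index(2)[of "\<lambda>b. (t \<bullet> b) *\<^sub>R l i b"], of "c i w * exp (l i a)"]
        by (simp add: exp_add mult.assoc)
    qed
    show "((\<lambda>i. c i w * exp (l i x)) has_sum f x w) UNIV" by (rule hs[OF w])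
  qed
  then show "((\<lambda>p. of_real (mpow (snd p) (x - a)) *
      (case p of (i, k) \<Rightarrow> \<lambda>w. c i w * exp (l i a) * (\<Prod>b\<in>Basis. l i b ^ k b / fact (k b))) w) has_sum f x w) (UNIV \<times> ?P)"
    by (rule has_sum_cong[THEN iffD1, rotated])
       (auto simp: mpow_def t_def scaleR_conv_of_real power_mult_distrib mult_ac of_real_prod simp flip: prod.distrib)
qed (auto intro!: continuous_on_mult c continuous_on_const split: prod.splits simp: M0 prod_nonneg)

lemma real_analytic_on_contour_integral:
  fixes f :: "'a::euclidean_space \<Rightarrow> complex \<Rightarrow> complex"
  assumes r: "0 < r" and f: "\<And>a. a \<in> A \<Longrightarrow> \<exists>R>0. unif_ps (sphere z r) a R f"
  shows "real_analytic_on (\<lambda>x. Re (c * contour_integral (circlepath z r) (f x))) A"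
proof (rule real_analytic_onI)
  fix a assume "a \<in> A"
  then obtain R where R: "R > 0" and ps: "unif_ps (sphere z r) a R f" using f by blast
  obtain I :: "nat set" and \<kappa> e where
    sm: "(\<lambda>n. norm (e n :: complex) * R ^ mdeg (\<kappa> n)) summable_on I" and
    hs: "\<And>x. x \<in> ball a R \<Longrightarrow>
       ((\<lambda>n. mpow (\<kappa> n) (x - a) *\<^sub>R e n) has_sum contour_integral (circlepath z r) (f x)) I"
    using unif_ps_contour_integral[OF ps r R] by metis
  have bl: "bounded_linear (\<lambda>w. Re (c * w))"
    by (rule bounded_linear_compose[OF bounded_linear_Re bounded_linear_mult_right])
  show "\<exists>(I::nat set) \<kappa> e R. R > 0 \<and> (\<lambda>n. norm (e n) * R ^ mdeg (\<kappa> n)) summable_on I \<and>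
      (\<forall>x\<in>ball a R. ((\<lambda>n. mpow (\<kappa> n) (x - a) *\<^sub>R e n) has_sum
        Re (c * contour_integral (circlepath z r) (f x))) I)"
  proof (intro exI[of _ I] exI[of _ \<kappa>] exI[of _ "\<lambda>n. Re (c * e n)"] exI[of _ R] conjI ballI)
    show "(\<lambda>n. norm (Re (c * e n)) * R ^ mdeg (\<kappa> n)) summable_on I"
    proof (rule summable_on_comparison_test[OF summable_on_cmult_right[OF sm, of "norm c"]])
      fix n
      have "norm (Re (c * e n)) \<le> norm c * norm (e n)"
        using abs_Re_le_cmod[of "c * e n"] by (simp add: norm_mult)
      then show "norm (Re (c * e n)) * R ^ mdeg (\<kappa> n) \<le> norm c * (norm (e n) * R ^ mdeg (\<kappa> n))"
        unfolding mult.assoc[symmetric] using R by (intro mult_right_mono) auto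
    qed (use R in auto)
  next
    fix x assume "x \<in> ball a R"
    from has_sum_bounded_linear[OF bl hs[OF this]]
    show "((\<lambda>n. mpow (\<kappa> n) (x - a) *\<^sub>R Re (c * e n)) has_sum
        Re (c * contour_integral (circlepath z r) (f x))) I"
      by simp
  qed (rule R)
qed

text \<open>On the ball of radius \<open>t * R\<close> every term of positive degree shrinks at
  least by the factor \<open>t\<close>, and the constant terms cancel; the variation is thus at most
  \<open>t * S\<close>, whatever the parameter.\<close>

lemma unif_ps_uniform_limit:
  assumes f: "unif_ps K a R f" and R: "0 < R"
  shows "uniform_limit K f (f a) (at a)"
proof (rule uniform_limitI)
  fix \<epsilon> :: real assume \<epsilon>: "\<epsilon> > 0"
  obtain I \<kappa> d M where E: "ps_expansion K a R f I \<kappa> d M"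
    using f unfolding unif_ps_def by blast
  note M0 = ps_expansionD(1)[OF E] and c = ps_expansionD(2)[OF E]
    and M = ps_expansionD(3)[OF E] and sm = ps_expansionD(4)[OF E]
    and hs = ps_expansionD(5)[OF E]
  define S where "S = (\<Sum>\<^sub>\<infinity>n\<in>I. M n * R ^ mdeg (\<kappa> n))"
  have S0: "0 \<le> S" unfolding S_def using M0 R by (intro infsum_nonneg) auto
  have key: "norm (f x w - f a w) \<le> t * S"
    if t: "0 \<le> t" "t < 1" and x: "norm (x - a) \<le> t * R" and w: "w \<in> K" for t x w
  proof -
    have "t * R < R" using t R by simp
    then have xR: "x \<in> ball a R" using x by (simp add: dist_norm norm_minus_commute)
    have "((\<lambda>n. of_real (mpow (\<kappa> n) (x - a)) * d n w + - (of_real (mpow (\<kappa> n) (a - a)) * d n w))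
        has_sum (f x w + - f a w)) I"
      by (intro has_sum_add has_sum_uminusI hs xR w) (use R in auto)
    then have 1: "((\<lambda>n. (of_real (mpow (\<kappa> n) (x - a)) - of_real (mpow (\<kappa> n) 0)) * d n w)
        has_sum (f x w - f a w)) I"
      by (simp add: algebra_simps)
    have 2: "((\<lambda>n. t * (M n * R ^ mdeg (\<kappa> n))) has_sum t * S) I"
      unfolding S_def by (intro has_sum_cmult_right has_sum_infsum sm)
    show ?thesis
    proof (rule norm_infsum_le[OF 1 2])
      fix n assume n: "n \<in> I"
      show "norm ((of_real (mpow (\<kappa> n) (x - a)) - of_real (mpow (\<kappa> n) 0)) * d n w)
          \<le> t * (M n * R ^ mdeg (\<kappa> n))"
      proof (cases "mdeg (\<kappa> n)")
        case 0
        then show ?thesis using t M0[OF n] by (simp add: mpow_mdeg_0)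
      next
        case (Suc m)
        have "\<bar>mpow (\<kappa> n) (x - a)\<bar> \<le> (t * R) ^ Suc m"
          using abs_mpow_le[OF x, of "\<kappa> n"] Suc by simp
        also have "\<dots> = t ^ Suc m * R ^ Suc m" by (simp add: power_mult_distrib)
        also have "\<dots> \<le> t * R ^ Suc m"
          using mult_left_mono[OF power_le_one[of t m], of t] t R by (intro mult_right_mono) auto
        finally have "\<bar>mpow (\<kappa> n) (x - a)\<bar> * norm (d n w) \<le> t * R ^ Suc m * M n"
          using M[OF n w] t R by (intro mult_mono) auto
        then show ?thesis by (simp add: norm_mult mpow_at_0 Suc mult_ac)
      qed
    qed
  qed
  define t where "t = min (1/2) (\<epsilon> / (2 * (S + 1)))"
  have t: "0 < t" "t < 1" using \<epsilon> S0 by (auto simp: t_def)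
  have "t * S \<le> \<epsilon> / (2 * (S + 1)) * S" using S0 by (intro mult_right_mono) (auto simp: t_def)
  also have "\<dots> < \<epsilon>" using \<epsilon> S0 by (simp add: divide_simps)
  finally have tS: "t * S < \<epsilon>" .
  show "\<forall>\<^sub>F x in at a. \<forall>w\<in>K. dist (f x w) (f a w) < \<epsilon>"
    unfolding eventually_at
  proof (intro exI[of _ "t * R"] conjI ballI impI)
    show "dist (f x w) (f a w) < \<epsilon>" if "x \<noteq> a \<and> dist x a < t * R" "w \<in> K" for x w
      using key[of t x w] that t tS by (simp add: dist_norm)
  qed (use t R in auto)
qed

section \<open>Sign changes and zeros of families of entire functions\<close>

lemma entire_eq_0_if_real_interval:
  assumes holo: "F holomorphic_on UNIV" and e: "0 < e"
    and zero: "\<And>x. \<bar>x - t\<bar> < e \<Longrightarrow> F (of_real x) = 0"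
  shows "F w = 0"
proof (rule analytic_continuation[OF holo])
  show "of_real t islimpt (of_real ` {x. \<bar>x - t\<bar> < e} :: complex set)"
    unfolding islimpt_approachable
  proof (intro allI impI)
    fix d :: real assume d: "d > 0"
    define x where "x = t + min d e / 2"
    show "\<exists>x'\<in>of_real ` {x. \<bar>x - t\<bar> < e}. x' \<noteq> of_real t \<and> dist x' (of_real t :: complex) < d"
    proof (rule bexI[of _ "of_real x"])
      show "of_real x \<noteq> (of_real t :: complex) \<and> dist (of_real x) (of_real t :: complex) < d"
        using d e unfolding dist_of_real of_real_eq_iff by (simp add: x_def dist_real_def min_def)
      show "(of_real x :: complex) \<in> of_real ` {x. \<bar>x - t\<bar> < e}"
        using d e by (intro imageI) (simp add: x_def min_def)
    qed
  qed
qed (use zero in auto)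

text \<open>For an entire function that is real on the real line this is a zero of odd multiplicity.
  Phrased by values alone, it can be found by a connectedness argument without any local
  factorisation.\<close>

definition sign_change :: "(complex \<Rightarrow> complex) \<Rightarrow> real \<Rightarrow> bool" where
  "sign_change F t \<longleftrightarrow> (\<forall>\<epsilon>>0. \<exists>a b. \<bar>a - t\<bar> < \<epsilon> \<and> \<bar>b - t\<bar> < \<epsilon> \<and>
     Re (F (of_real a)) < 0 \<and> Re (F (of_real b)) > 0)"

lemma sign_change_eq_0:
  assumes "F holomorphic_on UNIV" "Im (F (of_real t)) = 0" "sign_change F t"
  shows "F (of_real t) = 0"
proof (rule ccontr)
  assume "F (of_real t) \<noteq> 0"
  with assms(2) have nz: "Re (F (of_real t)) \<noteq> 0" by (simp add: complex_eq_iff)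
  have "continuous_on UNIV (\<lambda>x::real. Re (F (of_real x)))"
    by (intro continuous_intros continuous_on_compose2[OF holomorphic_on_imp_continuous_on[OF assms(1)]]) auto
  then have "isCont (\<lambda>x::real. Re (F (of_real x))) t"
    by (simp add: continuous_on_eq_continuous_at)
  then obtain \<delta> where \<delta>: "\<delta> > 0" "\<And>x. \<bar>x - t\<bar> < \<delta> \<Longrightarrow>
      \<bar>Re (F (of_real x)) - Re (F (of_real t))\<bar> < \<bar>Re (F (of_real t))\<bar>"
    unfolding continuous_at_eps_delta using nz by (metis zero_less_abs_iff dist_real_def)
  from assms(3) \<delta>(1) obtain a b where "\<bar>a - t\<bar> < \<delta>" "\<bar>b - t\<bar> < \<delta>"
     "Re (F (of_real a)) < 0" "Re (F (of_real b)) > 0"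
    unfolding sign_change_def by blast
  with \<delta>(2)[of a] \<delta>(2)[of b] nz show False by linarith
qed

text \<open>The intermediate value theorem would only give a zero, perhaps one without a sign
  change. Without any sign change, however, each point of the segment has a neighbourhood on which
  \<open>F\<close> is nonpositive or one on which it is nonnegative, and these two open conditions
  would disconnect the segment.\<close>

lemma sign_change_between:
  assumes holo: "F holomorphic_on UNIV" and im: "\<And>x::real. Im (F (of_real x)) = 0"
    and a: "Re (F (of_real a)) < 0" and b: "Re (F (of_real b)) > 0"
  obtains t where "min a b \<le> t" "t \<le> max a b" "sign_change F t"
proof (rule ccontr)
  assume "\<not> thesis"
  with that have no: "\<not> sign_change F t" if "t \<in> {min a b..max a b}" for t
    using that by auto
  define P where "P s = {t. \<exists>\<epsilon>>0. \<forall>x. \<bar>x - t\<bar> < \<epsilon> \<longrightarrow> s * Re (F (of_real x)) \<le> 0}" for s :: real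
  have opn: "open (P s)" for s
    unfolding open_dist
  proof
    fix t assume "t \<in> P s"
    then obtain \<epsilon> where \<epsilon>: "\<epsilon> > 0" "\<And>x. \<bar>x - t\<bar> < \<epsilon> \<Longrightarrow> s * Re (F (of_real x)) \<le> 0"
      by (auto simp: P_def)
    have "u \<in> P s" if "dist u t < \<epsilon> / 2" for u
      unfolding P_def
    proof (intro CollectI exI[of _ "\<epsilon> / 2"] conjI allI impI)
      show "s * Re (F (of_real x)) \<le> 0" if "\<bar>x - u\<bar> < \<epsilon> / 2" for x
        using that \<open>dist u t < \<epsilon> / 2\<close> unfolding dist_real_def by (intro \<epsilon>(2)) argo
    qed (use \<epsilon>(1) in simp)
    then show "\<exists>e>0. \<forall>y. dist y t < e \<longrightarrow> y \<in> P s" using \<epsilon>(1) by (intro exI[of _ "\<epsilon> / 2"]) auto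
  qed
  have cover: "{min a b..max a b} \<subseteq> P 1 \<union> P (-1)"
  proof
    fix t assume "t \<in> {min a b..max a b}"
    from no[OF this] obtain \<epsilon> where \<epsilon>: "\<epsilon> > 0" and n: "\<And>u v. \<bar>u - t\<bar> < \<epsilon> \<Longrightarrow> \<bar>v - t\<bar> < \<epsilon> \<Longrightarrow>
        Re (F (of_real u)) < 0 \<Longrightarrow> Re (F (of_real v)) > 0 \<Longrightarrow> False"
      unfolding sign_change_def by blast
    show "t \<in> P 1 \<union> P (-1)"
    proof (cases "\<exists>u. \<bar>u - t\<bar> < \<epsilon> \<and> Re (F (of_real u)) < 0")
      case True
      then have "t \<in> P 1" unfolding P_def using \<epsilon> n by (intro CollectI exI[of _ \<epsilon>]) force
      then show ?thesis by simp
    next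
      case False
      then have "t \<in> P (-1)" unfolding P_def using \<epsilon> by (intro CollectI exI[of _ \<epsilon>]) force
      then show ?thesis by simp
    qed
  qed
  have "P 1 \<inter> {min a b..max a b} = {} \<or> P (-1) \<inter> {min a b..max a b} = {}"
  proof (rule connectedD)
    show "connected {min a b..max a b}" by simp
    show "P 1 \<inter> P (-1) \<inter> {min a b..max a b} = {}"
    proof (rule ccontr)
      assume "\<not> ?thesis"
      then obtain t e1 e2 where "e1 > 0" "e2 > 0" and
        1: "\<And>x. \<bar>x - t\<bar> < e1 \<Longrightarrow> Re (F (of_real x)) \<le> 0" and
        2: "\<And>x. \<bar>x - t\<bar> < e2 \<Longrightarrow> Re (F (of_real x)) \<ge> 0"
        by (auto simp: P_def)
      \<comment> \<open>On a common neighbourhood both inequalities hold, so \<open>F\<close>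
        vanishes on an interval and hence identically, against its value at
        \<open>a\<close>.\<close>
      have "F w = 0" for w
      proof (rule entire_eq_0_if_real_interval[OF holo])
        show "min e1 e2 > 0" using \<open>e1 > 0\<close> \<open>e2 > 0\<close> by simp
        show "F (of_real x) = 0" if "\<bar>x - t\<bar> < min e1 e2" for x
          using 1[of x] 2[of x] im[of x] that by (simp add: complex_eq_iff)
      qed
      with a show False by simp
    qed
  qed (rule opn cover)+
  moreover have P_le: "s * Re (F (of_real u)) \<le> 0" if "u \<in> P s" for u s
    using that by (auto simp: P_def)
  then have "a \<notin> P (-1)" "b \<notin> P 1" using P_le[of a "-1"] P_le[of b 1] a b by auto
  moreover have "a \<in> P 1 \<union> P (-1)" "b \<in> P 1 \<union> P (-1)" by (rule subsetD[OF cover]; simp)+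
  moreover have "a \<in> {min a b..max a b}" "b \<in> {min a b..max a b}" by auto
  ultimately show False by blast
qed

text \<open>
  Among all sign changes in the family take one of minimal multiplicity \<open>k\<close>.  By Rouche's theorem
  and minimality, nearby members have in a fixed disc exactly one zero, of multiplicity \<open>k\<close>; the
  weighted argument principle expresses it by a contour integral, hence analytically.
\<close>

lemma analytic_zero_of_sign_change:
  fixes f :: "'a::euclidean_space \<Rightarrow> complex \<Rightarrow> complex"
  assumes holo: "\<And>y. f y holomorphic_on UNIV"
    and im: "\<And>y x. Im (f y (of_real x)) = 0"
    and ps: "\<And>y K. compact K \<Longrightarrow> unif_ps K y 1 f"
    and ps': "\<And>y K. compact K \<Longrightarrow> unif_ps K y 1 (\<lambda>y. deriv (f y))"
    and neg: "Re (f y (of_real s)) < 0" and pos: "Re (f y (of_real s')) > 0"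
  obtains V and h :: "(complex \<Rightarrow> complex) \<Rightarrow> real" where
    "open V" "V \<noteq> {}" "real_analytic_on (\<lambda>y. h (f y)) V"
    "\<And>y. y \<in> V \<Longrightarrow> f y (of_real (h (f y))) = 0"
    "\<And>y y'. f y = f y' \<Longrightarrow> y \<in> V \<Longrightarrow> y' \<in> V"
proof -
  \<comment> \<open>\<open>zorder\<close> is an integer; at a zero of a member that is not
    identically zero it is positive, so passing to \<open>nat\<close> loses nothing and makes a
    least value available.\<close>
  define P where "P k \<longleftrightarrow> (\<exists>y t. (\<exists>w. f y w \<noteq> 0) \<and> sign_change (f y) t \<and>
    nat (zorder (f y) (of_real t)) = k)" for k
  obtain t where "sign_change (f y) t"
    by (rule sign_change_between[OF holo im neg pos])
  then have "\<exists>k. P k" unfolding P_def using neg by (metis less_irrefl zero_complex.sel(1))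
  define k where "k = (LEAST k. P k)"
  have "P k" unfolding k_def using \<open>\<exists>k. P k\<close> by (rule LeastI_ex)
  have min: "k \<le> nat (zorder (f y) (of_real t))" if "f y w \<noteq> 0" "sign_change (f y) t" for y t w
    unfolding k_def using that by (intro Least_le) (auto simp: P_def)
  obtain y0 t0 w0 where w0: "f y0 w0 \<noteq> 0" and t0: "sign_change (f y0) t0"
    and k: "nat (zorder (f y0) (of_real t0)) = k"
    using \<open>P k\<close> unfolding P_def by blast
  define z0 where "z0 = complex_of_real t0"
  have z0: "f y0 z0 = 0" unfolding z0_def by (rule sign_change_eq_0[OF holo im t0])
  have zpos: "zorder (f y) z > 0" if nz: "f y w \<noteq> 0" and z: "f y z = 0" for y w z
  proof -
    obtain r where r: "0 < r" "\<And>u. u \<in> ball z r - {z} \<Longrightarrow> f y u \<noteq> 0"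
      using isolated_zeros[OF holo open_UNIV connected_UNIV UNIV_I z UNIV_I nz] by metis
    have "eventually (\<lambda>u. f y u \<noteq> 0) (at z)"
      unfolding eventually_at using r by (intro exI[of _ r]) (auto simp: dist_commute)
    then have "frequently (\<lambda>u. f y u \<noteq> 0) (at z)" by (intro eventually_frequently) auto
    then show ?thesis using zorder_pos_iff[OF holo, of z y] z by auto
  qed
  obtain r' where r': "0 < r'" "\<And>u. u \<in> ball z0 r' - {z0} \<Longrightarrow> f y0 u \<noteq> 0"
    using isolated_zeros[OF holo open_UNIV connected_UNIV UNIV_I z0 UNIV_I w0] by metis
  \<comment> \<open>Half the isolating radius: the circle avoids the zeros of \<open>f y0\<close>,
    and the larger ball is the domain in which the residue theorems are applied.\<close>
  define r where "r = r' / 2"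
  have r: "0 < r" "r < r'" using r' by (auto simp: r_def)
  obtain a b where ab: "\<bar>a - t0\<bar> < r" "\<bar>b - t0\<bar> < r"
    "Re (f y0 (of_real a)) < 0" "Re (f y0 (of_real b)) > 0"
    using t0 r unfolding sign_change_def by blast
  \<comment> \<open>Closeness to \<open>f y0\<close> on the circle is the hypothesis of Rouche's
    theorem; closeness at \<open>a\<close> and \<open>b\<close> preserves the two signs, so every
    nearby member still changes sign between them.\<close>
  define K where "K = sphere z0 r \<union> {of_real a, of_real b}"
  have K: "compact K" unfolding K_def by (intro compact_Un) auto
  have K0: "K \<noteq> {}" by (auto simp: K_def)
  have nzK: "f y0 w \<noteq> 0" if "w \<in> K" for w
  proof (cases "w \<in> sphere z0 r")
    case True
    then show ?thesis using r by (intro r'(2)) auto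
  next
    case False
    then show ?thesis using that ab by (auto simp: K_def)
  qed
  have cont: "continuous_on X (f y)" for X y
    by (rule continuous_on_subset[OF holomorphic_on_imp_continuous_on[OF holo]]) auto
  obtain w1 where w1: "w1 \<in> K" "\<And>w. w \<in> K \<Longrightarrow> norm (f y0 w1) \<le> norm (f y0 w)"
    using continuous_attains_inf[OF K K0 continuous_on_norm[OF cont]] by blast
  define \<epsilon> where "\<epsilon> = norm (f y0 w1)"
  have \<epsilon>: "\<epsilon> > 0" using nzK[OF w1(1)] by (simp add: \<epsilon>_def)
  \<comment> \<open>The uniform margin \<open>\<delta> < \<epsilon>\<close> makes \<open>V\<close>
    open. \<open>V\<close> refers to \<open>y\<close> only through the function \<open>f y\<close>,
    which gives the last conclusion.\<close>
  define V where "V = {y. \<exists>\<delta><\<epsilon>. \<forall>w\<in>K. norm (f y w - f y0 w) \<le> \<delta>}"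
  define Z where "Z y = {p \<in> ball z0 r'. f y p = 0}" for y
  \<comment> \<open>The integral is \<open>2 \<pi> i\<close> times the sum of the enclosed zeros
    counted with multiplicity; with a single zero of multiplicity \<open>k\<close> the prefactor
    recovers its position.\<close>
  define h where "h F = Re (1 / (2 * pi * \<i> * of_nat k) *
     contour_integral (circlepath z0 r) (\<lambda>x. deriv F x * x / F x))" for F
  have less: "norm (f y w - f y0 w) < norm (f y0 w)" if "y \<in> V" "w \<in> K" for y w
    using that w1(2)[of w] unfolding V_def \<epsilon>_def by force
  have nzV: "f y w \<noteq> 0" if "y \<in> V" "w \<in> K" for y w
    using less[OF that] by auto
  have y0V: "y0 \<in> V" using \<epsilon> by (auto simp: V_def intro!: exI[of _ 0])
  have pathK: "path_image (circlepath z0 r) = sphere z0 r" using r by simp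
  have wn1: "winding_number (circlepath z0 r) p = 1" if "norm (p - z0) < r" for p
    by (rule winding_number_circlepath[OF that])
  have wn0: "winding_number (circlepath z0 r) p = 0" if "norm (p - z0) > r" for p
    by (rule winding_number_zero_outside[of _ "cball z0 r"])
       (use that r in \<open>auto simp: dist_norm norm_minus_commute\<close>)
  have finZ: "finite (Z y)" if "y \<in> V" for y
  proof -
    \<comment> \<open>A constant this close to \<open>f y0\<close> at both \<open>a\<close> and
      \<open>b\<close> would be negative and positive at once.\<close>
    have "\<not> f y constant_on UNIV"
    proof
      assume "f y constant_on UNIV"
      then obtain c where c: "\<And>w. f y w = c" unfolding constant_on_def by auto
      have "norm (f y (of_real a) - f y0 (of_real a)) < norm (f y0 (of_real a))"
        "norm (f y (of_real b) - f y0 (of_real b)) < norm (f y0 (of_real b))"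
        using less[OF that] by (auto simp: K_def)
      then have "\<bar>Re c - Re (f y0 (of_real a))\<bar> < \<bar>Re (f y0 (of_real a))\<bar>"
        "\<bar>Re c - Re (f y0 (of_real b))\<bar> < \<bar>Re (f y0 (of_real b))\<bar>"
        using im[of y a] im[of y0 a] im[of y0 b] c by (auto simp: cmod_eq_Re)
      with ab show False by linarith
    qed
    then have "finite {z \<in> cball z0 r'. f y z = 0}"
      by (intro holomorphic_compact_finite_zeros[OF holo]) auto
    then show ?thesis by (rule finite_subset[rotated]) (auto simp: Z_def)
  qed
  have Z0: "Z y0 = {z0}" using r'(2) z0 r'(1) by (auto simp: Z_def)
  have main: "h (f y) = t \<and> f y (of_real t) = 0"
    if y: "y \<in> V" and t: "min a b \<le> t" "t \<le> max a b" "sign_change (f y) t" for y t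
  proof -
    have "(\<Sum>p\<in>{p\<in>ball z0 r'. f y0 p + (f y p - f y0 p) = 0}.
         winding_number (circlepath z0 r) p * zorder (\<lambda>p. f y0 p + (f y p - f y0 p)) p)
      = (\<Sum>p\<in>{p\<in>ball z0 r'. f y0 p = 0}. winding_number (circlepath z0 r) p * zorder (f y0) p)"
    proof (rule Rouche_theorem)
      show "finite {p \<in> ball z0 r'. f y0 p + (f y p - f y0 p) = 0}"
        using finZ[OF y] by (simp add: Z_def)
      show "finite {p \<in> ball z0 r'. f y0 p = 0}" using finZ[OF y0V] by (simp add: Z_def)
      show "\<forall>z\<in>path_image (circlepath z0 r). cmod (f y z - f y0 z) < cmod (f y0 z)"
        unfolding pathK using less[OF y] by (auto simp: K_def)
      show "\<forall>z. z \<notin> ball z0 r' \<longrightarrow> winding_number (circlepath z0 r) z = 0"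
        using r by (auto intro!: wn0 simp: dist_norm norm_minus_commute)
      show "path_image (circlepath z0 r) \<subseteq> ball z0 r'" using r unfolding pathK by auto
    qed (auto intro!: holomorphic_on_diff holomorphic_on_subset[OF holo])
    then have S1: "(\<Sum>p\<in>Z y. winding_number (circlepath z0 r) p * zorder (f y) p)
         = winding_number (circlepath z0 r) z0 * zorder (f y0) z0"
      unfolding Z0[symmetric] using Z0 by (simp add: Z_def cong: sum.cong)
    define Z1 where "Z1 = {p \<in> Z y. norm (p - z0) < r}"
    have finZ1: "finite Z1" using finZ[OF y] by (simp add: Z1_def)
    have nsph: "norm (p - z0) \<noteq> r" if "p \<in> Z y" for p
      using nzV[OF y, of p] that by (auto simp: Z_def K_def dist_norm norm_minus_commute)
    have toZ1: "(\<Sum>p\<in>Z y. winding_number (circlepath z0 r) p * g p) = (\<Sum>p\<in>Z1. g p)" for g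
    proof -
      have "(\<Sum>p\<in>Z y. winding_number (circlepath z0 r) p * g p)
        = (\<Sum>p\<in>Z1. winding_number (circlepath z0 r) p * g p)"
        using nsph finZ[OF y]
        by (intro sum.mono_neutral_right) (auto simp: Z1_def intro!: wn0 dest: nsph linorder_neqE_linordered_idom)
      also have "\<dots> = (\<Sum>p\<in>Z1. g p)" by (intro sum.cong) (auto simp: Z1_def wn1)
      finally show ?thesis .
    qed
    have "(\<Sum>p\<in>Z1. of_int (zorder (f y) p)) = (of_int (zorder (f y0) z0) :: complex)"
      using S1 r unfolding toZ1 by (simp add: wn1)
    then have "(of_int (\<Sum>p\<in>Z1. zorder (f y) p) :: complex) = of_int (zorder (f y0) z0)"
      by simp
    then have S2: "(\<Sum>p\<in>Z1. zorder (f y) p) = zorder (f y0) z0"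
      unfolding of_int_eq_iff .
    have nz: "f y (of_real a) \<noteq> 0" using nzV[OF y, of "of_real a"] by (simp add: K_def)
    have k': "zorder (f y0) z0 = int k" "k > 0"
      using k zpos[OF w0 z0] unfolding z0_def by linarith+
    have ft: "f y (of_real t) = 0" by (rule sign_change_eq_0[OF holo im t(3)])
    have "\<bar>t - t0\<bar> < r" using t ab by (auto simp: min_def max_def split: if_splits)
    then have tZ1: "of_real t \<in> Z1"
      using ft r unfolding Z1_def Z_def z0_def
      by (auto simp: dist_norm simp flip: of_real_diff)
    \<comment> \<open>Here minimality enters: \<open>t\<close> takes up at least \<open>k\<close>,
      which is the total of all multiplicities in the disc, so the other zeros, each of positive
      multiplicity, have nothing left.\<close>
    have zt: "zorder (f y) (of_real t) \<ge> int k" using min[OF nz t(3)] k'(2) by linarith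
    have "(\<Sum>p\<in>Z1. zorder (f y) p) = zorder (f y) (of_real t) + (\<Sum>p\<in>Z1 - {of_real t}. zorder (f y) p)"
      by (rule sum.remove[OF finZ1 tZ1])
    moreover have pos: "zorder (f y) p > 0" if "p \<in> Z1" for p
      using zpos[OF nz, of p] that by (simp add: Z1_def Z_def)
    moreover have "(\<Sum>p\<in>Z1 - {of_real t}. zorder (f y) p) \<ge> 0" by (intro sum_nonneg) (use pos in force)
    ultimately have zt': "zorder (f y) (of_real t) = int k" and "(\<Sum>p\<in>Z1 - {of_real t}. zorder (f y) p) = 0"
      using S2 zt k' by linarith+
    then have "Z1 - {of_real t} = {}"
      using sum_pos[of "Z1 - {of_real t}" "zorder (f y)"] finZ1 pos by force
    then have Z1: "Z1 = {of_real t}" using tZ1 by auto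
    \<comment> \<open>The argument principle weighted by the identity function; the empty set stands
      for the absence of poles.\<close>
    have "contour_integral (circlepath z0 r) (\<lambda>x. deriv (f y) x * x / f y x) =
       2 * pi * \<i> * (\<Sum>p\<in>{w \<in> ball z0 r'. f y w = 0 \<or> w \<in> {}}. winding_number (circlepath z0 r) p * p * zorder (f y) p)"
    proof (rule argument_principle)
      show "path_image (circlepath z0 r) \<subseteq> ball z0 r' - {w \<in> ball z0 r'. f y w = 0 \<or> w \<in> {}}"
        using r nzV[OF y] unfolding pathK by (auto simp: K_def)
      show "\<forall>z. z \<notin> ball z0 r' \<longrightarrow> winding_number (circlepath z0 r) z = 0"
        using r by (auto intro!: wn0 simp: dist_norm norm_minus_commute)
      show "finite {w \<in> ball z0 r'. f y w = 0 \<or> w \<in> {}}" using finZ[OF y] by (simp add: Z_def)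
    qed (auto intro!: holomorphic_on_subset[OF holo])
    also have "(\<Sum>p\<in>{w \<in> ball z0 r'. f y w = 0 \<or> w \<in> {}}. winding_number (circlepath z0 r) p * p * zorder (f y) p)
       = (\<Sum>p\<in>Z y. winding_number (circlepath z0 r) p * (p * zorder (f y) p))"
      by (simp add: Z_def mult.assoc)
    also have "\<dots> = of_real t * of_nat k" unfolding toZ1 Z1 by (simp add: zt')
    finally have "h (f y) = t" unfolding h_def using k' by simp
    then show ?thesis using ft by simp
  qed
  have ex: "\<exists>t. min a b \<le> t \<and> t \<le> max a b \<and> sign_change (f y) t" if y: "y \<in> V" for y
  proof -
    have "norm (f y (of_real a) - f y0 (of_real a)) < norm (f y0 (of_real a))"
      "norm (f y (of_real b) - f y0 (of_real b)) < norm (f y0 (of_real b))"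
      using less[OF y] by (auto simp: K_def)
    then have "\<bar>Re (f y (of_real a)) - Re (f y0 (of_real a))\<bar> < \<bar>Re (f y0 (of_real a))\<bar>"
      "\<bar>Re (f y (of_real b)) - Re (f y0 (of_real b))\<bar> < \<bar>Re (f y0 (of_real b))\<bar>"
      using im by (auto simp: cmod_eq_Re)
    then have "Re (f y (of_real a)) < 0" "Re (f y (of_real b)) > 0" using ab by linarith+
    from sign_change_between[OF holo im this] show ?thesis by blast
  qed
  show thesis
  proof (rule that)
    show "V \<noteq> {}" using y0V by auto
    show "f y (of_real (h (f y))) = 0" if "y \<in> V" for y
      using main[OF that] ex[OF that] by metis
    show "y' \<in> V" if "f y = f y'" "y \<in> V" for y y' using that by (simp add: V_def)
    show "open V"
      unfolding open_dist
    proof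
      fix y assume "y \<in> V"
      then obtain \<delta> where \<delta>: "\<delta> < \<epsilon>" "\<And>w. w \<in> K \<Longrightarrow> norm (f y w - f y0 w) \<le> \<delta>"
        unfolding V_def by blast
      have "uniform_limit K f (f y) (at y)" by (rule unif_ps_uniform_limit[OF ps[OF K]]) simp
      then have "\<forall>\<^sub>F x in at y. \<forall>w\<in>K. dist (f x w) (f y w) < (\<epsilon> - \<delta>) / 2"
        by (rule uniform_limitD) (use \<delta> in simp)
      then obtain d where d: "d > 0"
        "\<And>x w. x \<noteq> y \<Longrightarrow> dist x y < d \<Longrightarrow> w \<in> K \<Longrightarrow> dist (f x w) (f y w) < (\<epsilon> - \<delta>) / 2"
        unfolding eventually_at by blast
      have "x \<in> V" if "dist x y < d" for x
      proof (cases "x = y")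
        case False
        show ?thesis
          unfolding V_def
        proof (intro CollectI exI[of _ "(\<epsilon> + \<delta>) / 2"] conjI ballI)
          fix w assume w: "w \<in> K"
          show "norm (f x w - f y0 w) \<le> (\<epsilon> + \<delta>) / 2"
            using d(2)[OF False that w] \<delta>(2)[OF w] norm_triangle_ineq[of "f x w - f y w" "f y w - f y0 w"]
            unfolding dist_norm by (simp add: field_simps)
        qed (use \<delta> in auto)
      qed (use \<open>y \<in> V\<close> in auto)
      then show "\<exists>e>0. \<forall>x. dist x y < e \<longrightarrow> x \<in> V" using d(1) by blast
    qed
    show "real_analytic_on (\<lambda>y. h (f y)) V"
      unfolding h_def
    proof (rule real_analytic_on_contour_integral[OF r(1)])
      fix y assume y: "y \<in> V"
      let ?S = "sphere z0 r"
      have cS: "compact ?S" by simp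
      \<comment> \<open>For \<open>y\<close> in \<open>V\<close> the function \<open>f y\<close> has
        no zero on the circle, so the reciprocal in the integrand is again a parametrised power
        series.\<close>
      obtain R where R: "0 < R" "R \<le> 1" "unif_ps ?S y R (\<lambda>x w. inverse (f x w))"
        by (rule unif_ps_inverse[OF ps[OF cS] _ cS cont]) (use nzV[OF y] in \<open>auto simp: K_def\<close>)
      have "unif_ps ?S y R (\<lambda>x w. deriv (f x) w)"
        by (rule unif_ps_mono[OF ps'[OF cS]]) (use R in auto)
      moreover have "unif_ps ?S y R (\<lambda>x w. w)"
        by (rule unif_ps_parameter) auto
      ultimately have "unif_ps ?S y R (\<lambda>x w. deriv (f x) w * w * inverse (f x w))"
        using R by (intro unif_ps_mult) auto
      then show "\<exists>R>0. unif_ps ?S y R (\<lambda>x w. deriv (f x) w * w / f x w)"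
        using R(1) unfolding divide_inverse by blast
    qed
  qed
qed

section \<open>Trigonometric series with rapidly decreasing coefficients\<close>

definition l1 :: "int^'n \<Rightarrow> real" where
  "l1 m = (\<Sum>i\<in>UNIV. \<bar>real_of_int (m $ i)\<bar>)"

text \<open>At complex arguments the exponentials grow like \<open>exp (\<rho> * l1 m)\<close> with
  \<open>\<rho>\<close> proportional to the size of the argument. Decay beyond every such rate makes
  the series entire along complex lines and is stable under the polynomial factors produced by
  differentiation.\<close>

definition rapid_decay :: "(int^'n \<Rightarrow> complex) \<Rightarrow> bool" where
  "rapid_decay c \<longleftrightarrow> (\<forall>\<rho>. (\<lambda>m. norm (c m) * exp (\<rho> * l1 m)) summable_on UNIV)"

definition rvec :: "real^'n \<Rightarrow> complex^'n" where
  "rvec x = (\<chi> i. of_real (x $ i))"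

definition freq :: "real^'n \<Rightarrow> int^'n \<Rightarrow> complex^'n" where
  "freq \<alpha> m = cvec m + rvec \<alpha>"

text \<open>The frequencies form the integer lattice shifted by \<open>\<alpha>\<close>, as for
  theta functions with characteristics; the shift alone determines the multiplier under integral
  translations.\<close>

definition trig :: "(int^'n \<Rightarrow> complex) \<Rightarrow> real^'n \<Rightarrow> complex^'n \<Rightarrow> complex" where
  "trig c \<alpha> z = (\<Sum>\<^sub>\<infinity>m. c m * exp (2 * of_real pi * \<i> * cdot (freq \<alpha> m) z))"

lemma freq_nth: "freq \<alpha> m $ i = of_real (of_int (m $ i) + \<alpha> $ i)"
  by (simp add: freq_def cvec_def rvec_def)

lemma cdot_add_right: "cdot u (v + w) = cdot u v + cdot u w"
  by (simp add: cdot_def distrib_left sum.distrib)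

lemma cdot_add_left: "cdot (u + v) w = cdot u w + cdot v w"
  by (simp add: cdot_def distrib_right sum.distrib)

lemma cdot_scale_right: "cdot u (a *s v) = a * cdot u v"
  by (simp add: cdot_def sum_distrib_left mult_ac)

lemma cdot_scaleR_right: "cdot u (a *\<^sub>R v) = a *\<^sub>R cdot u v"
  by (simp add: cdot_def scaleR_sum_right)

lemma cdot_axis: "cdot u (axis j 1) = u $ j"
  by (simp add: cdot_def axis_def if_distrib cong: if_cong)

lemma l1_nonneg [simp]: "0 \<le> l1 m"
  by (simp add: l1_def sum_nonneg)

lemma abs_nth_le_l1: "\<bar>real_of_int (m $ i)\<bar> \<le> l1 m"
  unfolding l1_def by (rule member_le_sum) auto

lemma norm_freq_nth_le: "norm (freq \<alpha> m $ i) \<le> l1 m + (\<Sum>i\<in>UNIV. \<bar>\<alpha> $ i\<bar>)"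
proof -
  have "norm (freq \<alpha> m $ i) \<le> \<bar>real_of_int (m $ i)\<bar> + \<bar>\<alpha> $ i\<bar>"
    unfolding freq_nth norm_of_real by simp
  also have "\<bar>\<alpha> $ i\<bar> \<le> (\<Sum>i\<in>UNIV. \<bar>\<alpha> $ i\<bar>)" by (rule member_le_sum) auto
  finally show ?thesis using abs_nth_le_l1[of m i] by simp
qed

lemma norm_cdot_freq_le:
  assumes "\<And>i. norm (z $ i) \<le> B"
  shows "norm (cdot (freq \<alpha> m) z) \<le> (l1 m + (\<Sum>i\<in>UNIV. \<bar>\<alpha> $ i\<bar>)) * B"
proof -
  have "norm (cdot (freq \<alpha> m) z) \<le> (\<Sum>i\<in>UNIV. norm (freq \<alpha> m $ i) * norm (z $ i))"
    unfolding cdot_def by (rule order_trans[OF norm_sum]) (simp add: norm_mult)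
  also have "\<dots> \<le> (\<Sum>i\<in>UNIV. (\<bar>real_of_int (m $ i)\<bar> + \<bar>\<alpha> $ i\<bar>) * B)"
    using assms unfolding freq_nth norm_of_real by (intro sum_mono mult_mono) auto
  also have "\<dots> = (l1 m + (\<Sum>i\<in>UNIV. \<bar>\<alpha> $ i\<bar>)) * B"
    by (simp add: l1_def sum.distrib sum_distrib_right distrib_right)
  finally show ?thesis .
qed

lemma rapid_decay_summable:
  assumes "rapid_decay c" "\<And>m. norm (d m) \<le> norm (c m) * (C * exp (\<rho> * l1 m))"
  shows "(\<lambda>m. norm (d m)) summable_on UNIV"
proof (rule Infinite_Sum.abs_summable_on_comparison_test')
  show "(\<lambda>m. C * (norm (c m) * exp (\<rho> * l1 m))) summable_on UNIV"
    using assms(1) unfolding rapid_decay_def by (intro summable_on_cmult_right) auto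
  show "norm (d m) \<le> C * (norm (c m) * exp (\<rho> * l1 m))" for m
    using assms(2)[of m] by (simp add: mult_ac)
qed

lemma rapid_decay_mult:
  assumes "rapid_decay c" "\<And>m. norm (d m) \<le> C * exp (\<rho> * l1 m)"
  shows "rapid_decay (\<lambda>m. c m * d m)"
  unfolding rapid_decay_def
proof
  fix \<sigma>
  have "(\<lambda>m. norm (c m * d m * exp (\<sigma> * l1 m))) summable_on UNIV"
  proof (rule rapid_decay_summable[OF assms(1)])
    fix m
    have "norm (d m) * exp (\<sigma> * l1 m) \<le> C * exp (\<rho> * l1 m) * exp (\<sigma> * l1 m)"
      using assms(2) by (intro mult_right_mono) auto
    then show "norm (c m * d m * exp (\<sigma> * l1 m)) \<le> norm (c m) * (C * exp ((\<rho> + \<sigma>) * l1 m))"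
      by (simp add: norm_mult mult.assoc distrib_right exp_add mult_left_mono del: exp_of_real flip: of_real_mult)
  qed
  then show "(\<lambda>m. norm (c m * d m) * exp (\<sigma> * l1 m)) summable_on UNIV"
    by (simp add: norm_mult del: exp_of_real flip: of_real_mult)
qed

lemma norm_exp_cdot_freq_le:
  assumes "\<And>i. norm (z $ i) \<le> B"
  shows "norm (exp (2 * of_real pi * \<i> * cdot (freq \<alpha> m) z))
     \<le> exp (2 * pi * B * (\<Sum>i\<in>UNIV. \<bar>\<alpha> $ i\<bar>)) * exp (2 * pi * B * l1 m)"
proof -
  have "norm (exp (2 * of_real pi * \<i> * cdot (freq \<alpha> m) z)) \<le> exp (2 * pi * norm (cdot (freq \<alpha> m) z))"
    using complex_Re_le_cmod[of "2 * of_real pi * \<i> * cdot (freq \<alpha> m) z"] by (simp add: norm_mult)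
  also have "\<dots> \<le> exp (2 * pi * ((l1 m + (\<Sum>i\<in>UNIV. \<bar>\<alpha> $ i\<bar>)) * B))"
    using norm_cdot_freq_le[OF assms] by simp
  also have "\<dots> = exp (2 * pi * B * (\<Sum>i\<in>UNIV. \<bar>\<alpha> $ i\<bar>)) * exp (2 * pi * B * l1 m)"
    by (simp add: exp_add[symmetric] algebra_simps)
  finally show ?thesis .
qed

lemma trig_abs_summable:
  assumes "rapid_decay c"
  shows "(\<lambda>m. norm (c m * exp (2 * of_real pi * \<i> * cdot (freq \<alpha> m) z))) summable_on UNIV"
proof (rule rapid_decay_summable[OF assms])
  show "norm (c m * exp (2 * of_real pi * \<i> * cdot (freq \<alpha> m) z)) \<le> norm (c m) *
      (exp (2 * pi * norm z * (\<Sum>i\<in>UNIV. \<bar>\<alpha> $ i\<bar>)) * exp (2 * pi * norm z * l1 m))" for m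
    unfolding norm_mult
    by (rule mult_left_mono[OF norm_exp_cdot_freq_le]) (auto simp: Finite_Cartesian_Product.norm_nth_le)
qed

lemma trig_has_sum:
  assumes "rapid_decay c"
  shows "((\<lambda>m. c m * exp (2 * of_real pi * \<i> * cdot (freq \<alpha> m) z)) has_sum trig c \<alpha> z) UNIV"
  unfolding trig_def by (rule has_sum_infsum[OF abs_summable_summable[OF trig_abs_summable[OF assms]]])

lemma trig_periodic:
  "trig c \<alpha> (z + axis j 1) = exp (2 * of_real pi * \<i> * of_real (\<alpha> $ j)) * trig c \<alpha> z"
proof -
  have "exp (2 * of_real pi * \<i> * cdot (freq \<alpha> m) (z + axis j 1))
      = exp (2 * of_real pi * \<i> * of_real (\<alpha> $ j)) * exp (2 * of_real pi * \<i> * cdot (freq \<alpha> m) z)" for m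
  proof -
    have "exp (2 * of_real pi * \<i> * cdot (freq \<alpha> m) (z + axis j 1))
       = exp (2 * of_real pi * \<i> * cdot (freq \<alpha> m) z) * exp (2 * of_real pi * \<i> * of_real (\<alpha> $ j))
         * exp (2 * of_real pi * \<i> * of_int (m $ j))"
      by (simp add: cdot_add_right cdot_axis freq_nth distrib_left exp_add mult_ac)
    also have "exp (2 * of_real pi * \<i> * of_int (m $ j)) = 1"
      using exp_integer_2pi[of "of_int (m $ j)"] by (simp add: mult_ac)
    finally show ?thesis by simp
  qed
  then show ?thesis
    unfolding trig_def infsum_cmult_right'[symmetric] by (simp add: mult_ac)
qed

text \<open>Coefficients of the derivative in direction \<open>v\<close>, so that differentiation
  stays within series of the form \<open>trig\<close>.\<close>

definition trig_diff :: "(int^'n \<Rightarrow> complex) \<Rightarrow> real^'n \<Rightarrow> complex^'n \<Rightarrow> int^'n \<Rightarrow> complex" where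
  "trig_diff c \<alpha> v m = c m * (2 * of_real pi * \<i> * cdot (freq \<alpha> m) v)"

lemma rapid_decay_trig_diff:
  assumes "rapid_decay c"
  shows "rapid_decay (trig_diff c \<alpha> v)"
  unfolding trig_diff_def
proof (rule rapid_decay_mult[OF assms, where \<rho> = 1 and
      C = "2 * pi * norm v * (1 + (\<Sum>i\<in>UNIV. \<bar>\<alpha> $ i\<bar>))"])
  fix m
  let ?A = "\<Sum>i\<in>UNIV. \<bar>\<alpha> $ i\<bar>"
  have A: "?A \<ge> 0" by (simp add: sum_nonneg)
  have "norm (cdot (freq \<alpha> m) v) \<le> (l1 m + ?A) * norm v"
    by (rule norm_cdot_freq_le) (simp add: Finite_Cartesian_Product.norm_nth_le)
  also have "\<dots> \<le> ((1 + ?A) * exp (l1 m)) * norm v"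
  proof (rule mult_right_mono)
    have "l1 m \<le> exp (l1 m)" "1 \<le> exp (l1 m)"
      using exp_ge_add_one_self[of "l1 m"] l1_nonneg[of m] by linarith+
    then have "l1 m + ?A * 1 \<le> exp (l1 m) + ?A * exp (l1 m)"
      using A by (intro add_mono mult_left_mono) auto
    then show "l1 m + ?A \<le> (1 + ?A) * exp (l1 m)" by (simp add: distrib_right)
  qed simp
  finally have "2 * pi * norm (cdot (freq \<alpha> m) v) \<le> 2 * pi * (((1 + ?A) * exp (l1 m)) * norm v)"
    by (rule mult_left_mono) simp
  then show "norm (2 * of_real pi * \<i> * cdot (freq \<alpha> m) v)
      \<le> 2 * pi * norm v * (1 + ?A) * exp (1 * l1 m)"
    by (simp add: norm_mult mult_ac del: distrib_left_numeral)
qed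

text \<open>Uniform convergence of the partial sums on a disc permits termwise differentiation; the
  derivative so obtained is identified with the differentiated series by uniqueness of sums.\<close>

lemma trig_line_has_field_derivative:
  assumes c: "rapid_decay c"
  shows "((\<lambda>w. trig c \<alpha> (u + w *s v)) has_field_derivative trig (trig_diff c \<alpha> v) \<alpha> (u + w0 *s v)) (at w0)"
proof -
  define T where "T m w = c m * exp (2 * of_real pi * \<i> * cdot (freq \<alpha> m) (u + w *s v))" for m w
  define T' where "T' m w = trig_diff c \<alpha> v m * exp (2 * of_real pi * \<i> * cdot (freq \<alpha> m) (u + w *s v))" for m w
  \<comment> \<open>Bounds every coordinate of \<open>u + w *s v\<close> on the closed unit disc
    about \<open>w0\<close>, and thereby fixes the exponential rate of the majorant.\<close>
  define B where "B = norm u + (norm w0 + 1) * norm v"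
  have B: "norm ((u + w *s v) $ i) \<le> B" if "w \<in> cball w0 1" for w i
  proof -
    have "norm w \<le> norm w0 + 1"
      using that norm_triangle_ineq2[of w w0] by (simp add: dist_norm norm_minus_commute)
    have "norm ((u + w *s v) $ i) \<le> norm (u $ i) + norm w * norm (v $ i)"
      using norm_triangle_ineq[of "u $ i" "w * v $ i"] by (simp add: norm_mult)
    also have "\<dots> \<le> B"
      unfolding B_def using \<open>norm w \<le> norm w0 + 1\<close>
      by (intro add_mono mult_mono) (auto simp: Finite_Cartesian_Product.norm_nth_le)
    finally show ?thesis .
  qed
  let ?M = "\<lambda>m. norm (c m) * (exp (2 * pi * B * (\<Sum>i\<in>UNIV. \<bar>\<alpha> $ i\<bar>)) * exp (2 * pi * B * l1 m))"
  have "(\<lambda>m. norm (c m * (exp (2 * pi * B * (\<Sum>i\<in>UNIV. \<bar>\<alpha> $ i\<bar>)) * exp (2 * pi * B * l1 m)))) summable_on UNIV"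
    by (rule rapid_decay_summable[OF c, of _ "exp (2 * pi * B * (\<Sum>i\<in>UNIV. \<bar>\<alpha> $ i\<bar>))" "2 * pi * B"])
       (simp add: norm_mult del: exp_of_real flip: of_real_mult)
  then have sm: "?M summable_on UNIV"
    by (simp add: norm_mult del: exp_of_real flip: of_real_mult)
  have ul: "uniform_limit (cball w0 1) (\<lambda>X w. \<Sum>m\<in>X. T m w) (\<lambda>w. trig c \<alpha> (u + w *s v)) (finite_subsets_at_top UNIV)"
  proof (rule Weierstrass_m_test_general'[OF _ _ sm])
    show "norm (T m w) \<le> ?M m" if "w \<in> cball w0 1" for m w
      unfolding T_def norm_mult using B[OF that] by (intro mult_left_mono norm_exp_cdot_freq_le) auto
    show "((\<lambda>m. T m w) has_sum trig c \<alpha> (u + w *s v)) UNIV" for w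
      unfolding T_def by (rule trig_has_sum[OF c])
  qed
  have der: "(T m has_field_derivative T' m w) (at w)" for m w
    unfolding T_def T'_def trig_diff_def cdot_add_right cdot_scale_right
    by (auto intro!: derivative_eq_intros)
  have contT: "continuous_on X (T m)" for X m
    by (meson continuous_at_imp_continuous_on der DERIV_isCont)
  obtain g' where g': "\<And>w. w \<in> ball w0 1 \<Longrightarrow> ((\<lambda>w. trig c \<alpha> (u + w *s v)) has_field_derivative g' w) (at w)
      \<and> ((\<lambda>X. \<Sum>m\<in>X. T' m w) \<longlongrightarrow> g' w) (finite_subsets_at_top UNIV)"
  proof (rule has_complex_derivative_uniform_limit[OF _ ul])
    show "\<forall>\<^sub>F X in finite_subsets_at_top UNIV. continuous_on (cball w0 1) (\<lambda>w. \<Sum>m\<in>X. T m w) \<and>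
         (\<forall>w\<in>ball w0 1. ((\<lambda>w. \<Sum>m\<in>X. T m w) has_field_derivative (\<Sum>m\<in>X. T' m w)) (at w))"
      by (intro always_eventually allI conjI ballI continuous_on_sum contT DERIV_sum der)
  qed (auto intro: that)
  have "((\<lambda>m. T' m w0) has_sum g' w0) UNIV" using g'[of w0] by (simp add: has_sum_def)
  moreover have "((\<lambda>m. T' m w0) has_sum trig (trig_diff c \<alpha> v) \<alpha> (u + w0 *s v)) UNIV"
    unfolding T'_def by (rule trig_has_sum[OF rapid_decay_trig_diff[OF c]])
  ultimately have "g' w0 = trig (trig_diff c \<alpha> v) \<alpha> (u + w0 *s v)" by (rule has_sum_unique)
  then show ?thesis using g'[of w0] by simp
qed

lemma trig_line_holomorphic:
  "rapid_decay c \<Longrightarrow> (\<lambda>w. trig c \<alpha> (u + w *s v)) holomorphic_on UNIV"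
  unfolding holomorphic_on_open[OF open_UNIV] using trig_line_has_field_derivative by blast

text \<open>Base point of the line in direction \<open>axis j 1\<close> through the real part of
  \<open>y\<close>; erasing the \<open>j\<close>-th coordinate turns it into a label of the
  line.\<close>

definition re_except :: "'n \<Rightarrow> complex^'n \<Rightarrow> complex^'n" where
  "re_except j y = (\<chi> i. if i = j then 0 else of_real (Re (y $ i)))"

lemma re_except_linear: "linear (re_except j)"
  by (rule linearI; simp add: re_except_def vec_eq_iff; simp add: scaleR_conv_of_real)

lemma norm_re_except_nth_le: "norm (re_except j y $ i) \<le> norm y"
  using abs_Re_le_cmod[of "y $ i"] Finite_Cartesian_Product.norm_nth_le[of y i] by (simp add: re_except_def)

text \<open>The exponent splits into a part linear in \<open>y\<close>, which is expanded, and a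
  part in \<open>w\<close>, which is absorbed into the coefficient. Rapid decay outweighs the growth
  of both.\<close>

lemma unif_ps_trig:
  fixes c :: "int^'n \<Rightarrow> complex"
  assumes c: "rapid_decay c" and K: "compact K"
  shows "unif_ps K a 1 (\<lambda>y w. trig c \<alpha> (re_except j y + w *s axis j 1))"
proof -
  obtain W where W: "\<And>w. w \<in> K \<Longrightarrow> norm w \<le> W" "W > 0"
    using compact_imp_bounded[OF K] by (auto simp: bounded_pos)
  define A where "A = (\<Sum>i\<in>UNIV. \<bar>\<alpha> $ i\<bar>)"
  define l where "l m y = 2 * of_real pi * \<i> * cdot (freq \<alpha> m) (re_except j y)" for m and y :: "complex^'n"
  let ?D = "real DIM(complex^'n)"
  have nl: "norm (l m y) \<le> 2 * pi * (l1 m + A) * norm y" for m y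
    using norm_cdot_freq_le[of "re_except j y" "norm y" \<alpha> m] norm_re_except_nth_le[of j y]
    by (simp add: l_def norm_mult A_def)
  show ?thesis
  proof (rule unif_ps_exp_sum[where l = l and c = "\<lambda>m w. c m * exp (2 * of_real pi * \<i> * (freq \<alpha> m $ j * w))"
        and M = "\<lambda>m. norm (c m) * exp (2 * pi * (l1 m + A) * W)"])
    show "linear (l m)" for m
      using re_except_linear[of j] unfolding l_def
      by (intro linearI) (simp_all add: linear_add linear_scale cdot_add_right cdot_scaleR_right distrib_left)
    show "continuous_on K (\<lambda>w. c m * exp (2 * of_real pi * \<i> * (freq \<alpha> m $ j * w)))" for m
      by (intro continuous_intros)
    show "norm (c m * exp (2 * of_real pi * \<i> * (freq \<alpha> m $ j * w))) \<le> norm (c m) * exp (2 * pi * (l1 m + A) * W)"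
      if w: "w \<in> K" for m w
    proof -
      have "norm (exp (2 * of_real pi * \<i> * (freq \<alpha> m $ j * w))) \<le> exp (norm (2 * of_real pi * \<i> * (freq \<alpha> m $ j * w)))"
        unfolding norm_exp_eq_Re exp_le_cancel_iff by (rule complex_Re_le_cmod)
      also have "\<dots> \<le> exp (2 * pi * (l1 m + A) * W)"
        using norm_freq_nth_le[of \<alpha> m j] W(1)[OF w] W(2)
        by (auto simp: norm_mult A_def mult.assoc sum_nonneg intro!: mult_mono add_nonneg_nonneg)
      finally show ?thesis unfolding norm_mult by (rule mult_left_mono) simp
    qed
    show "((\<lambda>m. c m * exp (2 * of_real pi * \<i> * (freq \<alpha> m $ j * w)) * exp (l m y)) has_sum
        trig c \<alpha> (re_except j y + w *s axis j 1)) UNIV" for y w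
    proof -
      have "c m * exp (2 * of_real pi * \<i> * (freq \<alpha> m $ j * w)) * exp (l m y)
          = c m * exp (2 * of_real pi * \<i> * cdot (freq \<alpha> m) (re_except j y + w *s axis j 1))" for m
        unfolding l_def cdot_add_right cdot_scale_right cdot_axis mult.assoc exp_add[symmetric]
        by (simp add: algebra_simps)
      then show ?thesis using trig_has_sum[OF c, of \<alpha> "re_except j y + w *s axis j 1"] by presburger
    qed
    \<comment> \<open>Three contributions to the rate: the parameter, bounded by \<open>W\<close>;
      the centre \<open>a\<close>; and the sum over the basis vectors at radius 1.\<close>
    define \<sigma> where "\<sigma> = 2 * pi * W + 2 * pi * norm a + ?D * (2 * pi)"
    have "(\<lambda>m. norm (norm (c m) * exp (2 * pi * (l1 m + A) * W) *
        (exp (norm (l m a)) * exp (\<Sum>b\<in>Basis. norm (l m b) * 1)))) summable_on UNIV"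
    proof (rule rapid_decay_summable[OF c, of _ "exp (\<sigma> * A)" \<sigma>])
      fix m
      have "(\<Sum>b\<in>Basis. norm (l m b) * 1) \<le> (\<Sum>b\<in>(Basis :: (complex^'n) set). 2 * pi * (l1 m + A))"
        using nl[of m] by (intro sum_mono) (metis norm_Basis mult_1_right)
      also have "\<dots> = ?D * (2 * pi * (l1 m + A))" by simp
      finally have "2 * pi * (l1 m + A) * W + norm (l m a) + (\<Sum>b\<in>Basis. norm (l m b) * 1)
         \<le> 2 * pi * (l1 m + A) * W + 2 * pi * (l1 m + A) * norm a + ?D * (2 * pi * (l1 m + A))"
        using nl[of m a] by linarith
      also have "\<dots> = \<sigma> * A + \<sigma> * l1 m" unfolding \<sigma>_def by (simp add: algebra_simps)
      finally have "exp (2 * pi * (l1 m + A) * W) * (exp (norm (l m a)) * exp (\<Sum>b\<in>Basis. norm (l m b) * 1))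
          \<le> exp (\<sigma> * A) * exp (\<sigma> * l1 m)"
        unfolding exp_add[symmetric] exp_le_cancel_iff by (simp add: add.assoc)
      then show "norm (norm (c m) * exp (2 * pi * (l1 m + A) * W) *
        (exp (norm (l m a)) * exp (\<Sum>b\<in>Basis. norm (l m b) * 1))) \<le> norm (c m) * (exp (\<sigma> * A) * exp (\<sigma> * l1 m))"
        by (simp add: mult.assoc mult_left_mono abs_mult)
    qed
    then show "(\<lambda>m. norm (c m) * exp (2 * pi * (l1 m + A) * W) *
        (exp (norm (l m a)) * exp (\<Sum>b\<in>Basis. norm (l m b) * 1))) summable_on UNIV"
      by (simp add: abs_mult)
  qed auto
qed

section \<open>Uniqueness of the coefficients\<close>

lemma has_sum_sum_finite:
  fixes f :: "'k \<Rightarrow> 'i \<Rightarrow> 'c::topological_comm_monoid_add"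
  assumes "\<And>k. k \<in> K \<Longrightarrow> (f k has_sum s k) A"
  shows "((\<lambda>i. \<Sum>k\<in>K. f k i) has_sum (\<Sum>k\<in>K. s k)) A"
  using assms by (induction K rule: infinite_finite_induct) (auto intro: has_sum_add)

lemma sum_roots_of_unity:
  fixes m :: int
  assumes N: "N > 0"
  shows "(\<Sum>k<N. exp (2 * of_real pi * \<i> * (of_int m * of_nat k / of_nat N)))
     = (if int N dvd m then of_nat N else (0 :: complex))"
proof -
  define z where "z = exp (2 * of_real pi * \<i> * (of_int m / of_nat N))"
  have pow: "exp (2 * of_real pi * \<i> * (of_int m * of_nat k / of_nat N)) = z ^ k" for k
    unfolding z_def by (simp add: exp_of_nat_mult[symmetric] mult_ac)
  have "z ^ N = exp (2 * of_real pi * \<i> * of_int m)"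
    unfolding z_def using N by (simp add: exp_of_nat_mult[symmetric])
  also have "\<dots> = 1" using exp_integer_2pi[of "of_int m"] by (simp add: mult_ac)
  finally have zN: "z ^ N = 1" .
  show ?thesis
  proof (cases "int N dvd m")
    case True
    then obtain q where "m = int N * q" by (auto elim: dvdE)
    then have "z = exp (2 * of_real pi * \<i> * of_int q)" using N by (simp add: z_def)
    also have "\<dots> = 1" using exp_integer_2pi[of "of_int q"] by (simp add: mult_ac)
    finally have "z = 1" .
    then show ?thesis using True unfolding pow by simp
  next
    case False
    have "z \<noteq> 1"
    proof
      assume "z = 1"
      then obtain n :: int where "2 * pi * (of_int m / of_nat N) = of_int (2 * n) * pi"
        unfolding z_def exp_eq_1 by (auto simp: Im_divide_of_nat)
      then have "real_of_int m = real_of_int (int N * n)" using N by (simp add: field_simps)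
      then have "m = int N * n" unfolding of_int_eq_iff .
      with False show False by simp
    qed
    then show ?thesis using False zN unfolding pow by (simp add: geometric_sum)
  qed
qed

lemma rvec_add: "rvec (x + y) = rvec x + rvec y"
  by (simp add: rvec_def vec_eq_iff)

lemma rvec_scaleR: "rvec (a *\<^sub>R x) = of_real a *s rvec x"
  by (simp add: rvec_def vec_eq_iff)

text \<open>On the complex line through \<open>x0\<close> and \<open>x\<close> the series is entire
  in one variable and vanishes on a real interval around \<open>x0\<close>.\<close>

lemma trig_eq_0_everywhere:
  assumes c: "rapid_decay c" and e: "e > 0"
    and zero: "\<And>x. norm (x - x0) < e \<Longrightarrow> trig c \<alpha> (rvec x) = 0"
  shows "trig c \<alpha> (rvec x) = 0"
proof -
  define v where "v = x - x0"
  define F where "F w = trig c \<alpha> (rvec x0 + w *s rvec v)" for w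
  have "F 1 = 0"
  \<comment> \<open>The summand 1 keeps the radius positive when \<open>x = x0\<close>.\<close>
  proof (rule entire_eq_0_if_real_interval[of F "e / (norm v + 1)" 0])
    show "F holomorphic_on UNIV" unfolding F_def by (rule trig_line_holomorphic[OF c])
    show "e / (norm v + 1) > 0" using e by (simp add: add_nonneg_pos)
    fix t :: real assume t: "\<bar>t - 0\<bar> < e / (norm v + 1)"
    have nv: "norm v + 1 > 0" by (simp add: add_nonneg_pos)
    have "norm (t *\<^sub>R v) \<le> \<bar>t\<bar> * (norm v + 1)" by (simp add: mult_left_mono)
    also have "\<dots> < e" using t nv by (simp add: pos_less_divide_eq)
    finally show "F (of_real t) = 0"
      using zero[of "x0 + t *\<^sub>R v"] by (simp add: F_def rvec_add rvec_scaleR)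
  qed
  then show ?thesis by (simp add: F_def v_def flip: rvec_add)
qed

text \<open>
  Averaging over the grid of mesh \<open>1 / N\<close> isolates the coefficients with index in \<open>N\<close> times the
  integer lattice; apart from the one at \<open>0\<close> they are \<open>O(exp (-N))\<close>.
\<close>

lemma trig_eq_0_imp_coeff_0:
  fixes c :: "int^'n \<Rightarrow> complex"
  assumes c: "rapid_decay c" and zero: "\<And>x. trig c \<alpha> (rvec x) = 0"
  shows "c 0 = 0"
proof -
  define S where "S = (\<Sum>\<^sub>\<infinity>m. norm (c m) * exp (1 * l1 m))"
  have smS: "(\<lambda>m. norm (c m) * exp (1 * l1 m)) summable_on UNIV"
    using c unfolding rapid_decay_def by blast
  have bound: "norm (c 0) \<le> S * exp (- real N)" if N: "N > 0" for N :: nat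
  proof -
    define K where "K = (UNIV :: 'n set) \<rightarrow>\<^sub>E {..<N}"
    define X where "X k = (\<chi> i. real (k i) / real N)" for k :: "'n \<Rightarrow> nat"
    \<comment> \<open>Cancels the shift \<open>\<alpha>\<close>; what remains are characters of the
      grid, whose sums factor into sums over roots of unity.\<close>
    define E where "E k = exp (- (2 * of_real pi * \<i> * cdot (rvec \<alpha>) (rvec (X k))))" for k
    have "((\<lambda>m. \<Sum>k\<in>K. E k * (c m * exp (2 * of_real pi * \<i> * cdot (freq \<alpha> m) (rvec (X k)))))
        has_sum (\<Sum>k\<in>K. E k * trig c \<alpha> (rvec (X k)))) UNIV"
      by (intro has_sum_sum_finite has_sum_cmult_right trig_has_sum c)
    moreover have "(\<Sum>k\<in>K. E k * (c m * exp (2 * of_real pi * \<i> * cdot (freq \<alpha> m) (rvec (X k)))))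
        = (if \<forall>i. int N dvd m $ i then of_nat N ^ CARD('n) * c m else 0)" for m
    proof -
      have "E k * exp (2 * of_real pi * \<i> * cdot (freq \<alpha> m) (rvec (X k))) =
         (\<Prod>i\<in>UNIV. exp (2 * of_real pi * \<i> * (of_int (m $ i) * of_nat (k i) / of_nat N)))" for k
      proof -
        have "E k * exp (2 * of_real pi * \<i> * cdot (freq \<alpha> m) (rvec (X k)))
           = exp (2 * of_real pi * \<i> * cdot (cvec m) (rvec (X k)))"
          unfolding E_def freq_def cdot_add_left exp_add[symmetric] by (simp add: algebra_simps)
        also have "\<dots> = exp (\<Sum>i\<in>UNIV. 2 * of_real pi * \<i> * (of_int (m $ i) * of_nat (k i) / of_nat N))"
          by (simp add: cdot_def cvec_def rvec_def X_def sum_distrib_left)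
        also have "\<dots> = (\<Prod>i\<in>UNIV. exp (2 * of_real pi * \<i> * (of_int (m $ i) * of_nat (k i) / of_nat N)))"
          by (rule exp_sum) simp
        finally show ?thesis .
      qed
      then have "E k * (c m * exp (2 * of_real pi * \<i> * cdot (freq \<alpha> m) (rvec (X k)))) =
         c m * (\<Prod>i\<in>UNIV. exp (2 * of_real pi * \<i> * (of_int (m $ i) * of_nat (k i) / of_nat N)))" for k
        by (metis mult.left_commute)
      then have "(\<Sum>k\<in>K. E k * (c m * exp (2 * of_real pi * \<i> * cdot (freq \<alpha> m) (rvec (X k)))))
         = c m * (\<Sum>k\<in>K. \<Prod>i\<in>UNIV. exp (2 * of_real pi * \<i> * (of_int (m $ i) * of_nat (k i) / of_nat N)))"
        by (simp only: sum_distrib_left)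
      also have "(\<Sum>k\<in>K. \<Prod>i\<in>UNIV. exp (2 * of_real pi * \<i> * (of_int (m $ i) * of_nat (k i) / of_nat N)))
         = (\<Prod>i\<in>UNIV. \<Sum>k<N. exp (2 * of_real pi * \<i> * (of_int (m $ i) * of_nat k / of_nat N)))"
        unfolding K_def by (rule prod_sum_PiE[symmetric]) auto
      also have "\<dots> = (if \<forall>i. int N dvd m $ i then of_nat N ^ CARD('n) else 0)"
        unfolding sum_roots_of_unity[OF N] by auto
      finally show ?thesis by simp
    qed
    ultimately have "((\<lambda>m. if \<forall>i. int N dvd m $ i then of_nat N ^ CARD('n) * c m else 0) has_sum 0) UNIV"
      by (simp add: zero)
    from has_sum_cmult_right[OF this, of "inverse (of_nat N ^ CARD('n))"]
    have "((\<lambda>m. if \<forall>i. int N dvd m $ i then c m else 0) has_sum 0) UNIV"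
      using N by (simp add: if_distrib[of "\<lambda>x. _ * x"] mult.assoc[symmetric] cong: if_cong)
    \<comment> \<open>The term at 0 is moved to the other side, so that it is estimated by all the
      remaining ones.\<close>
    then have "((\<lambda>m. if m = 0 then 0 else if \<forall>i. int N dvd m $ i then c m else 0) has_sum (0 + - c 0)) UNIV"
    proof -
      assume 1: "((\<lambda>m. if \<forall>i. int N dvd m $ i then c m else 0) has_sum 0) UNIV"
      have 2: "((\<lambda>m. if m = 0 then - c 0 else 0) has_sum (- c 0)) UNIV"
        by (rule has_sum_finite_neutralI[of "{0}"]) auto
      show ?thesis
        by (rule has_sum_cong[THEN iffD1, OF _ has_sum_add[OF 1 2]]) auto
    qed
    then have hs: "((\<lambda>m. if m = 0 then 0 else if \<forall>i. int N dvd m $ i then c m else 0) has_sum (- c 0)) UNIV"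
      by simp
    have "norm (- c 0) \<le> S * exp (- real N)"
    proof (rule norm_infsum_le[OF hs])
      show "((\<lambda>m. norm (c m) * exp (1 * l1 m) * exp (- real N)) has_sum S * exp (- real N)) UNIV"
        unfolding S_def by (intro has_sum_cmult_left has_sum_infsum smS)
      fix m :: "int^'n"
      show "norm (if m = 0 then 0 else if \<forall>i. int N dvd m $ i then c m else 0)
         \<le> norm (c m) * exp (1 * l1 m) * exp (- real N)"
      proof (cases "m \<noteq> 0 \<and> (\<forall>i. int N dvd m $ i)")
        case True
        \<comment> \<open>A nonzero entry divisible by \<open>N\<close> is at least \<open>N\<close>
          in absolute value; this pays for the factor \<open>exp (- real N)\<close>.\<close>
        then obtain i where "m $ i \<noteq> 0" "int N dvd m $ i" by (auto simp: vec_eq_iff)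
        then have "int N \<le> \<bar>m $ i\<bar>" using dvd_imp_le_int[of "m $ i" "int N"] by simp
        then have "real N \<le> \<bar>real_of_int (m $ i)\<bar>" by linarith
        also have "\<dots> \<le> l1 m" by (rule abs_nth_le_l1)
        finally have "1 \<le> exp (l1 m) * exp (- real N)" by (simp add: exp_add[symmetric])
        then have "norm (c m) * 1 \<le> norm (c m) * (exp (l1 m) * exp (- real N))"
          by (intro mult_left_mono) auto
        then show ?thesis using True by (simp add: mult.assoc)
      qed auto
    qed
    then show ?thesis by simp
  qed
  have "(\<lambda>n. S * exp (- real n)) \<longlonglongrightarrow> S * 0"
    by (intro tendsto_mult tendsto_const filterlim_compose[OF exp_at_bot]
        filterlim_compose[OF filterlim_uminus_at_bot_at_top] filterlim_real_sequentially)
  then have "norm (c 0) \<le> S * 0"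
    by (rule tendsto_lowerbound)
       (use bound in \<open>auto intro!: eventually_mono[OF eventually_gt_at_top[of 0]]\<close>)
  then show ?thesis by simp
qed

text \<open>A nonzero value exists because \<open>c 0\<close> does not vanish, and by
  \<open>odd\<close> it reappears with the opposite sign one unit further along the axis: these are
  the two signs needed on a line. That \<open>V\<close> and \<open>H\<close> ignore the
  \<open>j\<close>-th coordinate and the imaginary parts is what later makes the shear along the
  axis invertible.\<close>

lemma trig_analytic_zero:
  fixes c :: "int^'n \<Rightarrow> complex"
  assumes c: "rapid_decay c" and c0: "c 0 \<noteq> 0"
    and real: "\<And>x. Im (trig c \<alpha> (rvec x)) = 0"
    and odd: "exp (2 * of_real pi * \<i> * of_real (\<alpha> $ j)) = -1"
  obtains V and H :: "complex^'n \<Rightarrow> real" where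
    "open V" "V \<noteq> {}" "real_analytic_on H V"
    "\<And>y. y \<in> V \<Longrightarrow> trig c \<alpha> (re_except j y + of_real (H y) *s axis j 1) = 0"
    "\<And>y y'. re_except j y = re_except j y' \<Longrightarrow> y \<in> V \<Longrightarrow> y' \<in> V"
    "\<And>y y'. re_except j y = re_except j y' \<Longrightarrow> H y = H y'"
proof -
  define f where "f y w = trig c \<alpha> (re_except j y + w *s axis j 1)" for y w
  have f_rvec: "f y (of_real t) = trig c \<alpha> (rvec (\<chi> i. if i = j then t else Re (y $ i)))" for y t
  proof -
    have "re_except j y + of_real t *s axis j 1 = rvec (\<chi> i. if i = j then t else Re (y $ i))"
      by (auto simp: vec_eq_iff re_except_def rvec_def axis_def)
    then show ?thesis by (simp add: f_def)
  qed
  have der: "deriv (f y) = (\<lambda>w. trig (trig_diff c \<alpha> (axis j 1)) \<alpha> (re_except j y + w *s axis j 1))" for y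
    unfolding f_def using trig_line_has_field_derivative[OF c] by (intro ext DERIV_imp_deriv)
  obtain x where x: "trig c \<alpha> (rvec x) \<noteq> 0" using trig_eq_0_imp_coeff_0[OF c] c0 by blast
  have fx: "f (rvec x) (of_real (x $ j)) = trig c \<alpha> (rvec x)"
    unfolding f_rvec by (rule arg_cong[where f = "\<lambda>v. trig c \<alpha> (rvec v)"]) (auto simp: vec_eq_iff rvec_def)
  have "f (rvec x) (of_real (x $ j + 1)) = trig c \<alpha> (rvec x + axis j 1)"
    unfolding f_rvec by (rule arg_cong[where f = "trig c \<alpha>"]) (auto simp: vec_eq_iff rvec_def axis_def)
  also have "\<dots> = - trig c \<alpha> (rvec x)" unfolding trig_periodic odd by simp
  finally have fx': "f (rvec x) (of_real (x $ j + 1)) = - f (rvec x) (of_real (x $ j))" by (simp add: fx)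
  have "Re (f (rvec x) (of_real (x $ j))) \<noteq> 0"
    using x real[of x] by (auto simp: fx complex_eq_iff)
  with fx' have "\<exists>s s'. Re (f (rvec x) (of_real s)) < 0 \<and> Re (f (rvec x) (of_real s')) > 0"
    by (metis neg_0_less_iff_less neg_less_0_iff_less linorder_neqE_linordered_idom uminus_complex.sel(1))
  then obtain s s' where s: "Re (f (rvec x) (of_real s)) < 0" "Re (f (rvec x) (of_real s')) > 0" by blast
  show thesis
  proof (rule analytic_zero_of_sign_change[where f = f, OF _ _ _ _ s])
    show "f y holomorphic_on UNIV" for y unfolding f_def by (rule trig_line_holomorphic[OF c])
    show "Im (f y (of_real t)) = 0" for y t unfolding f_rvec by (rule real)
    show "unif_ps K y 1 f" if "compact K" for y K
      using unif_ps_trig[OF c that] unfolding f_def .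
    show "unif_ps K y 1 (\<lambda>y. deriv (f y))" if "compact K" for y K
      unfolding der by (rule unif_ps_trig[OF rapid_decay_trig_diff[OF c] that])
    fix V and h :: "(complex \<Rightarrow> complex) \<Rightarrow> real"
    assume V: "open V" "V \<noteq> {}" "real_analytic_on (\<lambda>y. h (f y)) V"
      "\<And>y. y \<in> V \<Longrightarrow> f y (of_real (h (f y))) = 0" "\<And>y y'. f y = f y' \<Longrightarrow> y \<in> V \<Longrightarrow> y' \<in> V"
    have f_cong: "f y = f y'" if "re_except j y = re_except j y'" for y y'
      using that by (simp add: f_def fun_eq_iff)
    show thesis
    proof (rule that[OF V(1-3)])
      show "trig c \<alpha> (re_except j y + of_real (h (f y)) *s axis j 1) = 0" if "y \<in> V" for y
        using V(4)[OF that] by (simp only: f_def)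
      show "y' \<in> V" if "re_except j y = re_except j y'" "y \<in> V" for y y'
        by (rule V(5)[OF f_cong]) (rule that)+
      show "h (f y) = h (f y')" if "re_except j y = re_except j y'" for y y'
        unfolding f_cong[OF that] ..
    qed
  qed
qed

section \<open>Real analytic maps and submanifolds\<close>

lemma real_analytic_on_subset:
  "real_analytic_on f A \<Longrightarrow> B \<subseteq> A \<Longrightarrow> real_analytic_on f B"
  unfolding real_analytic_on_def by blast

lemma real_analytic_on_add:
  assumes "real_analytic_on f A" "real_analytic_on g A"
  shows "real_analytic_on (\<lambda>x. f x + g x) A"
  unfolding real_analytic_on_def
proof
  fix a assume a: "a \<in> A"
  let ?P = "\<lambda>k x. \<Prod>b\<in>Basis. ((x - a) \<bullet> b) ^ k b"
  let ?B = "Basis \<rightarrow>\<^sub>E (UNIV :: nat set)"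
  obtain c r where c: "r > 0" "\<And>x. x \<in> ball a r \<Longrightarrow> ((\<lambda>k. ?P k x *\<^sub>R c k) has_sum f x) ?B"
    using bspec[OF assms(1)[unfolded real_analytic_on_def] a] by blast
  obtain d s where d: "s > 0" "\<And>x. x \<in> ball a s \<Longrightarrow> ((\<lambda>k. ?P k x *\<^sub>R d k) has_sum g x) ?B"
    using bspec[OF assms(2)[unfolded real_analytic_on_def] a] by blast
  show "\<exists>c r. r > 0 \<and> (\<forall>x\<in>ball a r. ((\<lambda>k. ?P k x *\<^sub>R c k) has_sum (f x + g x)) ?B)"
  proof (intro exI[of _ "\<lambda>k. c k + d k"] exI[of _ "min r s"] conjI ballI)
    fix x assume "x \<in> ball a (min r s)"
    then have "x \<in> ball a r" "x \<in> ball a s" by auto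
    from has_sum_add[OF c(2)[OF this(1)] d(2)[OF this(2)]]
    show "((\<lambda>k. ?P k x *\<^sub>R (c k + d k)) has_sum (f x + g x)) ?B"
      by (simp add: scaleR_add_right)
  qed (use c d in auto)
qed

lemma real_analytic_on_scaleR_left:
  fixes h :: "'a::euclidean_space \<Rightarrow> real"
  assumes "real_analytic_on h A"
  shows "real_analytic_on (\<lambda>x. h x *\<^sub>R v) A"
  unfolding real_analytic_on_def
proof
  fix a assume a: "a \<in> A"
  let ?P = "\<lambda>k x. \<Prod>b\<in>Basis. ((x - a) \<bullet> b) ^ k b"
  let ?B = "Basis \<rightarrow>\<^sub>E (UNIV :: nat set)"
  obtain c r where c: "r > 0" "\<And>x. x \<in> ball a r \<Longrightarrow> ((\<lambda>k. ?P k x *\<^sub>R c k) has_sum h x) ?B"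
    using bspec[OF assms[unfolded real_analytic_on_def] a] by blast
  show "\<exists>c r. r > 0 \<and> (\<forall>x\<in>ball a r. ((\<lambda>k. ?P k x *\<^sub>R c k) has_sum (h x *\<^sub>R v)) ?B)"
  proof (intro exI[of _ "\<lambda>k. c k *\<^sub>R v"] exI[of _ r] conjI ballI)
    fix x assume "x \<in> ball a r"
    from has_sum_bounded_linear[OF bounded_linear_scaleR_left c(2)[OF this]]
    show "((\<lambda>k. ?P k x *\<^sub>R c k *\<^sub>R v) has_sum (h x *\<^sub>R v)) ?B" by simp
  qed (rule c)
qed

lemma real_analytic_on_translate:
  assumes "real_analytic_on f ((+) t ` A)"
  shows "real_analytic_on (\<lambda>x. f (t + x)) A"
  unfolding real_analytic_on_def
proof
  fix a assume "a \<in> A"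
  then have a: "t + a \<in> (+) t ` A" by simp
  obtain c r where c: "r > 0" "\<And>x. x \<in> ball (t + a) r \<Longrightarrow>
      ((\<lambda>k. (\<Prod>b\<in>Basis. ((x - (t + a)) \<bullet> b) ^ k b) *\<^sub>R c k) has_sum f x) (Basis \<rightarrow>\<^sub>E (UNIV :: nat set))"
    using bspec[OF assms[unfolded real_analytic_on_def] a] by blast
  show "\<exists>c r. r > 0 \<and> (\<forall>x\<in>ball a r. ((\<lambda>k. (\<Prod>b\<in>Basis. ((x - a) \<bullet> b) ^ k b) *\<^sub>R c k) has_sum f (t + x))
      (Basis \<rightarrow>\<^sub>E (UNIV :: nat set)))"
  proof (intro exI[of _ c] exI[of _ r] conjI ballI)
    fix x assume "x \<in> ball a r"
    then have "t + x \<in> ball (t + a) r" by (simp add: dist_norm)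
    from c(2)[OF this]
    show "((\<lambda>k. (\<Prod>b\<in>Basis. ((x - a) \<bullet> b) ^ k b) *\<^sub>R c k) has_sum f (t + x)) (Basis \<rightarrow>\<^sub>E (UNIV :: nat set))"
      by simp
  qed (rule c)
qed

lemma real_analytic_on_id: "real_analytic_on (\<lambda>x. x) A"
proof (rule real_analytic_onI)
  fix a :: 'a assume "a \<in> A"
  \<comment> \<open>\<open>None\<close> indexes the constant term \<open>a\<close>, and
    \<open>Some b\<close> the linear term in direction \<open>b\<close>.\<close>
  define I where "I = insert None (Some ` (Basis :: 'a set))"
  define \<kappa> where "\<kappa> = case_option (\<lambda>_. 0 :: nat) (\<lambda>b c :: 'a. if c = b then 1 else 0)"
  define e where "e = case_option a (\<lambda>b :: 'a. b)"
  have fin: "finite I" by (simp add: I_def)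
  have mp: "mpow (\<kappa> (Some b)) y = y \<bullet> b" if "b \<in> Basis" for b y
  proof -
    have "mpow (\<kappa> (Some b)) y = (\<Prod>c\<in>Basis. if c = b then y \<bullet> c else 1)"
      unfolding mpow_def \<kappa>_def by (rule prod.cong) auto
    then show ?thesis using that by simp
  qed
  have sum: "(\<Sum>i\<in>I. mpow (\<kappa> i) (x - a) *\<^sub>R e i) = x" for x
  proof -
    have "(\<Sum>i\<in>I. mpow (\<kappa> i) (x - a) *\<^sub>R e i) = a + (\<Sum>b\<in>Basis. ((x - a) \<bullet> b) *\<^sub>R b)"
      unfolding I_def by (subst sum.insert) (auto simp: sum.reindex mp e_def \<kappa>_def[THEN fun_cong, of None])
    then show ?thesis by (simp only: euclidean_representation) simp
  qed
  show "\<exists>(I :: 'a option set) \<kappa> e R. R > 0 \<and> (\<lambda>n. norm (e n) * R ^ mdeg (\<kappa> n)) summable_on I \<and>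
      (\<forall>x\<in>ball a R. ((\<lambda>n. mpow (\<kappa> n) (x - a) *\<^sub>R e n) has_sum x) I)"
    by (rule exI[of _ I], rule exI[of _ \<kappa>], rule exI[of _ e], rule exI[of _ 1])
       (auto intro!: has_sum_finiteI summable_on_finite simp: fin sum)
qed

lemma real_analytic_on_const:
  fixes v :: "'b::banach"
  shows "real_analytic_on (\<lambda>_ :: 'a::euclidean_space. v) A"
proof (rule real_analytic_onI)
  fix a :: 'a
  show "\<exists>(I :: unit set) \<kappa> e R. R > 0 \<and> (\<lambda>n. norm (e n) * R ^ mdeg (\<kappa> n)) summable_on I \<and>
      (\<forall>x\<in>ball a R. ((\<lambda>n. mpow (\<kappa> n) (x - a) *\<^sub>R e n) has_sum v) I)"
    by (rule exI[of _ UNIV], rule exI[of _ "\<lambda>_ _. 0"], rule exI[of _ "\<lambda>_. v"], rule exI[of _ 1])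
       (auto intro!: has_sum_finiteI summable_on_finite simp: UNIV_unit)
qed

text \<open>For real numbers unconditional summability is absolute. Convergence at the single point
  whose coordinates all exceed those of \<open>a\<close> by \<open>R\<close> therefore yields a
  majorant on the ball of radius \<open>R\<close>, and continuity follows from the parametrised case
  with a one-point parameter set.\<close>

lemma real_analytic_on_imp_continuous_on:
  fixes h :: "'a::euclidean_space \<Rightarrow> real"
  assumes "real_analytic_on h A"
  shows "continuous_on A h"
  unfolding continuous_on_def
proof
  fix a assume "a \<in> A"
  let ?B = "Basis \<rightarrow>\<^sub>E (UNIV :: nat set)"
  obtain c r where r: "r > 0" and c: "\<And>x. x \<in> ball a r \<Longrightarrow> ((\<lambda>k. mpow k (x - a) *\<^sub>R c k) has_sum h x) ?B"
    using bspec[OF assms[unfolded real_analytic_on_def] \<open>a \<in> A\<close>] unfolding mpow_def by blast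
  \<comment> \<open>Small enough that this corner point, at distance at most
    \<open>DIM('a) * R\<close> from \<open>a\<close>, stays in the ball of convergence.\<close>
  define R where "R = r / (DIM('a) + 1)"
  have R: "0 < R" "real DIM('a) * R < r" "R \<le> r"
    using r by (auto simp: R_def field_simps)
  define x where "x = a + (\<Sum>b\<in>Basis. R *\<^sub>R b)"
  have "norm (\<Sum>b\<in>(Basis :: 'a set). R *\<^sub>R b) \<le> (\<Sum>b\<in>(Basis :: 'a set). R)"
    by (rule order_trans[OF norm_sum]) (use R in \<open>auto intro!: sum_mono\<close>)
  then have "x \<in> ball a r" using R by (simp add: x_def dist_norm)
  from c[OF this] have "((\<lambda>k. mpow k (x - a) *\<^sub>R c k) has_sum h x) ?B" .
  moreover have "mpow k (x - a) = R ^ mdeg k" for k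
    by (simp add: mpow_def x_def mdeg_def inner_sum_left inner_Basis power_sum if_distrib cong: if_cong)
  ultimately have "(\<lambda>k. R ^ mdeg k * c k) summable_on ?B" by (auto intro: has_sum_imp_summable)
  then have "(\<lambda>k. norm (R ^ mdeg k * c k)) summable_on ?B"
    by (rule summable_on_iff_abs_summable_on_real[THEN iffD1])
  then have sm: "(\<lambda>k. \<bar>c k\<bar> * R ^ mdeg k) summable_on ?B"
    using R by (simp add: abs_mult mult.commute)
  have "unif_ps {0} a R (\<lambda>x w. of_real (h x))"
  proof (rule unif_psI[where I = ?B and \<kappa> = "\<lambda>k. k" and d = "\<lambda>k w. of_real (c k)" and M = "\<lambda>k. \<bar>c k\<bar>"])
    show "countable ?B" by (intro countable_PiE) auto
    fix x w assume "x \<in> ball a R"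
    then have "x \<in> ball a r" using R by auto
    from has_sum_of_real[OF c[OF this], where ?'a = complex]
    show "((\<lambda>k. of_real (mpow k (x - a)) * of_real (c k) :: complex) has_sum of_real (h x)) ?B" by simp
  qed (use sm in auto)
  from unif_ps_uniform_limit[OF this R(1)]
  have "((\<lambda>x. complex_of_real (h x)) \<longlongrightarrow> of_real (h a)) (at a)"
    by (rule tendsto_uniform_limitI) simp
  then have "(h \<longlongrightarrow> h a) (at a)" by (simp only: tendsto_of_real_iff)
  then show "(h \<longlongrightarrow> h a) (at a within A)" by (rule tendsto_within_subset) simp
qed

section \<open>Charts, translations and graphs\<close>

text \<open>The condition at a single point, separated so that charts can be transferred between
  sets that agree near that point.\<close>

definition submanifold_chart :: "nat \<Rightarrow> 'a::euclidean_space set \<Rightarrow> 'a \<Rightarrow> bool" where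
  "submanifold_chart d S a \<longleftrightarrow> (\<exists>U W (\<phi> :: 'a \<Rightarrow> 'a) \<psi> L.
     open U \<and> a \<in> U \<and> open W \<and> homeomorphism U W \<phi> \<psi> \<and>
     real_analytic_on \<phi> U \<and> real_analytic_on \<psi> W \<and>
     subspace L \<and> dim L = d \<and> \<phi> ` (S \<inter> U) = L \<inter> W)"

lemma analytic_submanifold_iff: "analytic_submanifold d S \<longleftrightarrow> (\<forall>a\<in>S. submanifold_chart d S a)"
  unfolding analytic_submanifold_def submanifold_chart_def ..

text \<open>Having a chart is a local property: \<open>U\<close> is cut down to
  \<open>U \<inter> V\<close>, and \<open>W\<close> to the preimage of \<open>V\<close> under
  \<open>\<psi>\<close>.\<close>

lemma submanifold_chart_cong:
  fixes S T :: "'a::euclidean_space set"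
  assumes "submanifold_chart d S a" "open V" "a \<in> V" "V \<inter> S = V \<inter> T"
  shows "submanifold_chart d T a"
proof -
  obtain U W and \<phi> \<psi> :: "'a \<Rightarrow> 'a" and L where h: "open U" "a \<in> U" "open W" "homeomorphism U W \<phi> \<psi>"
    "real_analytic_on \<phi> U" "real_analytic_on \<psi> W" "subspace L" "dim L = d" "\<phi> ` (S \<inter> U) = L \<inter> W"
    using assms(1) unfolding submanifold_chart_def by blast
  have \<psi>\<phi>: "\<And>x. x \<in> U \<Longrightarrow> \<psi> (\<phi> x) = x" and \<phi>\<psi>: "\<And>x. x \<in> W \<Longrightarrow> \<phi> (\<psi> x) = x"
    and im: "\<phi> ` U = W" "\<psi> ` W = U" and cont: "continuous_on W \<psi>"
    using h(4) unfolding homeomorphism_def by auto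
  have W': "\<phi> ` (U \<inter> V) = W \<inter> \<psi> -` V"
  proof (intro equalityI subsetI)
    fix w assume w: "w \<in> W \<inter> \<psi> -` V"
    then have "w = \<phi> (\<psi> w)" "\<psi> w \<in> U" using \<phi>\<psi> im by auto
    with w show "w \<in> \<phi> ` (U \<inter> V)" by blast
  qed (use \<psi>\<phi> im in auto)
  have "inj_on \<phi> U" using \<psi>\<phi> by (rule inj_on_inverseI)
  then have "\<phi> ` ((S \<inter> U) \<inter> (U \<inter> V)) = \<phi> ` (S \<inter> U) \<inter> \<phi> ` (U \<inter> V)"
    by (rule inj_on_image_Int) auto
  also have "(S \<inter> U) \<inter> (U \<inter> V) = T \<inter> (U \<inter> V)" using assms(4) by blast
  finally have im': "\<phi> ` (T \<inter> (U \<inter> V)) = L \<inter> (W \<inter> \<psi> -` V)" unfolding h(9) W' by blast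
  have "homeomorphism (U \<inter> V) (W \<inter> \<psi> -` V) \<phi> \<psi>"
    by (rule homeomorphism_of_subsets[OF h(4) _ _ W']) auto
  moreover have "open (W \<inter> \<psi> -` V)" by (rule continuous_open_preimage[OF cont h(3) assms(2)])
  moreover have "real_analytic_on \<phi> (U \<inter> V)" "real_analytic_on \<psi> (W \<inter> \<psi> -` V)"
    by (rule real_analytic_on_subset[OF h(5)], simp, rule real_analytic_on_subset[OF h(6)], simp)
  ultimately show ?thesis
    unfolding submanifold_chart_def using h(1,2,7,8) assms(2,3) im' by blast
qed

lemma analytic_submanifold_translation:
  fixes S :: "'a::euclidean_space set"
  assumes "analytic_submanifold d S"
  shows "analytic_submanifold d ((+) t ` S)"
  unfolding analytic_submanifold_iff
proof
  fix a assume "a \<in> (+) t ` S"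
  then obtain a' where a': "a' \<in> S" "a = t + a'" by auto
  obtain U W and \<phi> \<psi> :: "'a \<Rightarrow> 'a" and L where h: "open U" "a' \<in> U" "open W" "homeomorphism U W \<phi> \<psi>"
    "real_analytic_on \<phi> U" "real_analytic_on \<psi> W" "subspace L" "dim L = d" "\<phi> ` (S \<inter> U) = L \<inter> W"
    using bspec[OF assms[unfolded analytic_submanifold_iff] a'(1)] unfolding submanifold_chart_def by blast
  show "submanifold_chart d ((+) t ` S) a"
    unfolding submanifold_chart_def
  proof (rule exI[of _ "(+) t ` U"], rule exI[of _ W], rule exI[of _ "\<phi> \<circ> (+) (- t)"],
      rule exI[of _ "(+) t \<circ> \<psi>"], rule exI[of _ L], intro conjI)
    show "open ((+) t ` U)" by (rule open_translation[OF h(1)])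
    show "homeomorphism ((+) t ` U) W (\<phi> \<circ> (+) (- t)) ((+) t \<circ> \<psi>)"
      by (rule homeomorphism_compose[OF homeomorphism_translation h(4)])
    have "(+) (- t) ` (+) t ` U = U" by (simp add: image_image)
    then have "real_analytic_on \<phi> ((+) (- t) ` (+) t ` U)" using h(5) by simp
    from real_analytic_on_translate[OF this]
    show "real_analytic_on (\<phi> \<circ> (+) (- t)) ((+) t ` U)" by (simp add: o_def)
    from real_analytic_on_add[OF h(6) real_analytic_on_const[of t]]
    show "real_analytic_on ((+) t \<circ> \<psi>) W" by (simp add: o_def add.commute)
    have "(\<phi> \<circ> (+) (- t)) ` ((+) t ` S \<inter> (+) t ` U) = \<phi> ` (S \<inter> U)"
    proof -
      have "(+) t ` S \<inter> (+) t ` U = (+) t ` (S \<inter> U)" by auto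
      then show ?thesis by (simp add: image_image)
    qed
    then show "(\<phi> \<circ> (+) (- t)) ` ((+) t ` S \<inter> (+) t ` U) = L \<inter> W" using h(9) by simp
  qed (use h a' in auto)
qed

lemma real_axis_inner: "y \<bullet> axis i (1 :: complex) = Re (y $ i)"
  by (simp add: inner_axis inner_complex_def)

lemma imag_axis_inner: "y \<bullet> axis i \<i> = Im (y $ i)"
  by (simp add: inner_axis inner_complex_def)

lemma dim_real_hyperplane:
  fixes j :: "'n::finite"
  defines "L \<equiv> {y :: complex^'n. (\<forall>i. Im (y $ i) = 0) \<and> Re (y $ j) = 0}"
  shows "subspace L" "dim L = CARD('n) - 1"
proof -
  let ?d = "(\<lambda>i. axis i (1 :: complex)) ` (UNIV - {j}) :: (complex^'n) set"
  have d: "?d \<subseteq> Basis" by (auto simp: Basis_vec_def Basis_complex_def)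
  have ax: "axis i (1 :: complex) \<in> ?d \<longleftrightarrow> i \<noteq> j" "axis i \<i> \<notin> ?d" for i
    by (auto simp: axis_eq_axis)
  have L: "L = {y. \<forall>b\<in>Basis. b \<notin> ?d \<longrightarrow> y \<bullet> b = 0}"
  proof -
    have "(\<forall>b\<in>Basis. b \<notin> ?d \<longrightarrow> y \<bullet> b = 0) \<longleftrightarrow> (\<forall>i. Im (y $ i) = 0) \<and> Re (y $ j) = 0" for y :: "complex^'n"
    proof -
      have "(\<forall>b\<in>Basis. b \<notin> ?d \<longrightarrow> y \<bullet> b = 0) \<longleftrightarrow>
          (\<forall>i. (axis i (1::complex) \<notin> ?d \<longrightarrow> y \<bullet> axis i 1 = 0) \<and> (axis i \<i> \<notin> ?d \<longrightarrow> y \<bullet> axis i \<i> = 0))"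
        unfolding Basis_vec_def Basis_complex_def by blast
      then show ?thesis by (auto simp only: ax real_axis_inner imag_axis_inner)
    qed
    then show ?thesis by (simp add: L_def)
  qed
  show "subspace L" unfolding L by (rule subspace_substandard)
  have "dim L = card ?d" unfolding L by (rule dim_substandard[OF d])
  also have "card ?d = CARD('n) - 1"
    by (subst card_image) (auto simp: inj_on_def axis_eq_axis)
  finally show "dim L = CARD('n) - 1" .
qed

text \<open>Subtracting \<open>H y\<close> from the \<open>j\<close>-th coordinate straightens the
  graph to a coordinate subspace. As \<open>H\<close> ignores that coordinate, adding
  \<open>H y\<close> is the inverse, and \<open>V\<close> is invariant under both maps; one chart on
  all of \<open>V\<close> serves every point.\<close>

lemma analytic_submanifold_graph:
  fixes V :: "(complex^'n) set" and j :: 'n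
  defines "P \<equiv> \<lambda>y y'. \<forall>i. i \<noteq> j \<longrightarrow> Re (y $ i) = Re (y' $ i)"
  assumes V: "open V" and H: "real_analytic_on H V"
    and V_cong: "\<And>y y'. P y y' \<Longrightarrow> y \<in> V \<Longrightarrow> y' \<in> V"
    and H_cong: "\<And>y y'. P y y' \<Longrightarrow> H y = H y'"
  shows "analytic_submanifold (CARD('n) - 1) {y \<in> V. (\<forall>i. Im (y $ i) = 0) \<and> Re (y $ j) = H y}"
  unfolding analytic_submanifold_iff submanifold_chart_def
proof
  fix a assume a: "a \<in> {y \<in> V. (\<forall>i. Im (y $ i) = 0) \<and> Re (y $ j) = H y}"
  define L where "L = {y :: complex^'n. (\<forall>i. Im (y $ i) = 0) \<and> Re (y $ j) = 0}"
  define e where "e = (axis j 1 :: complex^'n)"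
  have e: "e $ i = (if i = j then 1 else 0)" for i by (simp add: e_def axis_def)
  define g where "g s y = y + H y *\<^sub>R (s *\<^sub>R e)" for s :: real and y
  have Pg: "P y (g s y)" for s y by (simp add: P_def g_def e)
  have Pg': "P (g s y) y" for s y by (simp add: P_def g_def e)
  have gg: "g s (g (- s) y) = y" for s y
    unfolding g_def[of s] H_cong[OF Pg'[of "- s" y]] by (simp add: g_def)
  have gV: "g s ` V = V" for s
  proof
    show "g s ` V \<subseteq> V" using V_cong[OF Pg] by blast
    show "V \<subseteq> g s ` V" using V_cong[OF Pg, of _ "- s"] gg[of s] by (metis imageI subsetI)
  qed
  have an: "real_analytic_on (g s) V" for s
    unfolding g_def by (intro real_analytic_on_add real_analytic_on_id real_analytic_on_scaleR_left H)
  have cont: "continuous_on V (g s)" for s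
    unfolding g_def by (intro continuous_intros real_analytic_on_imp_continuous_on[OF H])
  have hom: "homeomorphism V V (g (-1)) (g 1)"
    by (rule homeomorphismI) (use cont gV gg[of 1] gg[of "-1"] in auto)
  have im: "g (-1) ` ({y \<in> V. (\<forall>i. Im (y $ i) = 0) \<and> Re (y $ j) = H y} \<inter> V) = L \<inter> V"
  proof (intro equalityI subsetI)
    fix y assume "y \<in> L \<inter> V"
    then have "g 1 y \<in> {y \<in> V. (\<forall>i. Im (y $ i) = 0) \<and> Re (y $ j) = H y} \<inter> V"
      using V_cong[OF Pg[of y 1]] H_cong[OF Pg'[of 1 y]] by (auto simp: g_def e L_def)
    moreover have "y = g (-1) (g 1 y)" using gg[of "-1" y] by simp
    ultimately show "y \<in> g (-1) ` ({y \<in> V. (\<forall>i. Im (y $ i) = 0) \<and> Re (y $ j) = H y} \<inter> V)" by blast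
  qed (use V_cong[OF Pg[of _ "-1"]] in \<open>auto simp: g_def e L_def\<close>)
  show "\<exists>U W (\<phi> :: complex^'n \<Rightarrow> complex^'n) \<psi> L. open U \<and> a \<in> U \<and> open W \<and> homeomorphism U W \<phi> \<psi> \<and>
     real_analytic_on \<phi> U \<and> real_analytic_on \<psi> W \<and> subspace L \<and> dim L = CARD('n) - 1 \<and>
     \<phi> ` ({y \<in> V. (\<forall>i. Im (y $ i) = 0) \<and> Re (y $ j) = H y} \<inter> U) = L \<inter> W"
    using V a hom an im dim_real_hyperplane[of j, folded L_def] by blast
qed

section \<open>Period matrices\<close>

definition ivec :: "int^'n \<Rightarrow> real^'n" where
  "ivec m = (\<chi> i. of_int (m $ i))"

definition im_mat :: "complex^'n^'n \<Rightarrow> real^'n^'n" where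
  "im_mat \<tau> = (\<chi> i j. Im (\<tau> $ i $ j))"

definition im_vec :: "complex^'n \<Rightarrow> real^'n" where
  "im_vec z = (\<chi> i. Im (z $ i))"

definition re_vec :: "complex^'n \<Rightarrow> real^'n" where
  "re_vec z = (\<chi> i. Re (z $ i))"

lemma cvec_eq_rvec: "cvec m = rvec (ivec m)"
  by (simp add: cvec_def rvec_def ivec_def)

lemma freq_eq_rvec: "freq \<alpha> m = rvec (ivec m + \<alpha>)"
  by (simp add: freq_def cvec_eq_rvec rvec_add)

lemma ivec_add: "ivec (m + n) = ivec m + ivec n"
  by (simp add: ivec_def vec_eq_iff)

lemma ivec_uminus: "ivec (- m) = - ivec m"
  by (simp add: ivec_def vec_eq_iff)

lemma rvec_uminus: "rvec (- x) = - rvec x"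
  by (simp add: rvec_def vec_eq_iff)

lemma rvec_diff: "rvec (x - y) = rvec x - rvec y"
  by (simp add: rvec_def vec_eq_iff)

lemma rvec_zero [simp]: "rvec 0 = 0"
  by (simp add: rvec_def vec_eq_iff)

lemma cnj_rvec [simp]: "cnj_vec (rvec x) = rvec x"
  by (simp add: cnj_vec_def rvec_def)

lemma eq_rvec_re_vec: "im_vec z = 0 \<Longrightarrow> z = rvec (re_vec z)"
  by (simp add: im_vec_def re_vec_def rvec_def vec_eq_iff complex_eq_iff)

lemma im_vec_diff: "im_vec (z - w) = im_vec z - im_vec w"
  by (simp add: im_vec_def vec_eq_iff)

lemma im_vec_rvec [simp]: "im_vec (rvec x) = 0"
  by (simp add: im_vec_def rvec_def vec_eq_iff)

lemma im_vec_cnj: "im_vec (cnj_vec z) = - im_vec z"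
  by (simp add: im_vec_def cnj_vec_def vec_eq_iff)

lemma norm_im_vec_le: "norm (im_vec z) \<le> norm z"
  by (rule norm_le_componentwise_cart) (simp add: im_vec_def abs_Im_le_cmod)

lemma im_vec_period: "im_vec (\<tau> *v rvec x) = im_mat \<tau> *v x"
  by (simp add: im_vec_def im_mat_def rvec_def matrix_vector_mult_def vec_eq_iff)

lemma inner_matrix_vector: "x \<bullet> (A *v y) = (\<Sum>i\<in>UNIV. \<Sum>j\<in>UNIV. x $ i * A $ i $ j * y $ j)"
  for A :: "real^'n^'n"
  by (simp add: inner_vec_def matrix_vector_mult_def sum_distrib_left mult.assoc)

lemma cdot_matrix_vector: "cdot u (A *v v) = (\<Sum>i\<in>UNIV. \<Sum>j\<in>UNIV. u $ i * A $ i $ j * v $ j)"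
  by (simp add: cdot_def matrix_vector_mult_def sum_distrib_left mult.assoc)

lemma inner_symmetric_matrix:
  fixes A :: "real^'n^'n"
  assumes "\<And>i j. A $ i $ j = A $ j $ i"
  shows "x \<bullet> (A *v y) = y \<bullet> (A *v x)"
proof -
  have "x \<bullet> (A *v y) = (\<Sum>j\<in>UNIV. \<Sum>i\<in>UNIV. x $ i * A $ i $ j * y $ j)"
    unfolding inner_matrix_vector by (rule sum.swap)
  also have "\<dots> = y \<bullet> (A *v x)"
    unfolding inner_matrix_vector by (intro sum.cong) (auto simp: assms mult_ac)
  finally show ?thesis .
qed

lemma cdot_symmetric_matrix:
  assumes "transpose A = A"
  shows "cdot u (A *v v) = cdot v (A *v u)"
proof -
  have A: "A $ i $ j = A $ j $ i" for i j using assms by (metis transpose_def vec_lambda_beta)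
  have "cdot u (A *v v) = (\<Sum>j\<in>UNIV. \<Sum>i\<in>UNIV. u $ i * A $ i $ j * v $ j)"
    unfolding cdot_matrix_vector by (rule sum.swap)
  also have "\<dots> = cdot v (A *v u)"
    unfolding cdot_matrix_vector
  proof (intro sum.cong refl)
    show "u $ i * A $ i $ j * v $ j = v $ j * A $ j $ i * u $ i" for i j
      using A[of i j] by (simp add: mult_ac)
  qed
  finally show ?thesis .
qed

text \<open>\<open>\<delta>\<close> is the minimum of the positive quadratic form on the compact
  unit sphere; homogeneity does the rest.\<close>

lemma siegel_lower_bound:
  assumes "\<tau> \<in> siegel"
  obtains \<delta> where "\<delta> > 0" "\<And>x. \<delta> * (norm x)\<^sup>2 \<le> x \<bullet> (im_mat \<tau> *v x)"
proof -
  have pos: "x \<bullet> (im_mat \<tau> *v x) > 0" if "x \<noteq> 0" for x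
    using assms that unfolding siegel_def im_mat_def by blast
  have cont: "continuous_on (sphere 0 1) (\<lambda>x. x \<bullet> (im_mat \<tau> *v x))"
    by (intro continuous_intros matrix_vector_mult_linear_continuous_on)
  have "axis undefined 1 \<in> sphere (0 :: real^'a) 1" by (simp add: norm_axis_1)
  then have ne: "sphere (0 :: real^'a) 1 \<noteq> {}" by blast
  obtain u where u: "u \<in> sphere 0 1" "\<And>x. x \<in> sphere 0 1 \<Longrightarrow>
      u \<bullet> (im_mat \<tau> *v u) \<le> x \<bullet> (im_mat \<tau> *v x)"
    using continuous_attains_inf[OF compact_sphere ne cont] by blast
  show thesis
  proof (rule that)
    show "u \<bullet> (im_mat \<tau> *v u) > 0" using u(1) by (intro pos) auto
    fix x :: "real^'a"
    show "u \<bullet> (im_mat \<tau> *v u) * (norm x)\<^sup>2 \<le> x \<bullet> (im_mat \<tau> *v x)"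
    proof (cases "x = 0")
      case False
      define y where "y = x /\<^sub>R norm x"
      have x: "x = norm x *\<^sub>R y" using False by (simp add: y_def)
      have "x \<bullet> (im_mat \<tau> *v x) = (norm x)\<^sup>2 * (y \<bullet> (im_mat \<tau> *v y))"
        by (subst (1 2) x) (simp add: matrix_vector_mult_scaleR power2_eq_square)
      moreover have "u \<bullet> (im_mat \<tau> *v u) \<le> y \<bullet> (im_mat \<tau> *v y)"
        using False by (intro u(2)) (simp add: y_def)
      ultimately show ?thesis by (simp add: mult_right_mono mult.commute[of "(norm x)\<^sup>2"])
    qed simp
  qed
qed

section \<open>The period lattice and the quasi-periodicity of theta\<close>

lemma norm_ivec_ge_1:
  assumes "m \<noteq> 0"
  shows "norm (ivec m) \<ge> 1"
proof -
  obtain i where "m $ i \<noteq> 0" using assms by (auto simp: vec_eq_iff)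
  then have "1 \<le> \<bar>real_of_int (m $ i)\<bar>" by linarith
  also have "\<dots> \<le> norm (ivec m)"
    using component_le_norm_cart[of "ivec m" i] by (simp add: ivec_def)
  finally show ?thesis .
qed

lemma norm_rvec: "norm (rvec x) = norm x"
  by (simp add: norm_vec_def rvec_def L2_set_def)

lemma ivec_zero [simp]: "ivec 0 = 0"
  by (simp add: ivec_def vec_eq_iff)

text \<open>If \<open>n\<close> is nonzero, the imaginary part of the lattice vector,
  \<open>im_mat \<tau>\<close> applied to \<open>n\<close>, has length at least
  \<open>\<delta>\<close> by Cauchy-Schwarz. If \<open>n = 0\<close>, an integral vector remains, of
  length at least 1 unless it is 0.\<close>

lemma lattice_discrete:
  assumes "\<tau> \<in> siegel"
  obtains \<delta> where "\<delta> > 0" "\<And>l. l \<in> lattice \<tau> \<Longrightarrow> norm l < \<delta> \<Longrightarrow> l = 0"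
proof -
  obtain \<delta> where \<delta>: "\<delta> > 0" "\<And>x. \<delta> * (norm x)\<^sup>2 \<le> x \<bullet> (im_mat \<tau> *v x)"
    using siegel_lower_bound[OF assms] by blast
  show thesis
  proof (rule that)
    show "min \<delta> 1 > 0" using \<delta> by simp
    fix l assume "l \<in> lattice \<tau>" and l: "norm l < min \<delta> 1"
    then obtain m n where lmn: "l = rvec (ivec m) + \<tau> *v rvec (ivec n)"
      by (auto simp: lattice_def cvec_eq_rvec)
    have "n = 0"
    proof (rule ccontr)
      assume n: "n \<noteq> 0"
      let ?x = "ivec n"
      have "im_vec l = im_mat \<tau> *v ?x"
        using im_vec_period[of \<tau> ?x] by (simp add: lmn im_vec_def rvec_def vec_eq_iff)
      have "\<delta> * norm ?x * norm ?x \<le> norm ?x * norm (im_mat \<tau> *v ?x)"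
        using \<delta>(2)[of ?x] norm_cauchy_schwarz[of ?x "im_mat \<tau> *v ?x"] by (simp add: power2_eq_square mult_ac)
      then have "norm ?x * (\<delta> * norm ?x) \<le> norm ?x * norm (im_mat \<tau> *v ?x)"
        by (simp only: mult_ac)
      moreover have "0 < norm ?x" using norm_ivec_ge_1[OF n] by linarith
      ultimately have "\<delta> * norm ?x \<le> norm (im_mat \<tau> *v ?x)"
        by (rule mult_left_le_imp_le)
      also have "\<dots> \<le> norm l" using norm_im_vec_le[of l] \<open>im_vec l = _\<close> by simp
      finally have "\<delta> * norm ?x \<le> norm l" .
      moreover have "\<delta> * 1 \<le> \<delta> * norm ?x"
        using norm_ivec_ge_1[OF n] \<delta>(1) by (intro mult_left_mono) auto
      ultimately show False using l by simp
    qed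
    moreover have "m = 0"
      using norm_ivec_ge_1[of m] l \<open>n = 0\<close> by (force simp: lmn norm_rvec)
    ultimately show "l = 0" by (simp add: lmn)
  qed
qed

lemma zero_in_lattice: "0 \<in> lattice \<tau>"
proof -
  have "(0 :: complex^'a) = cvec 0 + \<tau> *v cvec 0" by (simp add: cvec_eq_rvec)
  then show ?thesis unfolding lattice_def by blast
qed

lemma lattice_add: "k \<in> lattice \<tau> \<Longrightarrow> l \<in> lattice \<tau> \<Longrightarrow> k + l \<in> lattice \<tau>"
proof -
  assume "k \<in> lattice \<tau>" "l \<in> lattice \<tau>"
  then obtain m n m' n' where "k = cvec m + \<tau> *v cvec n" "l = cvec m' + \<tau> *v cvec n'"
    unfolding lattice_def by blast
  then have "k + l = cvec (m + m') + \<tau> *v cvec (n + n')"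
    by (simp add: cvec_eq_rvec ivec_add rvec_add matrix_vector_right_distrib)
  then show ?thesis unfolding lattice_def by blast
qed

lemma lattice_uminus: "l \<in> lattice \<tau> \<Longrightarrow> - l \<in> lattice \<tau>"
proof -
  assume "l \<in> lattice \<tau>"
  then obtain m n where "l = cvec m + \<tau> *v cvec n"
    unfolding lattice_def by blast
  then have "- l = cvec (- m) + \<tau> *v cvec (- n)"
    by (simp add: cvec_eq_rvec ivec_uminus rvec_uminus vec.neg)
  then show ?thesis unfolding lattice_def by blast
qed

lemma lattice_diff: "k \<in> lattice \<tau> \<Longrightarrow> l \<in> lattice \<tau> \<Longrightarrow> k - l \<in> lattice \<tau>"
  using lattice_add[of k \<tau> "- l"] lattice_uminus[of l \<tau>] by simp

lemma tproj_eq_iff: "tproj \<tau> z = tproj \<tau> w \<longleftrightarrow> z - w \<in> lattice \<tau>"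
proof
  assume "tproj \<tau> z = tproj \<tau> w"
  moreover have "z \<in> tproj \<tau> z" unfolding tproj_def using zero_in_lattice by force
  ultimately show "z - w \<in> lattice \<tau>" unfolding tproj_def by auto
next
  assume l: "z - w \<in> lattice \<tau>"
  have "z + k \<in> tproj \<tau> w" if "k \<in> lattice \<tau>" for k
    unfolding tproj_def using lattice_add[OF l that] by (intro image_eqI[of _ _ "(z - w) + k"]) auto
  moreover have "w + k \<in> tproj \<tau> z" if "k \<in> lattice \<tau>" for k
    unfolding tproj_def using lattice_diff[OF that l] by (intro image_eqI[of _ _ "k - (z - w)"]) auto
  ultimately show "tproj \<tau> z = tproj \<tau> w" unfolding tproj_def by blast
qed

text \<open>Translating by \<open>p + \<tau> n\<close> amounts to reindexing \<open>m\<close> as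
  \<open>m + n\<close>, up to the factor of automorphy \<open>k\<close>, which does not depend on
  \<open>m\<close>; the integral part \<open>p\<close> only contributes factors 1.\<close>

lemma theta_lattice_zero:
  assumes \<tau>: "transpose \<tau> = \<tau>" and l: "l \<in> lattice \<tau>" and z: "theta \<tau> z = 0"
  shows "theta \<tau> (z + l) = 0"
proof -
  obtain p n where l: "l = cvec p + \<tau> *v cvec n" using l unfolding lattice_def by blast
  define E where "E m = exp (of_real pi * \<i> * cdot (cvec m) (\<tau> *v cvec m) + 2 * of_real pi * \<i> * cdot (cvec m) z)" for m
  define k where "k = exp (- (of_real pi * \<i> * cdot (cvec n) (\<tau> *v cvec n)) - 2 * of_real pi * \<i> * cdot (cvec n) z)"
  have "exp (of_real pi * \<i> * cdot (cvec m) (\<tau> *v cvec m) + 2 * of_real pi * \<i> * cdot (cvec m) (z + l)) = k * E (m + n)" for m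
  proof -
    have "cdot (cvec m) (cvec p) = of_int (\<Sum>i\<in>UNIV. m $ i * p $ i)"
      by (simp add: cdot_def cvec_def)
    then obtain q :: int where "cdot (cvec m) (cvec p) = of_int q" by blast
    then have 1: "exp (2 * of_real pi * \<i> * cdot (cvec m) (cvec p)) = 1"
      using exp_integer_2pi[of "of_int q"] by (simp add: mult_ac)
    have "cvec (m + n) = cvec m + cvec n" by (simp add: cvec_eq_rvec ivec_add rvec_add)
    then have "k * E (m + n) = exp (of_real pi * \<i> * cdot (cvec m) (\<tau> *v cvec m)
         + 2 * of_real pi * \<i> * (cdot (cvec m) z + cdot (cvec m) (\<tau> *v cvec n)))"
      unfolding k_def E_def exp_add[symmetric]
      by (simp add: matrix_vector_right_distrib cdot_add_right cdot_add_left
          cdot_symmetric_matrix[OF \<tau>, of "cvec n" "cvec m"] algebra_simps)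
    also have "\<dots> = exp (of_real pi * \<i> * cdot (cvec m) (\<tau> *v cvec m)
         + 2 * of_real pi * \<i> * (cdot (cvec m) z + cdot (cvec m) (\<tau> *v cvec n)))
         * exp (2 * of_real pi * \<i> * cdot (cvec m) (cvec p))"
      by (simp add: 1)
    finally show ?thesis
      unfolding l exp_add[symmetric] by (simp add: cdot_add_right algebra_simps)
  qed
  then have "theta \<tau> (z + l) = (\<Sum>\<^sub>\<infinity>m. k * E (m + n))"
    by (simp add: theta_def)
  also have "\<dots> = k * (\<Sum>\<^sub>\<infinity>m. E (m + n))" by (rule infsum_cmult_right')
  also have "(\<Sum>\<^sub>\<infinity>m. E (m + n)) = (\<Sum>\<^sub>\<infinity>m. E m)"
    by (rule infsum_reindex_bij_witness[of _ "\<lambda>m. m - n" "\<lambda>m. m + n"]) auto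
  also have "\<dots> = theta \<tau> z" by (simp add: theta_def E_def)
  finally show ?thesis using z by simp
qed

lemma tproj_mem_theta_divisor_iff:
  assumes "transpose \<tau> = \<tau>"
  shows "tproj \<tau> z \<in> theta_divisor \<tau> \<longleftrightarrow> theta \<tau> z = 0"
proof
  assume "tproj \<tau> z \<in> theta_divisor \<tau>"
  then obtain w where w: "tproj \<tau> z = tproj \<tau> w" "theta \<tau> w = 0" unfolding theta_divisor_def by blast
  then have "theta \<tau> (w + (z - w)) = 0"
    by (intro theta_lattice_zero[OF assms]) (simp_all add: tproj_eq_iff)
  then show "theta \<tau> z = 0" by simp
qed (auto simp: theta_divisor_def)

section \<open>The theta function on the real points\<close>

lemma M_matrix_sym: "M_matrix lam $ i $ j = M_matrix lam $ j $ i"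
  by (auto simp: M_matrix_def)

lemma M_matrix_diag: "M_matrix lam $ i $ i = 0"
  by (simp add: M_matrix_def)

lemma M_matrix_Ints: "M_matrix lam $ i $ j \<in> \<int>"
  by (simp add: M_matrix_def)

text \<open>The matrix is integral and symmetric with zero diagonal, so the off-diagonal entries
  contribute in equal pairs. This parity is what makes the phases of the theta coefficients
  real.\<close>

lemma M_matrix_even:
  fixes m :: "int^('n::{finite,linorder})"
  obtains k :: int where "ivec m \<bullet> (M_matrix lam *v ivec m) = 2 * of_int k"
proof -
  define a where "a i j = ivec m $ i * M_matrix lam $ i $ j * ivec m $ j" for i j
  have sym: "a i j = a j i" for i j
    unfolding a_def M_matrix_sym[of lam i j] by (simp add: mult_ac)
  have "a i j = (if i < j then a i j else 0) + (if j < i then a i j else 0)" for i j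
    by (cases i j rule: linorder_cases) (auto simp: a_def M_matrix_diag)
  then have "(\<Sum>i\<in>UNIV. \<Sum>j\<in>UNIV. a i j) = (\<Sum>i\<in>UNIV. \<Sum>j\<in>UNIV. if i < j then a i j else 0)
      + (\<Sum>i\<in>UNIV. \<Sum>j\<in>UNIV. if j < i then a i j else 0)"
    by (simp only: sum.distrib[symmetric])
  also have "(\<Sum>i\<in>UNIV. \<Sum>j\<in>UNIV. if j < i then a i j else 0) = (\<Sum>j\<in>UNIV. \<Sum>i\<in>UNIV. if j < i then a j i else 0)"
    by (subst sum.swap) (simp only: sym)
  finally have 1: "ivec m \<bullet> (M_matrix lam *v ivec m) = 2 * (\<Sum>i\<in>UNIV. \<Sum>j\<in>UNIV. if i < j then a i j else 0)"
    unfolding inner_matrix_vector a_def[symmetric] by simp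
  have "a i j \<in> \<int>" for i j
    unfolding a_def by (intro Ints_mult M_matrix_Ints) (simp_all add: ivec_def)
  then have "(\<Sum>i\<in>UNIV. \<Sum>j\<in>UNIV. if i < j then a i j else 0) \<in> \<int>"
    by (intro Ints_sum) auto
  then obtain k where "(\<Sum>i\<in>UNIV. \<Sum>j\<in>UNIV. if i < j then a i j else 0) = of_int k"
    by (rule Ints_cases)
  with 1 that show thesis by simp
qed

lemma siegel_real_Re:
  assumes "\<tau> \<in> siegel_real lam"
  shows "Re (\<tau> $ i $ j) = M_matrix lam $ i $ j / 2"
proof -
  have "(\<chi> i j. 2 * Re (\<tau> $ i $ j)) = M_matrix lam" using assms by (simp add: siegel_real_def)
  then have "2 * Re (\<tau> $ i $ j) = M_matrix lam $ i $ j" by (metis vec_lambda_beta)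
  then show ?thesis by simp
qed

lemma re_vec_period:
  assumes "\<tau> \<in> siegel_real lam"
  shows "re_vec (\<tau> *v rvec x) = (1 / 2) *\<^sub>R (M_matrix lam *v x)"
  by (simp add: re_vec_def rvec_def matrix_vector_mult_def vec_eq_iff siegel_real_Re[OF assms]
      sum_divide_distrib)

lemma cdot_rvec: "cdot (rvec x) z = Complex (x \<bullet> re_vec z) (x \<bullet> im_vec z)"
  by (simp add: complex_eq_iff cdot_def rvec_def re_vec_def im_vec_def inner_vec_def)

lemma cdot_period:
  assumes "\<tau> \<in> siegel_real lam"
  shows "cdot (rvec x) (\<tau> *v rvec y) = Complex (x \<bullet> (M_matrix lam *v y) / 2) (x \<bullet> (im_mat \<tau> *v y))"
  unfolding cdot_rvec im_vec_period re_vec_period[OF assms] by simp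

text \<open>
  The coefficients of the theta function along \<open>\<tau> \<alpha> + \<real>\<^sup>g\<close>; the last factor is a phase that makes
  them real when \<open>M \<alpha>\<close> is integral.
\<close>

definition theta_coeff ::
  "nat \<Rightarrow> complex^('n::{finite,linorder})^('n::{finite,linorder}) \<Rightarrow> real^('n::{finite,linorder}) \<Rightarrow> int^('n::{finite,linorder}) \<Rightarrow> complex" where
  "theta_coeff lam \<tau> \<alpha> m = exp (of_real pi * \<i> * cdot (freq \<alpha> m) (\<tau> *v freq \<alpha> m))
     * exp (- (of_real pi * \<i> * of_real (\<alpha> \<bullet> (M_matrix lam *v \<alpha>) / 2)))"

lemma theta_coeff_nonzero: "theta_coeff lam \<tau> \<alpha> m \<noteq> 0"
  by (simp add: theta_coeff_def)

text \<open>\<open>Re \<tau> = M / 2\<close> governs the phase and \<open>Im \<tau>\<close> the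
  Gaussian size.\<close>

lemma theta_coeff_polar:
  assumes "\<tau> \<in> siegel_real lam"
  defines "x \<equiv> \<lambda>m \<alpha>. ivec m + \<alpha>"
  shows "theta_coeff lam \<tau> \<alpha> m = of_real (exp (- pi * (x m \<alpha> \<bullet> (im_mat \<tau> *v x m \<alpha>)))) *
    cis (pi * ((x m \<alpha> \<bullet> (M_matrix lam *v x m \<alpha>) - \<alpha> \<bullet> (M_matrix lam *v \<alpha>)) / 2))"
proof -
  have "theta_coeff lam \<tau> \<alpha> m = exp (of_real pi * \<i> * cdot (freq \<alpha> m) (\<tau> *v freq \<alpha> m)
     - of_real pi * \<i> * of_real (\<alpha> \<bullet> (M_matrix lam *v \<alpha>) / 2))"
    unfolding theta_coeff_def exp_add[symmetric] add_uminus_conv_diff ..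
  also have "of_real pi * \<i> * cdot (freq \<alpha> m) (\<tau> *v freq \<alpha> m)
     - of_real pi * \<i> * of_real (\<alpha> \<bullet> (M_matrix lam *v \<alpha>) / 2)
    = of_real (- pi * (x m \<alpha> \<bullet> (im_mat \<tau> *v x m \<alpha>)))
      + \<i> * of_real (pi * ((x m \<alpha> \<bullet> (M_matrix lam *v x m \<alpha>) - \<alpha> \<bullet> (M_matrix lam *v \<alpha>)) / 2))"
    unfolding freq_eq_rvec cdot_period[OF assms(1)] x_def
    by (simp add: complex_eq_iff diff_divide_distrib right_diff_distrib)
  finally show ?thesis by (simp only: exp_add cis_conv_exp exp_of_real)
qed

lemma norm_theta_coeff:
  assumes "\<tau> \<in> siegel_real lam"
  shows "norm (theta_coeff lam \<tau> \<alpha> m) = exp (- pi * ((ivec m + \<alpha>) \<bullet> (im_mat \<tau> *v (ivec m + \<alpha>))))"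
  unfolding theta_coeff_polar[OF assms] by (simp add: norm_mult)

text \<open>The quadratic form of \<open>M\<close> at \<open>m + \<alpha>\<close> differs from its
  value at \<open>\<alpha>\<close> by its value at \<open>m\<close>, which is even, plus twice the
  integer \<open>m \<bullet> M \<alpha>\<close>. Half the difference is an integer, so the phase is
  1 or -1.\<close>

lemma cnj_theta_coeff:
  assumes \<tau>: "\<tau> \<in> siegel_real lam" and p: "M_matrix lam *v \<alpha> = ivec p"
  shows "cnj (theta_coeff lam \<tau> \<alpha> m) = theta_coeff lam \<tau> \<alpha> m"
proof -
  let ?M = "M_matrix lam"
  obtain k where k: "ivec m \<bullet> (?M *v ivec m) = 2 * of_int k" by (rule M_matrix_even)
  have "ivec m \<bullet> (?M *v \<alpha>) = of_int (\<Sum>i\<in>UNIV. m $ i * p $ i)"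
    unfolding p by (simp add: inner_vec_def ivec_def)
  then obtain q where q: "ivec m \<bullet> (?M *v \<alpha>) = of_int q" by blast
  have "(ivec m + \<alpha>) \<bullet> (?M *v (ivec m + \<alpha>)) - \<alpha> \<bullet> (?M *v \<alpha>) = 2 * of_int k + 2 * of_int q"
    using inner_symmetric_matrix[of ?M \<alpha> "ivec m", OF M_matrix_sym]
    by (simp add: matrix_vector_right_distrib inner_add_left inner_add_right k q)
  then have "((ivec m + \<alpha>) \<bullet> (?M *v (ivec m + \<alpha>)) - \<alpha> \<bullet> (?M *v \<alpha>)) / 2 = of_int (k + q)"
    by simp
  then have "theta_coeff lam \<tau> \<alpha> m =
      of_real (exp (- pi * ((ivec m + \<alpha>) \<bullet> (im_mat \<tau> *v (ivec m + \<alpha>))))) * cis (pi * of_int (k + q))"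
    unfolding theta_coeff_polar[OF \<tau>] by (simp only:)
  moreover have "sin (pi * of_int (k + q)) = 0" by (rule sin_npi_int)
  ultimately show ?thesis by (simp add: complex_eq_iff)
qed

text \<open>Completing the square against the slope \<open>|\<rho>| + 1\<close>; the extra 1 leaves
  the term \<open>- |t|\<close>, which makes the sum over the lattice converge.\<close>

lemma abs_square_bound:
  fixes t u \<rho> \<delta> :: real
  assumes "\<delta> > 0"
  shows "- \<delta> * (t + u)\<^sup>2 + \<rho> * \<bar>t\<bar> \<le> (\<bar>\<rho>\<bar> + 1)\<^sup>2 / (4 * \<delta>) + (\<bar>\<rho>\<bar> + 1) * \<bar>u\<bar> - \<bar>t\<bar>"
proof -
  define B where "B = \<bar>\<rho>\<bar> + 1"
  have "0 \<le> (2 * \<delta> * \<bar>t + u\<bar> - B)\<^sup>2 / (4 * \<delta>)" using assms by simp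
  also have "\<dots> = \<delta> * (t + u)\<^sup>2 - B * \<bar>t + u\<bar> + B\<^sup>2 / (4 * \<delta>)"
    using assms by (simp add: power2_diff power_mult_distrib field_simps) (simp add: power2_eq_square)
  finally have 1: "B * \<bar>t + u\<bar> \<le> \<delta> * (t + u)\<^sup>2 + B\<^sup>2 / (4 * \<delta>)" by simp
  have "\<bar>t\<bar> \<le> \<bar>t + u\<bar> + \<bar>u\<bar>" by simp
  then have "B * \<bar>t\<bar> \<le> B * (\<bar>t + u\<bar> + \<bar>u\<bar>)" by (rule mult_left_mono) (simp add: B_def)
  moreover have "\<rho> * \<bar>t\<bar> + \<bar>t\<bar> \<le> B * \<bar>t\<bar>" by (simp add: B_def distrib_right mult_right_mono)
  ultimately show ?thesis using 1 unfolding B_def[symmetric] by (simp add: distrib_left)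
qed

text \<open>A product of one-dimensional geometric series, transported from functions on the index
  type to vectors.\<close>

lemma summable_exp_neg_l1: "(\<lambda>m :: int^'n. exp (- l1 m)) summable_on UNIV"
proof -
  have e: "summable (\<lambda>n. exp (- real n))"
    using summable_geometric[of "exp (-1) :: real"] by (simp add: exp_of_nat_mult[symmetric] mult.commute)
  then have "(\<lambda>n. exp (- real n)) summable_on UNIV"
    by (intro summable_nonneg_imp_summable_on) auto
  then have "(\<lambda>k. exp (- \<bar>real_of_int k\<bar>)) summable_on range int"
    "(\<lambda>k. exp (- \<bar>real_of_int k\<bar>)) summable_on range (\<lambda>n. - int n)"
    by (subst summable_on_reindex; simp add: inj_on_def o_def)+
  then have "(\<lambda>k. exp (- \<bar>real_of_int k\<bar>)) summable_on (range int \<union> range (\<lambda>n. - int n))"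
    by (rule summable_on_union)
  moreover have "k \<in> range int \<union> range (\<lambda>n. - int n)" for k
    by (cases k rule: int_cases2) auto
  then have "range int \<union> range (\<lambda>n. - int n) = UNIV" by blast
  ultimately have "(\<lambda>k. norm (exp (- \<bar>real_of_int k\<bar>))) summable_on UNIV"
    by simp
  then have "Infinite_Set_Sum.abs_summable_on (\<lambda>g. \<Prod>i\<in>UNIV. exp (- \<bar>real_of_int (g i)\<bar>)) ((UNIV :: 'n set) \<rightarrow>\<^sub>E UNIV)"
    by (intro abs_summable_on_prod_PiE) (simp_all add: abs_summable_equivalent[symmetric])
  then have "(\<lambda>g. \<Prod>i\<in>UNIV. exp (- \<bar>real_of_int (g i)\<bar>)) summable_on ((UNIV :: 'n set) \<rightarrow>\<^sub>E UNIV)"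
    unfolding abs_summable_equivalent[symmetric] by (rule abs_summable_summable)
  moreover have "bij_betw (\<lambda>m :: int^'n. ($) m) UNIV (UNIV \<rightarrow>\<^sub>E UNIV)"
    by (rule bij_betw_byWitness[where f' = vec_lambda]) auto
  ultimately have "(\<lambda>m :: int^'n. \<Prod>i\<in>UNIV. exp (- \<bar>real_of_int (m $ i)\<bar>)) summable_on UNIV"
    using summable_on_reindex_bij_betw[of "\<lambda>m :: int^'n. ($) m" UNIV "UNIV \<rightarrow>\<^sub>E UNIV"
        "\<lambda>g. \<Prod>i\<in>UNIV. exp (- \<bar>real_of_int (g i)\<bar>)"] by simp
  then show ?thesis
    by (simp add: l1_def exp_sum flip: sum_negf)
qed

text \<open>Positive definiteness of \<open>Im \<tau>\<close> bounds the coefficients by a product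
  of one-variable Gaussians; these absorb any rate \<open>\<rho>\<close> and still leave
  \<open>exp (- l1 m)\<close>.\<close>

lemma rapid_decay_theta_coeff:
  assumes \<tau>: "\<tau> \<in> siegel_real lam"
  shows "rapid_decay (theta_coeff lam \<tau> \<alpha>)"
  unfolding rapid_decay_def
proof
  fix \<rho> :: real
  have "\<tau> \<in> siegel" using \<tau> by (simp add: siegel_real_def)
  then obtain \<delta> where \<delta>: "\<delta> > 0" "\<And>x. \<delta> * (norm x)\<^sup>2 \<le> x \<bullet> (im_mat \<tau> *v x)"
    using siegel_lower_bound by blast
  define C where "C = (\<Sum>i\<in>UNIV. (\<bar>\<rho>\<bar> + 1)\<^sup>2 / (4 * (pi * \<delta>)) + (\<bar>\<rho>\<bar> + 1) * \<bar>\<alpha> $ i\<bar>)"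
  show "(\<lambda>m. norm (theta_coeff lam \<tau> \<alpha> m) * exp (\<rho> * l1 m)) summable_on UNIV"
  proof (rule summable_on_comparison_test[OF summable_on_cmult_right[OF summable_exp_neg_l1, of "exp C"]])
    fix m
    let ?x = "ivec m + \<alpha>"
    have "(norm ?x)\<^sup>2 = (\<Sum>i\<in>UNIV. (of_int (m $ i) + \<alpha> $ i)\<^sup>2)"
      unfolding power2_norm_eq_inner by (simp add: inner_vec_def ivec_def power2_eq_square)
    then have "- pi * (?x \<bullet> (im_mat \<tau> *v ?x)) \<le> (\<Sum>i\<in>UNIV. - (pi * \<delta>) * (of_int (m $ i) + \<alpha> $ i)\<^sup>2)"
      using \<delta>(2)[of ?x] by (simp add: sum_distrib_left[symmetric] sum_negf mult.assoc)
    then have "- pi * (?x \<bullet> (im_mat \<tau> *v ?x)) + \<rho> * l1 m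
       \<le> (\<Sum>i\<in>UNIV. - (pi * \<delta>) * (of_int (m $ i) + \<alpha> $ i)\<^sup>2 + \<rho> * \<bar>of_int (m $ i)\<bar>)"
      unfolding sum.distrib l1_def sum_distrib_left by (rule add_right_mono)
    also have "\<dots> \<le> (\<Sum>i\<in>UNIV. (\<bar>\<rho>\<bar> + 1)\<^sup>2 / (4 * (pi * \<delta>)) + (\<bar>\<rho>\<bar> + 1) * \<bar>\<alpha> $ i\<bar> - \<bar>of_int (m $ i)\<bar>)"
      using \<delta>(1) by (intro sum_mono abs_square_bound) simp
    also have "\<dots> = C + - l1 m" unfolding C_def l1_def sum_subtractf by simp
    finally show "norm (theta_coeff lam \<tau> \<alpha> m) * exp (\<rho> * l1 m) \<le> exp C * exp (- l1 m)"
      unfolding norm_theta_coeff[OF \<tau>] exp_add[symmetric] exp_le_cancel_iff .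
  qed simp
qed

text \<open>Completing the square in \<open>m\<close>: up to terms without \<open>m\<close>,
  collected in the nonvanishing \<open>k\<close>, the exponent at \<open>\<tau> \<alpha> + z\<close>
  is the one with frequency \<open>m + \<alpha>\<close>.\<close>

lemma theta_eq_0_iff:
  assumes \<tau>: "\<tau> \<in> siegel_real lam"
  shows "theta \<tau> (\<tau> *v rvec \<alpha> + z) = 0 \<longleftrightarrow> trig (theta_coeff lam \<tau> \<alpha>) \<alpha> z = 0"
proof -
  have sym: "transpose \<tau> = \<tau>" using \<tau> by (simp add: siegel_real_def siegel_def)
  define k where "k = exp (- (of_real pi * \<i> * cdot (rvec \<alpha>) (\<tau> *v rvec \<alpha>)) - 2 * of_real pi * \<i> * cdot (rvec \<alpha>) z
     + of_real pi * \<i> * of_real (\<alpha> \<bullet> (M_matrix lam *v \<alpha>) / 2))"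
  have "exp (of_real pi * \<i> * cdot (cvec m) (\<tau> *v cvec m) + 2 * of_real pi * \<i> * cdot (cvec m) (\<tau> *v rvec \<alpha> + z))
     = k * (theta_coeff lam \<tau> \<alpha> m * exp (2 * of_real pi * \<i> * cdot (freq \<alpha> m) z))" for m
    unfolding k_def theta_coeff_def exp_add[symmetric] freq_def
    by (simp add: matrix_vector_right_distrib cdot_add_right cdot_add_left
        cdot_symmetric_matrix[OF sym, of "rvec \<alpha>" "cvec m"] algebra_simps)
  then have "theta \<tau> (\<tau> *v rvec \<alpha> + z) = k * trig (theta_coeff lam \<tau> \<alpha>) \<alpha> z"
    by (simp add: theta_def trig_def infsum_cmult_right')
  moreover have "k \<noteq> 0" by (simp add: k_def)
  ultimately show ?thesis by simp
qed

text \<open>Conjugation negates the frequency \<open>m + \<alpha>\<close>, and because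
  \<open>2 \<alpha> = n\<close> is integral the negative is again a frequency, that of the index
  \<open>- m - n\<close>. The coefficients are real and even in the frequency, so conjugation only
  permutes the terms.\<close>

lemma trig_theta_coeff_real:
  assumes \<tau>: "\<tau> \<in> siegel_real lam" and n: "\<And>i. of_int (n $ i) = 2 * \<alpha> $ i"
    and p: "M_matrix lam *v \<alpha> = ivec p"
  shows "Im (trig (theta_coeff lam \<tau> \<alpha>) \<alpha> (rvec x)) = 0"
proof -
  let ?c = "theta_coeff lam \<tau> \<alpha>"
  have fr: "freq \<alpha> (- m - n) = - freq \<alpha> m" for m
    using n by (simp add: vec_eq_iff freq_nth)
  have c: "?c (- m - n) = ?c m" for m
    by (simp add: theta_coeff_def fr vec.neg cdot_def sum_negf)
  have "cnj (trig ?c \<alpha> (rvec x)) = (\<Sum>\<^sub>\<infinity>m. cnj (?c m * exp (2 * of_real pi * \<i> * cdot (freq \<alpha> m) (rvec x))))"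
    unfolding trig_def infsum_cnj ..
  also have "\<dots> = (\<Sum>\<^sub>\<infinity>m. ?c (- m - n) * exp (2 * of_real pi * \<i> * cdot (freq \<alpha> (- m - n)) (rvec x)))"
  proof (rule infsum_cong)
    fix m
    have "cnj (cdot (freq \<alpha> m) (rvec x)) = cdot (freq \<alpha> m) (rvec x)"
      by (simp add: cdot_def freq_nth rvec_def)
    moreover have "cdot (freq \<alpha> (- m - n)) (rvec x) = - cdot (freq \<alpha> m) (rvec x)"
      by (simp add: fr cdot_def sum_negf)
    ultimately show "cnj (?c m * exp (2 * of_real pi * \<i> * cdot (freq \<alpha> m) (rvec x)))
       = ?c (- m - n) * exp (2 * of_real pi * \<i> * cdot (freq \<alpha> (- m - n)) (rvec x))"
      by (simp add: c cnj_theta_coeff[OF \<tau> p] exp_cnj)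
  qed
  also have "\<dots> = trig ?c \<alpha> (rvec x)"
    unfolding trig_def
    by (rule infsum_reindex_bij_witness[of _ "\<lambda>m. - m - n" "\<lambda>m. - m - n"]) auto
  finally show ?thesis by (auto dest: arg_cong[of _ _ Im])
qed

text \<open>Being fixed means that \<open>cnj_vec z - z\<close> is a lattice vector
  \<open>p + \<tau> n\<close>. Its imaginary part determines that of \<open>z\<close> and gives
  \<open>\<alpha> = - n / 2\<close>; its real part vanishes, which says that
  \<open>M \<alpha>\<close> is \<open>p\<close>.\<close>

lemma real_point_representative:
  assumes \<tau>: "\<tau> \<in> siegel_real lam" and P: "tproj \<tau> z \<in> real_points \<tau>"
  obtains \<alpha> \<beta> n p where "z = \<tau> *v rvec \<alpha> + rvec \<beta>" "\<And>i. of_int (n $ i) = 2 * \<alpha> $ i"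
    "M_matrix lam *v \<alpha> = ivec p"
proof -
  have "tproj \<tau> (cnj_vec z) = tproj \<tau> z"
    using P by (simp add: real_points_def S_conj_tproj[OF \<tau>])
  then obtain p n where pn: "cnj_vec z - z = rvec (ivec p) + \<tau> *v rvec (ivec n)"
    unfolding tproj_eq_iff lattice_def cvec_eq_rvec by blast
  define \<alpha> where "\<alpha> = - (1 / 2) *\<^sub>R ivec n"
  have n: "ivec n = -2 *\<^sub>R \<alpha>" by (simp add: \<alpha>_def)
  have "- 2 *\<^sub>R im_vec z = im_vec (cnj_vec z - z)" by (simp add: im_vec_diff im_vec_cnj scaleR_2)
  also have "\<dots> = im_mat \<tau> *v ivec n"
    unfolding pn im_vec_period[symmetric] by (simp add: im_vec_def rvec_def vec_eq_iff)
  also have "\<dots> = -2 *\<^sub>R (im_mat \<tau> *v \<alpha>)" unfolding n by (rule matrix_vector_mult_scaleR)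
  finally have "im_vec z = im_mat \<tau> *v \<alpha>" by simp
  then have "im_vec (z - \<tau> *v rvec \<alpha>) = 0" by (simp add: im_vec_diff im_vec_period)
  then have z: "z = \<tau> *v rvec \<alpha> + rvec (re_vec (z - \<tau> *v rvec \<alpha>))"
    using eq_rvec_re_vec by (metis add.commute diff_add_cancel)
  have "0 = re_vec (cnj_vec z - z)" by (simp add: re_vec_def cnj_vec_def vec_eq_iff)
  also have "\<dots> = ivec p + re_vec (\<tau> *v rvec (ivec n))"
    unfolding pn by (simp add: re_vec_def rvec_def vec_eq_iff)
  also have "\<dots> = ivec p - M_matrix lam *v \<alpha>"
    unfolding re_vec_period[OF \<tau>] n matrix_vector_mult_scaleR by simp
  finally have p: "M_matrix lam *v \<alpha> = ivec p" by simp
  show thesis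
  proof (rule that[OF z _ p])
    show "of_int ((- n) $ i) = 2 * \<alpha> $ i" for i by (simp add: \<alpha>_def ivec_def)
  qed
qed

section \<open>The dimension of the intersection\<close>

lemma rvec_linear: "linear rvec"
  by (rule linearI) (simp_all add: rvec_add, simp add: rvec_def vec_eq_iff scaleR_conv_of_real[where 'a = complex])

text \<open>A real translation leaves \<open>cnj_vec z - z\<close> unchanged, so real points stay
  real, and the translates form the continuous image of a convex set. In this way a component
  contains all real translates of its points.\<close>

lemma real_translate_connected:
  assumes \<tau>: "\<tau> \<in> siegel_real lam" and P: "tproj \<tau> z \<in> real_points \<tau>"
  shows "connectedin (subtopology (torus_topology \<tau>) (real_points \<tau>)) (range (\<lambda>x. tproj \<tau> (z + rvec x)))"
proof -
  have "range (\<lambda>x. tproj \<tau> (z + rvec x)) \<subseteq> real_points \<tau>"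
  proof safe
    fix x
    have "tproj \<tau> (cnj_vec z) = tproj \<tau> z"
      using P by (simp add: real_points_def S_conj_tproj[OF \<tau>])
    then have "cnj_vec (z + rvec x) - (z + rvec x) \<in> lattice \<tau>"
      by (simp add: tproj_eq_iff cnj_vec_add)
    then have "S_conj (tproj \<tau> (z + rvec x)) = tproj \<tau> (z + rvec x)"
      by (simp add: S_conj_tproj[OF \<tau>] tproj_eq_iff)
    then show "tproj \<tau> (z + rvec x) \<in> real_points \<tau>"
      by (simp add: real_points_def torus_def)
  qed
  moreover have "connectedin (torus_topology \<tau>) (tproj \<tau> ` range (\<lambda>x. z + rvec x))"
  proof (rule connectedin_continuous_map_image)
    show "continuous_map euclidean (torus_topology \<tau>) (tproj \<tau>)"
      unfolding continuous_map_def
      by (auto simp: topspace_torus_topology torus_def openin_torus_topology vimage_def)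
    have "continuous_on UNIV (\<lambda>x. z + rvec x)"
      by (intro continuous_intros linear_continuous_on linear_conv_bounded_linear[THEN iffD1] rvec_linear)
    then show "connectedin euclidean (range (\<lambda>x. z + rvec x))"
      unfolding connectedin_iff_connected by (rule connected_continuous_image) (rule convex_connected[OF convex_UNIV])
  qed
  ultimately show ?thesis by (simp add: connectedin_subtopology image_image)
qed

text \<open>Two points in a ball of radius \<open>\<delta> / 2\<close> never differ by a nonzero
  lattice vector. Near any point of the preimage only one translate of \<open>S\<close> is therefore
  visible, and its chart is carried over by translation.\<close>

lemma torus_submanifold_tproj:
  assumes S: "analytic_submanifold d S" and \<delta>: "\<And>l. l \<in> lattice \<tau> \<Longrightarrow> norm l < \<delta> \<Longrightarrow> l = 0"
    and ball: "S \<subseteq> ball a (\<delta> / 2)"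
  shows "torus_submanifold \<tau> d (tproj \<tau> ` S)"
  unfolding torus_submanifold_def
proof (intro conjI allI impI)
  show "tproj \<tau> ` S \<subseteq> torus \<tau>" by (auto simp: torus_def)
  fix U assume U: "open U \<and> inj_on (tproj \<tau>) U"
  show "analytic_submanifold d (U \<inter> tproj \<tau> -` tproj \<tau> ` S)"
    unfolding analytic_submanifold_iff
  proof
    fix p assume p: "p \<in> U \<inter> tproj \<tau> -` tproj \<tau> ` S"
    then obtain s where s: "s \<in> S" "tproj \<tau> p = tproj \<tau> s" by auto
    define l where "l = p - s"
    have l: "l \<in> lattice \<tau>" using s(2) by (simp add: l_def tproj_eq_iff)
    have "submanifold_chart d ((+) l ` S) p"
      using analytic_submanifold_translation[OF S, of l] s(1)
      unfolding analytic_submanifold_iff by (auto simp: l_def)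
    then show "submanifold_chart d (U \<inter> tproj \<tau> -` tproj \<tau> ` S) p"
    proof (rule submanifold_chart_cong)
      show "open (U \<inter> ball (l + a) (\<delta> / 2))" using U by auto
      have "dist (l + a) p = dist a s" by (simp add: l_def dist_norm algebra_simps)
      then show "p \<in> U \<inter> ball (l + a) (\<delta> / 2)" using p s(1) ball by auto
      show "U \<inter> ball (l + a) (\<delta> / 2) \<inter> (+) l ` S
          = U \<inter> ball (l + a) (\<delta> / 2) \<inter> (U \<inter> tproj \<tau> -` tproj \<tau> ` S)"
      proof (intro equalityI subsetI)
        fix q assume q: "q \<in> U \<inter> ball (l + a) (\<delta> / 2) \<inter> (+) l ` S"
        then obtain s' where s': "s' \<in> S" "q = l + s'" by auto
        then have "tproj \<tau> q = tproj \<tau> s'" using l by (simp add: tproj_eq_iff)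
        with q s'(1) show "q \<in> U \<inter> ball (l + a) (\<delta> / 2) \<inter> (U \<inter> tproj \<tau> -` tproj \<tau> ` S)" by auto
      next
        fix q assume q: "q \<in> U \<inter> ball (l + a) (\<delta> / 2) \<inter> (U \<inter> tproj \<tau> -` tproj \<tau> ` S)"
        then obtain s' where s': "s' \<in> S" "tproj \<tau> q = tproj \<tau> s'" by auto
        have "q - s' \<in> lattice \<tau>" using s'(2) by (simp add: tproj_eq_iff)
        then have "(q - s') - l \<in> lattice \<tau>" using l by (rule lattice_diff)
        moreover have "norm ((q - s') - l) < \<delta>"
        proof -
          have "norm ((q - s') - l) = norm ((a - s') - ((l + a) - q))" by (simp add: algebra_simps)
          also have "\<dots> \<le> norm (a - s') + norm ((l + a) - q)" by (rule norm_triangle_ineq4)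
          also have "\<dots> < \<delta> / 2 + \<delta> / 2"
            using ball s'(1) q by (intro add_strict_mono) (auto simp: dist_norm)
          finally show ?thesis by simp
        qed
        ultimately have "(q - s') - l = 0" by (rule \<delta>)
        then have "q = l + s'" by (simp add: algebra_simps)
        with q s'(1) show "q \<in> U \<inter> ball (l + a) (\<delta> / 2) \<inter> (+) l ` S" by auto
      qed
    qed
  qed
qed

lemma theta_divisor_contains_hypersurface:
  fixes \<tau> :: "complex^('n::{finite,linorder})^('n::{finite,linorder})"
  assumes \<tau>: "\<tau> \<in> siegel_real lam"
    and n: "\<And>i. of_int (n $ i) = 2 * \<alpha> $ i" and p: "M_matrix lam *v \<alpha> = ivec p"
    and j: "odd (n $ j)"
  obtains N where "N \<noteq> {}" "torus_submanifold \<tau> (CARD('n) - 1) N" "N \<subseteq> theta_divisor \<tau>"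
    "N \<subseteq> range (\<lambda>x. tproj \<tau> (\<tau> *v rvec \<alpha> + rvec x))"
proof -
  let ?c = "theta_coeff lam \<tau> \<alpha>"
  have sg: "\<tau> \<in> siegel" and sym: "transpose \<tau> = \<tau>"
    using \<tau> by (simp_all add: siegel_real_def siegel_def)
  obtain q where q: "n $ j = 2 * q + 1" using j by (rule oddE)
  \<comment> \<open>The \<open>j\<close>-th entry of \<open>\<alpha>\<close> is half an odd integer,
    so the multiplier under translation by \<open>axis j 1\<close> is -1.\<close>
  have "of_real (\<alpha> $ j) = of_int q + (1 / 2 :: complex)"
    using n[of j] q by (simp add: complex_eq_iff)
  then have "exp (2 * of_real pi * \<i> * of_real (\<alpha> $ j)) = exp (2 * of_real pi * \<i> * of_int q) * exp (of_real pi * \<i>)"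
    by (simp add: exp_add[symmetric] algebra_simps)
  also have "exp (2 * of_real pi * \<i> * of_int q) = 1"
    using exp_integer_2pi[of "of_int q"] by (simp add: mult_ac)
  finally have odd: "exp (2 * of_real pi * \<i> * of_real (\<alpha> $ j)) = -1" by simp
  obtain V and H :: "complex^('n::{finite,linorder}) \<Rightarrow> real" where V: "open V" "V \<noteq> {}" and H: "real_analytic_on H V"
    and zero: "\<And>y. y \<in> V \<Longrightarrow> trig ?c \<alpha> (re_except j y + of_real (H y) *s axis j 1) = 0"
    and V_cong: "\<And>y y'. re_except j y = re_except j y' \<Longrightarrow> y \<in> V \<Longrightarrow> y' \<in> V"
    and H_cong: "\<And>y y'. re_except j y = re_except j y' \<Longrightarrow> H y = H y'"
    by (rule trig_analytic_zero[OF rapid_decay_theta_coeff[OF \<tau>] theta_coeff_nonzero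
        trig_theta_coeff_real[OF \<tau> n p] odd], rule that)
  define G where "G = {y \<in> V. (\<forall>i. Im (y $ i) = 0) \<and> Re (y $ j) = H y}"
  have G: "analytic_submanifold (CARD('n) - 1) G"
    unfolding G_def
  proof (rule analytic_submanifold_graph[OF V(1) H])
    have re: "re_except j y = re_except j y'" if "\<forall>i. i \<noteq> j \<longrightarrow> Re (y $ i) = Re (y' $ i)" for y y'
      using that by (auto simp: re_except_def vec_eq_iff)
    show "y' \<in> V" if "\<forall>i. i \<noteq> j \<longrightarrow> Re (y $ i) = Re (y' $ i)" "y \<in> V" for y y'
      by (rule V_cong[OF re[OF that(1)] that(2)])
    show "H y = H y'" if "\<forall>i. i \<noteq> j \<longrightarrow> Re (y $ i) = Re (y' $ i)" for y y'
      by (rule H_cong[OF re[OF that]])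
  qed
  obtain y0 where y0: "y0 \<in> V" using V(2) by blast
  \<comment> \<open>The point of the graph on the line labelled by \<open>y0\<close>; it witnesses
    that \<open>G\<close> is nonempty.\<close>
  define y1 where "y1 = re_except j y0 + of_real (H y0) *s axis j 1"
  have re1: "re_except j y0 = re_except j y1"
    by (auto simp: y1_def re_except_def vec_eq_iff axis_def)
  have "Im (y1 $ i) = 0" for i by (auto simp: y1_def re_except_def axis_def)
  moreover have "Re (y1 $ j) = H y1" unfolding H_cong[OF re1, symmetric] by (simp add: y1_def re_except_def axis_def)
  ultimately have y1: "y1 \<in> G" using V_cong[OF re1 y0] by (simp add: G_def)
  have trigG: "trig ?c \<alpha> y = 0 \<and> y = rvec (re_vec y)" if "y \<in> G" for y
  proof -
    have "re_except j y + of_real (H y) *s axis j 1 = y"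
      using that by (auto simp: G_def re_except_def axis_def vec_eq_iff complex_eq_iff)
    moreover have "im_vec y = 0" using that by (simp add: G_def im_vec_def vec_eq_iff)
    ultimately show ?thesis using zero[of y] that eq_rvec_re_vec[of y] by (simp add: G_def)
  qed
  obtain \<delta> where \<delta>: "\<delta> > 0" "\<And>l. l \<in> lattice \<tau> \<Longrightarrow> norm l < \<delta> \<Longrightarrow> l = 0"
    using lattice_discrete[OF sg] by blast
  define a where "a = \<tau> *v rvec \<alpha> + y1"
  \<comment> \<open>Only the part of \<open>G\<close> within \<open>\<delta> / 2\<close> of
    \<open>y1\<close> is kept, so that the quotient map is injective on its translate.\<close>
  define S where "S = (+) (\<tau> *v rvec \<alpha>) ` (ball y1 (\<delta> / 2) \<inter> G)"
  have "analytic_submanifold (CARD('n) - 1) (ball y1 (\<delta> / 2) \<inter> G)"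
    unfolding analytic_submanifold_iff
  proof
    fix y assume y: "y \<in> ball y1 (\<delta> / 2) \<inter> G"
    then have "submanifold_chart (CARD('n) - 1) G y" using G by (simp add: analytic_submanifold_iff)
    then show "submanifold_chart (CARD('n) - 1) (ball y1 (\<delta> / 2) \<inter> G) y"
      by (rule submanifold_chart_cong[where V = "ball y1 (\<delta> / 2)"]) (use y in auto)
  qed
  then have S: "analytic_submanifold (CARD('n) - 1) S"
    unfolding S_def by (rule analytic_submanifold_translation)
  show thesis
  proof (rule that)
    have "y1 \<in> ball y1 (\<delta> / 2) \<inter> G" using y1 \<delta>(1) by simp
    then show "tproj \<tau> ` S \<noteq> {}" unfolding S_def by blast
    show "torus_submanifold \<tau> (CARD('n) - 1) (tproj \<tau> ` S)"
      by (rule torus_submanifold_tproj[OF S \<delta>(2), where a = a]) (auto simp: S_def a_def dist_norm)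
    show "tproj \<tau> ` S \<subseteq> theta_divisor \<tau>"
      unfolding S_def using trigG
      by (auto simp: tproj_mem_theta_divisor_iff[OF sym] theta_eq_0_iff[OF \<tau>])
    show "tproj \<tau> ` S \<subseteq> range (\<lambda>x. tproj \<tau> (\<tau> *v rvec \<alpha> + rvec x))"
    proof
      fix Q assume "Q \<in> tproj \<tau> ` S"
      then obtain y where y: "y \<in> G" and Q: "Q = tproj \<tau> (\<tau> *v rvec \<alpha> + y)" unfolding S_def by blast
      have "Q = tproj \<tau> (\<tau> *v rvec \<alpha> + rvec (re_vec y))" using trigG[OF y] Q by simp
      then show "Q \<in> range (\<lambda>x. tproj \<tau> (\<tau> *v rvec \<alpha> + rvec x))" by blast
    qed
  qed
qed

text \<open>The charts of \<open>N\<close> live in real dimension \<open>2g\<close>; the drop to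
  \<open>g\<close> comes from the real points, which near \<open>z\<close> all lie in
  \<open>z + \<real>^g\<close>. This turns a chart into a continuous injection of an open piece of a
  \<open>d\<close>-dimensional subspace into \<open>\<real>^g\<close>.\<close>

lemma theta_divisor_real_submanifold_dim:
  fixes \<tau> :: "complex^('n::{finite,linorder})^('n::{finite,linorder})"
  assumes \<tau>: "\<tau> \<in> siegel_real lam"
    and N: "torus_submanifold \<tau> d N" "N \<noteq> {}" "N \<subseteq> theta_divisor \<tau>" "N \<subseteq> real_points \<tau>"
  shows "d < CARD('n)"
proof (rule ccontr)
  assume "\<not> d < CARD('n)"
  then have d: "d \<ge> CARD('n)" by simp
  have sg: "\<tau> \<in> siegel" and sym: "transpose \<tau> = \<tau>"
    using \<tau> by (simp_all add: siegel_real_def siegel_def)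
  obtain \<delta> where \<delta>: "\<delta> > 0" "\<And>l. l \<in> lattice \<tau> \<Longrightarrow> norm l < \<delta> \<Longrightarrow> l = 0"
    using lattice_discrete[OF sg] by blast
  obtain P where "P \<in> N" using N(2) by blast
  moreover from this N(4) have "P \<in> torus \<tau>" by (auto simp: real_points_def)
  ultimately obtain z where z: "tproj \<tau> z \<in> N" by (auto simp: torus_def)
  then have zr: "tproj \<tau> z \<in> real_points \<tau>" using N(4) by blast
  obtain \<alpha> \<beta> where z_eq: "z = \<tau> *v rvec \<alpha> + rvec \<beta>"
    using real_point_representative[OF \<tau> zr] by blast
  let ?U = "ball z (\<delta> / 2)"
  have cnj_diff: "cnj_vec u - u \<in> lattice \<tau>" if "tproj \<tau> u \<in> real_points \<tau>" for u
    using that by (simp add: real_points_def S_conj_tproj[OF \<tau>] tproj_eq_iff)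
  have "inj_on (tproj \<tau>) ?U"
  proof (rule inj_onI)
    fix u v assume uv: "u \<in> ?U" "v \<in> ?U" "tproj \<tau> u = tproj \<tau> v"
    have "norm (u - v) \<le> dist z u + dist z v"
      using dist_triangle2[of u v z] by (simp add: dist_norm norm_minus_commute)
    also have "\<dots> < \<delta>" using uv(1,2) by simp
    finally have "u - v = 0" using uv(3) by (intro \<delta>(2)) (simp_all add: tproj_eq_iff)
    then show "u = v" by simp
  qed
  then have "analytic_submanifold d (?U \<inter> tproj \<tau> -` N)"
    using N(1) by (simp add: torus_submanifold_def)
  then have "submanifold_chart d (?U \<inter> tproj \<tau> -` N) z"
    using z \<delta>(1) by (simp add: analytic_submanifold_iff)
  then obtain U W and \<phi> \<psi> :: "complex^('n::{finite,linorder}) \<Rightarrow> complex^('n::{finite,linorder})" and L where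
    ch: "open U" "z \<in> U" "open W" "homeomorphism U W \<phi> \<psi>" "subspace L" "dim L = d"
      "\<phi> ` (?U \<inter> tproj \<tau> -` N \<inter> U) = L \<inter> W"
    unfolding submanifold_chart_def by blast
  have \<psi>\<phi>: "\<And>x. x \<in> U \<Longrightarrow> \<psi> (\<phi> x) = x" and \<phi>\<psi>: "\<And>x. x \<in> W \<Longrightarrow> \<phi> (\<psi> x) = x"
    and cont: "continuous_on W \<psi>"
    using ch(4) unfolding homeomorphism_def by auto
  define f where "f w = re_vec (\<psi> w - z)" for w
  have f: "\<psi> w = z + rvec (f w) \<and> tproj \<tau> (\<psi> w) \<in> N" if "w \<in> L \<inter> W" for w
  proof -
    have "w \<in> \<phi> ` (?U \<inter> tproj \<tau> -` N \<inter> U)" unfolding ch(7) by (rule that)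
    then obtain u where u: "u \<in> ?U" "tproj \<tau> u \<in> N" "u \<in> U" "w = \<phi> u" by auto
    have u_eq: "\<psi> w = u" using \<psi>\<phi> u by simp
    \<comment> \<open>For real points these differences lie in the discrete lattice, so they cannot
      vary over the ball of radius \<open>\<delta> / 2\<close>; hence \<open>u - z\<close> is
      real.\<close>
    have "(cnj_vec u - u) - (cnj_vec z - z) \<in> lattice \<tau>"
      using u(2) zr N(4) by (intro lattice_diff cnj_diff) auto
    moreover have "norm ((cnj_vec u - u) - (cnj_vec z - z)) < \<delta>"
    proof -
      have "norm (cnj_vec (u - z)) = norm (u - z)"
        by (simp add: norm_vec_def cnj_vec_def del: complex_cnj_diff vector_minus_component)
      moreover have eq: "(cnj_vec u - u) - (cnj_vec z - z) = cnj_vec (u - z) - (u - z)"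
        by (simp add: cnj_vec_def vec_eq_iff)
      ultimately have "norm ((cnj_vec u - u) - (cnj_vec z - z)) \<le> norm (u - z) + norm (u - z)"
        unfolding eq using norm_triangle_ineq4[of "cnj_vec (u - z)" "u - z"] by simp
      then show ?thesis using u(1) by (simp add: dist_norm norm_minus_commute)
    qed
    ultimately have "(cnj_vec u - u) - (cnj_vec z - z) = 0" by (rule \<delta>(2))
    then have "im_vec (u - z) = 0" by (simp add: im_vec_def cnj_vec_def vec_eq_iff complex_eq_iff)
    then show ?thesis using eq_rvec_re_vec[of "u - z"] u(2) by (simp add: f_def u_eq algebra_simps)
  qed
  have contf: "continuous_on (L \<inter> W) f"
    unfolding f_def re_vec_def
    by (intro continuous_intros continuous_on_subset[OF cont]) auto
  have inj: "inj_on f (L \<inter> W)"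
  proof (rule inj_onI)
    fix v w assume v: "v \<in> L \<inter> W" and w: "w \<in> L \<inter> W" and "f v = f w"
    then have "\<phi> (\<psi> v) = \<phi> (\<psi> w)" using f[OF v] f[OF w] by simp
    then show "v = w" using \<phi>\<psi> v w by simp
  qed
  have "openin (top_of_set (UNIV :: (real^('n::{finite,linorder})) set)) (f ` (L \<inter> W))"
  proof (rule invariance_of_domain_subspaces[where U = L, OF _ ch(5) _ _ contf _ inj])
    show "openin (top_of_set L) (L \<inter> W)" using ch(3) by (rule openin_open_Int)
    show "dim (UNIV :: (real^('n::{finite,linorder})) set) \<le> dim L" using d ch(6) by simp
  qed auto
  then have op: "open (f ` (L \<inter> W))" by simp
  \<comment> \<open>The chart point of \<open>z\<close> is sent to 0, so the open image contains a
    ball about 0, that is, real translates filling a ball about \<open>\<beta>\<close>.\<close>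
  have "\<phi> z \<in> L \<inter> W" using ch(2,7) z \<delta>(1) by (auto simp: ch(7)[symmetric])
  moreover have "f (\<phi> z) = 0" using \<psi>\<phi>[OF ch(2)] by (simp add: f_def re_vec_def vec_eq_iff)
  ultimately have "0 \<in> f ` (L \<inter> W)" by (metis imageI)
  then obtain e where e: "e > 0" "ball 0 e \<subseteq> f ` (L \<inter> W)"
    using op open_contains_ball by blast
  have "trig (theta_coeff lam \<tau> \<alpha>) \<alpha> (rvec x) = 0" if "norm (x - \<beta>) < e" for x
  proof -
    have "x - \<beta> \<in> f ` (L \<inter> W)" using that e(2) by (auto simp: dist_norm norm_minus_commute)
    then obtain w where w: "w \<in> L \<inter> W" "x - \<beta> = f w" by blast
    have "\<psi> w = \<tau> *v rvec \<alpha> + rvec x"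
      using f[OF w(1)] by (simp add: z_eq w(2)[symmetric] rvec_diff)
    then have "tproj \<tau> (\<tau> *v rvec \<alpha> + rvec x) \<in> theta_divisor \<tau>"
      using f[OF w(1)] N(3) by auto
    then show ?thesis
      by (simp add: tproj_mem_theta_divisor_iff[OF sym] theta_eq_0_iff[OF \<tau>])
  qed
  then have "trig (theta_coeff lam \<tau> \<alpha>) \<alpha> (rvec x) = 0" for x
    by (rule trig_eq_0_everywhere[OF rapid_decay_theta_coeff[OF \<tau>] e(1)])
  then have "theta_coeff lam \<tau> \<alpha> 0 = 0"
    by (rule trig_eq_0_imp_coeff_0[OF rapid_decay_theta_coeff[OF \<tau>]])
  then show False by (simp add: theta_coeff_nonzero)
qed

theorem theorem1p3:
  fixes \<tau> :: "complex^('n::{finite,linorder})^('n::{finite,linorder})"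
    and lam :: nat
    and R :: "(complex^('n::{finite,linorder})) set set"
  assumes "orthosymmetric_type CARD('n) lam"
    and "\<tau> \<in> siegel_real lam"
    and "R \<in> real_components \<tau>"
    and "tproj \<tau> 0 \<notin> R"
  shows "real_analytic_dim \<tau> (theta_divisor \<tau> \<inter> R) = ereal (real CARD('n) - 1)"
proof -
  note \<tau> = assms(2)
  let ?X = "subtopology (torus_topology \<tau>) (real_points \<tau>)"
  have R: "R \<in> connected_components_of ?X" using assms(3) by (simp add: real_components_def)
  have R_real: "R \<subseteq> real_points \<tau>"
    using connected_components_of_subset[OF R] by simp
  obtain P where P: "P \<in> R" using nonempty_connected_components_of[OF R] by blast
  then obtain z where z: "P = tproj \<tau> z" using R_real by (auto simp: real_points_def torus_def)
  have zr: "tproj \<tau> z \<in> real_points \<tau>" using P R_real z by blast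
  obtain \<alpha> \<beta> n p where z_eq: "z = \<tau> *v rvec \<alpha> + rvec \<beta>" and n: "\<And>i. of_int (n $ i) = 2 * \<alpha> $ i"
    and p: "M_matrix lam *v \<alpha> = ivec p"
    using real_point_representative[OF \<tau> zr] by blast
  have sub: "range (\<lambda>x. tproj \<tau> (z + rvec x)) \<subseteq> R"
  proof (rule connected_components_of_maximal[OF R real_translate_connected[OF \<tau> zr]])
    have "tproj \<tau> (z + rvec 0) \<in> R" using P z by simp
    then show "\<not> disjnt R (range (\<lambda>x. tproj \<tau> (z + rvec x)))" using rangeI[of "\<lambda>x. tproj \<tau> (z + rvec x)" 0] by (auto simp: disjnt_iff)
  qed
  have sub': "tproj \<tau> (\<tau> *v rvec \<alpha> + rvec x) \<in> R" for x
  proof -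
    have "tproj \<tau> (z + rvec (x - \<beta>)) \<in> R" using sub by blast
    then show ?thesis by (simp add: z_eq rvec_diff)
  qed
  \<comment> \<open>With all entries even, \<open>\<alpha>\<close> would be integral and
    \<open>\<tau> \<alpha>\<close> a lattice vector, so the real translates of \<open>z\<close>
    inside \<open>R\<close> would include the zero of the torus.\<close>
  have "\<exists>j. odd (n $ j)"
  proof (rule ccontr)
    assume "\<not> ?thesis"
    then have "n $ i = 2 * (n $ i div 2)" for i by simp
    then have "\<alpha> $ i = of_int (n $ i div 2)" for i
      using n[of i] by (metis mult_cancel_left of_int_mult of_int_numeral zero_neq_numeral)
    then have "\<alpha> = ivec (\<chi> i. n $ i div 2)" by (simp add: ivec_def vec_eq_iff)
    then have "\<tau> *v rvec \<alpha> + rvec 0 - 0 = cvec 0 + \<tau> *v cvec (\<chi> i. n $ i div 2)"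
      by (simp add: cvec_eq_rvec)
    then have "\<tau> *v rvec \<alpha> + rvec 0 - 0 \<in> lattice \<tau>" unfolding lattice_def by blast
    then have "tproj \<tau> 0 \<in> R" using sub'[of 0] by (simp only: tproj_eq_iff[symmetric])
    with assms(4) show False by simp
  qed
  then obtain j where j: "odd (n $ j)" ..
  obtain N where N: "N \<noteq> {}" "torus_submanifold \<tau> (CARD('n) - 1) N" "N \<subseteq> theta_divisor \<tau>"
    "N \<subseteq> range (\<lambda>x. tproj \<tau> (\<tau> *v rvec \<alpha> + rvec x))"
    using theta_divisor_contains_hypersurface[OF \<tau> n p j] by blast
  have "N \<subseteq> theta_divisor \<tau> \<inter> R" using N(3,4) sub' by blast
  then have mem: "CARD('n) - 1 \<in> {d. \<exists>N. N \<noteq> {} \<and> N \<subseteq> theta_divisor \<tau> \<inter> R \<and> torus_submanifold \<tau> d N}"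
    using N(1,2) by blast
  \<comment> \<open>\<open>CARD('n)\<close> is positive, so truncated and real subtraction
    agree.\<close>
  have card: "real (CARD('n) - 1) = real CARD('n) - 1" by (simp add: of_nat_diff Suc_leI)
  show ?thesis
    unfolding real_analytic_dim_def
  proof (rule antisym)
    show "(SUP d\<in>{d. \<exists>N. N \<noteq> {} \<and> N \<subseteq> theta_divisor \<tau> \<inter> R \<and> torus_submanifold \<tau> d N}. ereal (real d))
        \<le> ereal (real CARD('n) - 1)"
    proof (rule SUP_least)
      fix d assume "d \<in> {d. \<exists>N. N \<noteq> {} \<and> N \<subseteq> theta_divisor \<tau> \<inter> R \<and> torus_submanifold \<tau> d N}"
      then obtain N where "N \<noteq> {}" "N \<subseteq> theta_divisor \<tau> \<inter> R" "torus_submanifold \<tau> d N" by blast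
      then have "d < CARD('n)"
        using R_real by (intro theta_divisor_real_submanifold_dim[OF \<tau>, of d N]) auto
      then show "ereal (real d) \<le> ereal (real CARD('n) - 1)" by simp
    qed
    show "ereal (real CARD('n) - 1)
        \<le> (SUP d\<in>{d. \<exists>N. N \<noteq> {} \<and> N \<subseteq> theta_divisor \<tau> \<inter> R \<and> torus_submanifold \<tau> d N}. ereal (real d))"
      unfolding card[symmetric] by (rule SUP_upper[OF mem])
  qed
qed

end
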